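(* Let $d\ge2$, $\kappa\in(0,1/(4d))$, $C,g>0$, $\ell\in\mathbb S^{d-1}$, and suppose the random environment satisfies $(\mathbf{SMG})_{C,g}$. There exist constants $C',C''>0$, depending only on $d,\kappa,C,g,r$, such that the following holds. Assume that $$\inf_{\mathcal B=(R,L-2,L+2,\widetilde L),\ a\in[0,1]}\Big(C'\,\widetilde L^{d-1}L^{4(d-1)+1}\,\mathbb E[\rho_{\mathcal B}^a]\Big)<1,$$ where the infimum runs over $a\in[0,1]$ and all the box specifications $(R,L-2,L+2,\widetilde L)$ where $R$ is a rotation with $R(e_1)=\ell$, $L\ge C''$ and $L\le\widetilde L<L^4$. Then $(T')|\ell$ is satisfied.
   Context: Model. Let $\Lambda=\{e\in\mathbb Z^d:|e|_1=1\}$ and let $\mathcal P_\kappa=\{x\in\mathbb R^{2d}:\sum_{i=1}^{2d}x_i=1,\ x_i\ge 2\kappa\ \forall i\}$ (coordinates indexed by $\Lambda$). Let $\Omega=\mathcal P_\kappa^{\mathbb Z^d}$ with the product $\sigma$-algebra, and let $\mathbb P$ be a probability measure on $\Omega$, stationary and ergodic under spatial shifts, with expectation $\mathbb E$. For $\omega=(\omega(y,e))_{y\in\mathbb Z^d,e\in\Lambda}\in\Omega$ and $x\in\mathbb Z^d$, the quenched law $P_{x,\omega}$ is the law of the Markov chain $(X_n)_{n\ge0}$ on $\mathbb Z^d$ with $X_0=x$ and $P_{x,\omega}[X_{n+1}=X_n+e\mid X_n]=\omega(X_n,e)$, $e\in\Lambda$. The annealed law $P_x$ is the semidirect product $\mathbb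 P\otimes P_{x,\omega}$ (and also its marginal on paths). $|\cdot|_1$ is the $\ell_1$ norm, $d_1$ the $\ell_1$-distance, $\mathbb S^{d-1}$ the Euclidean unit sphere. For $V\subset\mathbb Z^d$, $\partial^rV=\{z\in V^c:d_1(z,V)\le r\}$, $\partial V=\partial^1V$, and $T_V=\inf\{n\ge0:X_n\notin V\}$. Mixing (standing assumption). With $\mathfrak F_A=\sigma(\omega_x:x\in A)$, $\mathbb P$ is $r$-Markovian ($r\ge1$) if for every finite $V\subset\mathbb Z^d$, $\mathbb P[(\omega_x)_{x\in V}\in\cdot\mid\mathfrak F_{V^c}]=\mathbb P[(\omega_x)_{x\in V}\in\cdot\mid\mathfrak F_{\partial^rV}]$ $\mathbb P$-a.s. An $r$-Markovian $\mathbb P$ satisfies $(\mathbf{SMG})_{C,g}$ if for all finite $\Delta\subset V\subset\mathbb Z^d$ with $d_1(\Delta,V^c)\ge r$ and all $A\subset V^c$, $$\frac{d\mathbb P[(\omega_x)_{x\in\Delta}\in\cdot\mid\eta]}{d\mathbb P[(\omega_x)_{x\in\Delta}\in\cdot\mid\eta']}\le\exp\Big(C\sum_{x\in\Delta,y\in A}e^{-g|x-y|_1}\Big)$$ for $\mathbb P$-a.s. all pairs $\eta,\eta'\in\mathcal P_\kappa^{V^c}$ agreeing on $V^c\setminus A$, where $\mathbb P[\cdot\mid\eta]$ is $\mathbb P[\cdot\mid\mathfrak F_{V^c}]$ evaluated at $(\omega_x)_{x\in V^c}=\eta$. Condition $(T')|\ell$. For $c\in\mathbb R$, $u\in\mathbb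 S^{d-1}$ let $T_c^u=\inf\{n\ge0:X_n\cdot u\ge c\}$, $\widetilde T_c^u=\inf\{n\ge0:X_n\cdot u\le c\}$. $(T^\gamma)|\ell$ holds if there is a neighborhood $U\subset\mathbb S^{d-1}$ of $\ell$ such that $\limsup_{L\to\infty}L^{-\gamma}\ln P_0[\widetilde T_{-bL}^{\ell'}<T_L^{\ell'}]<0$ for all $\ell'\in U$ and $b>0$; $(T')|\ell$ means $(T^\gamma)|\ell$ for all $\gamma\in(0,1)$. Box specifications. For a rotation $R$ of $\mathbb R^d$ with $R(e_1)=\ell$ and reals $L,L',\widetilde L>3\sqrt d$, the box specification $\mathcal B=(R,L,L',\widetilde L)$ has box $B_{\mathcal B}=R((-L,L')\times(-\widetilde L,\widetilde L)^{d-1})\cap\mathbb Z^d$ and frontal boundary $\partial^+B_{\mathcal B}=\partial B_{\mathcal B}\cap\{z:z\cdot\ell\ge L',\ |z\cdot R(e_j)|<\widetilde L\ \forall j\in[2,d]\}$. Put $q_{\mathcal B}=P_{0,\omega}[X_{T_{B_{\mathcal B}}}\notin\partial^+B_{\mathcal B}]=1-p_{\mathcal B}$ and $\rho_{\mathcal B}=q_{\mathcal B}/p_{\mathcal B}$. *)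

theory Defs
  imports "HOL-Analysis.Analysis" "HOL-Probability.Probability"
begin

type_synonym 'n site = "(int, 'n) vec"

definition to_real :: "int ^ 'n::finite \<Rightarrow> real ^ 'n" where
  "to_real z = (\<chi> i. real_of_int (z $ i))"

definition norm1 :: "int ^ 'n::finite \<Rightarrow> real" where
  "norm1 z = real_of_int (\<Sum>i\<in>UNIV. \<bar>z $ i\<bar>)"

definition nn_steps :: "(int ^ 'n::finite) set" where
  "nn_steps = {e. norm1 e = 1}"

text \<open>The values are extended reals so that the distance to the empty set is \<open>\<infinity>\<close>.\<close>

definition dist1 :: "(int ^ 'n::finite) set \<Rightarrow> (int ^ 'n) set \<Rightarrow> ereal" where
  "dist1 A B = (INF x\<in>A. INF y\<in>B. ereal (norm1 (x - y)))"

definition outer_boundary :: "real \<Rightarrow> (int ^ 'n::finite) set \<Rightarrow> (int ^ 'n) set" where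
  "outer_boundary r V = {z \<in> - V. dist1 {z} V \<le> ereal r}"

text \<open>\<open>\<omega> y e\<close> is the probability of jumping from \<open>y\<close> to \<open>y + e\<close>.\<close>

type_synonym 'n env = "'n site \<Rightarrow> 'n site \<Rightarrow> real"

definition simplex_kappa :: "real \<Rightarrow> (int ^ 'n::finite \<Rightarrow> real) set" where
  "simplex_kappa \<kappa> =
     {p \<in> extensional nn_steps. (\<Sum>e\<in>nn_steps. p e) = 1 \<and> (\<forall>e\<in>nn_steps. p e \<ge> 2 * \<kappa>)}"

definition site_space :: "real \<Rightarrow> (int ^ 'n::finite \<Rightarrow> real) measure" where
  "site_space \<kappa> = restrict_space (\<Pi>\<^sub>M e\<in>nn_steps. borel) (simplex_kappa \<kappa>)"

definition conf_space :: "real \<Rightarrow> (int ^ 'n::finite) set \<Rightarrow> 'n env measure" where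
  "conf_space \<kappa> V = (\<Pi>\<^sub>M x\<in>V. site_space \<kappa>)"

definition env_shift :: "int ^ 'n::finite \<Rightarrow> 'n env \<Rightarrow> 'n env" where
  "env_shift z \<omega> = (\<lambda>y. \<omega> (y + z))"

definition stationary :: "('n::finite) env measure \<Rightarrow> bool" where
  "stationary P \<longleftrightarrow> (\<forall>z. distr P P (env_shift z) = P)"

definition ergodic :: "('n::finite) env measure \<Rightarrow> bool" where
  "ergodic P \<longleftrightarrow>
     (\<forall>A\<in>sets P. (\<forall>z. env_shift z -` A \<inter> space P = A) \<longrightarrow> measure P A = 0 \<or> measure P A = 1)"

definition random_environment :: "real \<Rightarrow> ('n::finite) env measure \<Rightarrow> bool" where
  "random_environment \<kappa> P \<longleftrightarrow>
     prob_space P \<and> sets P = sets (conf_space \<kappa> UNIV) \<and> stationary P \<and> ergodic P"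

definition env_algebra :: "real \<Rightarrow> (int ^ 'n::finite) set \<Rightarrow> 'n env measure" where
  "env_algebra \<kappa> A =
     vimage_algebra (space (conf_space \<kappa> UNIV)) (\<lambda>\<omega>. restrict \<omega> A) (conf_space \<kappa> A)"

text \<open>The conditional probability of \<open>(\<omega>\<^sub>x)\<^sub>x\<^sub>\<in>\<^sub>V \<in> E\<close> given the coordinates in \<open>A\<close>.\<close>

definition cond_prob_env ::
    "real \<Rightarrow> ('n::finite) env measure \<Rightarrow> (int ^ 'n) set \<Rightarrow> 'n env set \<Rightarrow> (int ^ 'n) set \<Rightarrow> 'n env \<Rightarrow> real" where
  "cond_prob_env \<kappa> P V E A =
     real_cond_exp P (env_algebra \<kappa> A) (indicator {\<omega> \<in> space P. restrict \<omega> V \<in> E})"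

definition r_markovian :: "real \<Rightarrow> real \<Rightarrow> ('n::finite) env measure \<Rightarrow> bool" where
  "r_markovian \<kappa> r P \<longleftrightarrow>
     (\<forall>V. finite V \<longrightarrow> (\<forall>E\<in>sets (conf_space \<kappa> V).
        AE \<omega> in P. cond_prob_env \<kappa> P V E (- V) \<omega> = cond_prob_env \<kappa> P V E (outer_boundary r V) \<omega>))"

text \<open>\<open>K \<eta>\<close> is a version of the law of the coordinates in \<open>\<Delta>\<close> given that the
  configuration on the complement of \<open>V\<close> is \<open>\<eta>\<close>.\<close>

definition regular_cond_law ::
    "real \<Rightarrow> ('n::finite) env measure \<Rightarrow> (int ^ 'n) set \<Rightarrow> (int ^ 'n) set \<Rightarrow> ('n env \<Rightarrow> 'n env measure) \<Rightarrow> bool" where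
  "regular_cond_law \<kappa> P \<Delta> V K \<longleftrightarrow>
     K \<in> conf_space \<kappa> (- V) \<rightarrow>\<^sub>M prob_algebra (conf_space \<kappa> \<Delta>) \<and>
     (\<forall>E\<in>sets (conf_space \<kappa> \<Delta>).
        AE \<omega> in P. measure (K (restrict \<omega> (- V))) E = cond_prob_env \<kappa> P \<Delta> E (- V) \<omega>)"

text \<open>The Radon-Nikodym derivative \<open>d\<mu>/d\<nu>\<close> exists and is at most \<open>c\<close>. The library's
  \<open>RN_deriv\<close> is \<open>0\<close> when there is no density, hence the explicit absolute continuity.\<close>

definition RN_bounded :: "'a measure \<Rightarrow> 'a measure \<Rightarrow> real \<Rightarrow> bool" where
  "RN_bounded \<mu> \<nu> c \<longleftrightarrow>
     absolutely_continuous \<nu> \<mu> \<and> (AE x in \<nu>. RN_deriv \<nu> \<mu> x \<le> ennreal c)"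

text \<open>Pairs \<open>\<eta>, \<eta>'\<close> agreeing off \<open>A\<close> form in general a null set of the product measure;
  ``for almost all pairs'' means that both members range over a set \<open>G\<close> of full measure.
  Two versions of the conditional law agree on such a set, so the choice of \<open>K\<close> is immaterial.\<close>

definition SMG :: "real \<Rightarrow> real \<Rightarrow> real \<Rightarrow> real \<Rightarrow> ('n::finite) env measure \<Rightarrow> bool" where
  "SMG \<kappa> r C g P \<longleftrightarrow> r_markovian \<kappa> r P \<and>
     (\<forall>\<Delta> V A. finite V \<and> \<Delta> \<subseteq> V \<and> dist1 \<Delta> (- V) \<ge> ereal r \<and> A \<subseteq> - V \<longrightarrow>
        (\<exists>K G. regular_cond_law \<kappa> P \<Delta> V K \<and>
           G \<subseteq> space (conf_space \<kappa> (- V)) \<and> (AE \<omega> in P. restrict \<omega> (- V) \<in> G) \<and>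
           (\<forall>\<eta>\<in>G. \<forall>\<eta>'\<in>G. (\<forall>x\<in>- V - A. \<eta> x = \<eta>' x) \<longrightarrow>
              RN_bounded (K \<eta>) (K \<eta>')
                (exp (C * (\<Sum>\<^sub>\<infinity>(x, y)\<in>\<Delta> \<times> A. exp (- g * norm1 (x - y))))))))"

definition jump :: "('n::finite) env \<Rightarrow> int ^ 'n \<Rightarrow> (int ^ 'n) pmf" where
  "jump \<omega> y = map_pmf (\<lambda>e. y + e) (embed_pmf (\<lambda>e. if e \<in> nn_steps then \<omega> y e else 0))"

text \<open>The law of \<open>X\<^sub>n\<close> given the history \<open>(X\<^sub>i)\<^sub>i\<^sub><\<^sub>n\<close>.\<close>

definition walk_kernel ::
    "('n::finite) env \<Rightarrow> int ^ 'n \<Rightarrow> nat \<Rightarrow> (nat \<Rightarrow> int ^ 'n) \<Rightarrow> (int ^ 'n) measure" where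
  "walk_kernel \<omega> x n X =
     measure_pmf (case n of 0 \<Rightarrow> return_pmf x | Suc m \<Rightarrow> jump \<omega> (X m))"

lemma Ionescu_Tulcea_walk_kernel:
  fixes \<omega> :: "('n::finite) env"
  shows "Ionescu_Tulcea (walk_kernel \<omega> x) (\<lambda>_. count_space UNIV)"
proof (rule Ionescu_Tulcea.intro)
  fix n
  show "walk_kernel \<omega> x n
      \<in> (\<Pi>\<^sub>M i\<in>{0..<n}. count_space UNIV) \<rightarrow>\<^sub>M subprob_algebra (count_space UNIV)"
  proof (cases n)
    case 0
    then show ?thesis
      by (simp add: walk_kernel_def[abs_def] measure_pmf_in_subprob_algebra)
  next
    case (Suc m)
    have "(\<lambda>X. X m) \<in> (\<Pi>\<^sub>M i\<in>{0..<Suc m}. count_space UNIV) \<rightarrow>\<^sub>M count_space UNIV"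
      by (rule measurable_component_singleton) simp
    moreover have "(\<lambda>y. measure_pmf (jump \<omega> y)) \<in> count_space UNIV \<rightarrow>\<^sub>M subprob_algebra (count_space UNIV)"
      by (simp add: measure_pmf_in_subprob_algebra)
    ultimately show ?thesis
      using Suc by (simp add: walk_kernel_def[abs_def] measurable_compose)
  qed
next
  fix n and X :: "nat \<Rightarrow> int ^ 'n"
  assume "X \<in> space (\<Pi>\<^sub>M i\<in>{0..<n}. count_space UNIV)"
  show "prob_space (walk_kernel \<omega> x n X)"
    by (simp add: walk_kernel_def measure_pmf.prob_space_axioms)
qed

abbreviation path_space :: "(nat \<Rightarrow> int ^ 'n::finite) measure" where
  "path_space \<equiv> \<Pi>\<^sub>M i\<in>UNIV. count_space UNIV"

text \<open>The path measure with kernels \<open>walk_kernel \<omega> x\<close> given by the Ionescu-Tulcea theorem.\<close>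

definition quenched :: "int ^ 'n::finite \<Rightarrow> 'n env \<Rightarrow> (nat \<Rightarrow> int ^ 'n) measure" where
  "quenched x \<omega> =
     projective_family.lim UNIV (Ionescu_Tulcea.CI (walk_kernel \<omega> x) (\<lambda>_. count_space UNIV))
       (\<lambda>_. count_space UNIV)"

text \<open>Only the marginal on paths of the semidirect product is needed.\<close>

definition annealed :: "('n::finite) env measure \<Rightarrow> int ^ 'n \<Rightarrow> (nat \<Rightarrow> int ^ 'n) measure" where
  "annealed P x = P \<bind> quenched x"

definition first_time :: "(nat \<Rightarrow> bool) \<Rightarrow> enat" where
  "first_time Q = (INF n\<in>{n. Q n}. enat n)"

definition exit_time :: "(int ^ 'n::finite) set \<Rightarrow> (nat \<Rightarrow> int ^ 'n) \<Rightarrow> enat" where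
  "exit_time V X = first_time (\<lambda>n. X n \<notin> V)"

definition up_time :: "real \<Rightarrow> real ^ 'n::finite \<Rightarrow> (nat \<Rightarrow> int ^ 'n) \<Rightarrow> enat" where
  "up_time c u X = first_time (\<lambda>n. to_real (X n) \<bullet> u \<ge> c)"

definition down_time :: "real \<Rightarrow> real ^ 'n::finite \<Rightarrow> (nat \<Rightarrow> int ^ 'n) \<Rightarrow> enat" where
  "down_time c u X = first_time (\<lambda>n. to_real (X n) \<bullet> u \<le> c)"

text \<open>Unlike \<open>ln\<close> on the reals, this takes the value \<open>-\<infinity>\<close> at \<open>0\<close>.\<close>

definition log_ereal :: "real \<Rightarrow> ereal" where
  "log_ereal p = (if p = 0 then -\<infinity> else ereal (ln p))"

definition T_gamma :: "('n::finite) env measure \<Rightarrow> real \<Rightarrow> real ^ 'n \<Rightarrow> bool" where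
  "T_gamma P \<gamma> l \<longleftrightarrow>
     (\<exists>U. openin (top_of_set (sphere 0 1)) U \<and> l \<in> U \<and>
       (\<forall>l'\<in>U. \<forall>b>0.
          Limsup at_top (\<lambda>L::real. ereal (L powr (- \<gamma>)) *
            log_ereal (measure (annealed P 0)
              {X \<in> space path_space. down_time (- b * L) l' X < up_time L l' X})) < 0))"

definition T_prime :: "('n::finite) env measure \<Rightarrow> real ^ 'n \<Rightarrow> bool" where
  "T_prime P l \<longleftrightarrow> (\<forall>\<gamma>\<in>{0<..<1}. T_gamma P \<gamma> l)"

text \<open>The order on the index type serves only to single out the first coordinate.\<close>

definition idx1 :: "'n::{finite,linorder}" where
  "idx1 = Min UNIV"

definition basis_vec :: "'n::finite \<Rightarrow> real ^ 'n" where
  "basis_vec j = axis j 1"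

text \<open>A box specification is a tuple \<open>(R, L, L', M)\<close> with \<open>M\<close> the half-width in the
  directions orthogonal to \<open>R e\<^sub>1\<close>; rotations are given by their matrices.\<close>

type_synonym 'n box_spec = "((real, 'n) vec, 'n) vec \<times> real \<times> real \<times> real"

definition is_box_spec :: "(real, 'n::{finite,linorder}) vec \<Rightarrow> 'n box_spec \<Rightarrow> bool" where
  "is_box_spec l = (\<lambda>(R, L, L', M).
     rotation_matrix R \<and> R *v basis_vec idx1 = l \<and>
     L > 3 * sqrt (CARD('n)) \<and> L' > 3 * sqrt (CARD('n)) \<and> M > 3 * sqrt (CARD('n)))"

definition walk_box :: "('n::{finite,linorder}) box_spec \<Rightarrow> 'n site set" where
  "walk_box = (\<lambda>(R, L, L', M). {z. to_real z \<in> (\<lambda>y. R *v y) `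
     {y. y $ idx1 \<in> {-L<..<L'} \<and> (\<forall>j. j \<noteq> idx1 \<longrightarrow> y $ j \<in> {-M<..<M})}})"

definition front_boundary :: "('n::{finite,linorder}) box_spec \<Rightarrow> 'n site set" where
  "front_boundary = (\<lambda>(R, L, L', M). outer_boundary 1 (walk_box (R, L, L', M)) \<inter>
     {z. to_real z \<bullet> (R *v basis_vec idx1) \<ge> L' \<and>
         (\<forall>j. j \<noteq> idx1 \<longrightarrow> \<bar>to_real z \<bullet> (R *v basis_vec j)\<bar> < M)})"

text \<open>Paths that never leave the box (a null event) are counted as not leaving through
  the front.\<close>

definition q_box :: "('n::{finite,linorder}) box_spec \<Rightarrow> 'n env \<Rightarrow> real" where
  "q_box B \<omega> = measure (quenched 0 \<omega>)
     {X \<in> space path_space.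
        \<not> (exit_time (walk_box B) X \<noteq> \<infinity> \<and> X (the_enat (exit_time (walk_box B) X)) \<in> front_boundary B)}"

definition p_box :: "('n::{finite,linorder}) box_spec \<Rightarrow> 'n env \<Rightarrow> real" where
  "p_box B \<omega> = 1 - q_box B \<omega>"

definition rho_box :: "('n::{finite,linorder}) box_spec \<Rightarrow> 'n env \<Rightarrow> real" where
  "rho_box B \<omega> = q_box B \<omega> / p_box B \<omega>"

end

theory Submission
  imports Defs "HOL-Real_Asymp.Real_Asymp"
begin

text \<open>
  The hypothesis provides one box at a finite scale whose exit odds
  \<open>q/p\<close> have a small fractional moment.  The proof propagates this
  smallness to a growing sequence of scales and reads off a stretched exponential bound for the
  probability of backtracking.

  Exit probabilities are treated throughout as solutions of a Dirichlet problem
  (\<open>hit_harmonic\<close>, \<open>hit_boundary\<close>): the walk enters only through its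
  first step decomposition (\<open>quenched_first_step\<close>), and stopping time arguments become
  applications of the maximum principle on a finite set (\<open>box_comparison\<close>).

  Passing from a box of length \<open>L\<close> and width \<open>M\<close> to one of length
  \<open>N * L\<close> and width \<open>N ^ 3 * M\<close> compares the walk, observed at its
  exits from translates of the small box, with a one-dimensional nearest neighbour walk on slabs of
  thickness \<open>L\<close>.  Up to lateral exits, the odds of leaving the large box through the
  bottom are at most a sum of products of at least \<open>N\<close> slab odds
  (\<open>bottom_exit_odds\<close>).  A lateral exit has to cross about \<open>N\<^sup>2\<close>
  separated strips, and each crossing requires that some small box inside the strip is left through
  the wrong side (\<open>lateral_exit_le\<close>).  The mixing condition makes functionals of
  separated regions almost independent (\<open>mixing_product\<close>).  Slabs whose indices agree
  modulo four are separated, so the moment of order \<open>a/4\<close> at the large scale is bounded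
  by products of moments of order \<open>a\<close> at the small one
  (\<open>one_step_renormalization\<close>).

  With \<open>N\<close> growing by a factor sixteen from each scale to the next, the bounds reproduce
  themselves (\<open>scale_induction\<close>); the loss in the exponent is only a power of sixteen,
  whereas the scales grow superexponentially.  Chaining boxes of one scale in the direction of the
  drift, with a union bound over their centres and stationarity
  (\<open>expected_backtrack_le\<close>), therefore gives the decay
  \<open>exp (- T powr \<gamma>)\<close> for every \<open>\<gamma> < 1\<close>
  (\<open>limsup_from_scales\<close>).

  The criterion survives a small rotation of the box, at the price of changing
  \<open>L - 2\<close>, \<open>L + 2\<close>, \<open>M\<close> into \<open>L - 1\<close>,
  \<open>L + 1\<close>, \<open>M + 1\<close> (\<open>p_box_le_pfront\<close>); this
  yields the whole neighbourhood of directions required by \<open>T_prime\<close>.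
\<close>

section \<open>The quenched path measure\<close>

text \<open>The expectation of \<open>\<Prod>i\<le>n. F i (X\<^sub>i)\<close> for the walk started at \<open>x\<close>,
  written as a word in multiplication operators and the transition operator.  Recursion on the
  left end of the word is what makes the first step decomposition immediate, while the
  Ionescu-Tulcea construction adds steps on the right end; \<open>walk_op_end\<close> reconciles the two.\<close>

primrec walk_op :: "('n::finite) env \<Rightarrow> nat \<Rightarrow> (nat \<Rightarrow> 'n site \<Rightarrow> ennreal) \<Rightarrow> 'n site \<Rightarrow> ennreal" where
  "walk_op \<omega> 0 F x = F 0 x"
| "walk_op \<omega> (Suc n) F x = F 0 x * (\<integral>\<^sup>+y. walk_op \<omega> n (\<lambda>i. F (Suc i)) y \<partial>measure_pmf (jump \<omega> x))"

lemma walk_op_end: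
  "walk_op \<omega> (Suc n) F x =
     walk_op \<omega> n (F(n := \<lambda>y. F n y * (\<integral>\<^sup>+z. F (Suc n) z \<partial>measure_pmf (jump \<omega> y)))) x"
proof (induction n arbitrary: F x)
  case 0
  show ?case by simp
next
  case (Suc n)
  have "(\<lambda>i. (F(Suc n := \<lambda>y. F (Suc n) y * (\<integral>\<^sup>+z. F (Suc (Suc n)) z \<partial>measure_pmf (jump \<omega> y)))) (Suc i))
     = (\<lambda>i. F (Suc i))(n := \<lambda>y. F (Suc n) y * (\<integral>\<^sup>+z. F (Suc (Suc n)) z \<partial>measure_pmf (jump \<omega> y)))"
    by auto
  then show ?case
    by (simp only: walk_op.simps(2)[of \<omega> "Suc n"] Suc.IH[of "\<lambda>i. F (Suc i)"])
       (simp add: )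
qed

lemma component_measurable:
  "i \<in> I \<Longrightarrow> (\<lambda>X. (f :: 'a \<Rightarrow> ennreal) (X i)) \<in> borel_measurable (\<Pi>\<^sub>M i\<in>I. count_space UNIV)"
  by (rule measurable_compose[OF measurable_component_singleton]) auto

lemma nn_integral_walk_C:
  fixes \<omega> :: "('n::finite) env" and x :: "'n site"
  shows "(\<integral>\<^sup>+X. (\<Prod>i\<le>n. F i (X i)) \<partial>Ionescu_Tulcea.C (walk_kernel \<omega> x) (\<lambda>_. count_space UNIV) 0 (Suc n) (\<lambda>_. undefined))
    = walk_op \<omega> n F x"
proof (induction n arbitrary: F)
  interpret IT: Ionescu_Tulcea "walk_kernel \<omega> x" "\<lambda>_. count_space UNIV"
    by (rule Ionescu_Tulcea_walk_kernel)
  {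
    case 0
    have m: "(\<lambda>X. F 0 (X 0)) \<in> borel_measurable (Pi\<^sub>M {0..<Suc 0} (\<lambda>_. count_space UNIV))"
      by (rule component_measurable) simp
    have C: "IT.C 0 (Suc 0) (\<lambda>_. undefined) = IT.eP 0 (\<lambda>_. undefined)"
      using bind_return[OF IT.measurable_eP, of "\<lambda>_. undefined" 0] by (simp add: space_PiM)
    have "(\<integral>\<^sup>+X. F 0 (X 0) \<partial>IT.eP 0 (\<lambda>_. undefined)) = F 0 x"
      by (subst IT.nn_integral_eP) (use m in \<open>auto simp: space_PiM walk_kernel_def\<close>)
    then show ?case
      unfolding C by simp
  next
    case (Suc n)
    have m: "(\<lambda>X. \<Prod>i\<le>k. G i (X i)) \<in> borel_measurable (Pi\<^sub>M {0..<Suc k} (\<lambda>_. count_space UNIV))"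
      for k and G :: "nat \<Rightarrow> 'n site \<Rightarrow> ennreal"
      by (intro borel_measurable_prod_ennreal component_measurable) auto
    have "(\<integral>\<^sup>+X. (\<Prod>i\<le>Suc n. F i (X i)) \<partial>IT.C 0 (Suc (Suc n)) (\<lambda>_. undefined))
       = (\<integral>\<^sup>+X. (\<integral>\<^sup>+Y. (\<Prod>i\<le>Suc n. F i (Y i)) \<partial>IT.eP (Suc n) X) \<partial>IT.C 0 (Suc n) (\<lambda>_. undefined))"
      unfolding IT.C.simps(2)[of 0 "Suc n"]
      by (subst nn_integral_bind[OF m[of F "Suc n"]])
         (use IT.measurable_eP[of "Suc n"] in \<open>auto simp: measurable_cong_sets[OF IT.sets_C] space_PiM simp del: IT.C.simps(2)\<close>)
    also have "\<dots> = (\<integral>\<^sup>+X. (\<Prod>i\<le>n. (F(n := \<lambda>y. F n y * (\<integral>\<^sup>+z. F (Suc n) z \<partial>measure_pmf (jump \<omega> y)))) i (X i)) \<partial>IT.C 0 (Suc n) (\<lambda>_. undefined))"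
    proof (rule nn_integral_cong)
      fix X assume "X \<in> space (IT.C 0 (Suc n) (\<lambda>_. undefined))"
      then have X: "X \<in> space (Pi\<^sub>M {0..<Suc n} (\<lambda>_. count_space UNIV))"
        by (subst (asm) IT.space_C) (auto simp: space_PiM)
      have "(\<integral>\<^sup>+Y. (\<Prod>i\<le>Suc n. F i (Y i)) \<partial>IT.eP (Suc n) X)
          = (\<integral>\<^sup>+z. (\<Prod>i\<le>Suc n. F i ((X(Suc n := z)) i)) \<partial>walk_kernel \<omega> x (Suc n) X)"
        by (rule IT.nn_integral_eP[OF X m])
      also have "\<dots> = (\<integral>\<^sup>+z. (\<Prod>i\<le>n. F i (X i)) * F (Suc n) z \<partial>measure_pmf (jump \<omega> (X n)))"
        by (simp add: walk_kernel_def)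
      also have "\<dots> = (\<Prod>i\<le>n. F i (X i)) * (\<integral>\<^sup>+z. F (Suc n) z \<partial>measure_pmf (jump \<omega> (X n)))"
        by (rule nn_integral_cmult) simp
      also have "\<dots> = (\<Prod>i\<le>n. (F(n := \<lambda>y. F n y * (\<integral>\<^sup>+z. F (Suc n) z \<partial>measure_pmf (jump \<omega> y)))) i (X i))"
        by (simp add: lessThan_Suc_atMost[symmetric] mult_ac)
      finally show "(\<integral>\<^sup>+Y. (\<Prod>i\<le>Suc n. F i (Y i)) \<partial>IT.eP (Suc n) X) = \<dots>" .
    qed
    also have "\<dots> = walk_op \<omega> (Suc n) F x"
      by (simp only: Suc.IH walk_op_end)
    finally show ?case .
  }
qed

text \<open>Rectangles form an intersection-stable generator of the path space, so they determine path measures.\<close>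

definition rect :: "nat \<Rightarrow> (nat \<Rightarrow> 'a set) \<Rightarrow> (nat \<Rightarrow> 'a) set" where
  "rect n A = {X. \<forall>i\<le>n. X i \<in> A i}"

lemma sets_quenched [simp, measurable_cong]: "sets (quenched x \<omega>) = sets path_space"
proof -
  interpret IT: Ionescu_Tulcea "walk_kernel \<omega> x" "\<lambda>_. count_space UNIV"
    by (rule Ionescu_Tulcea_walk_kernel)
  show ?thesis unfolding quenched_def by (rule IT.PF.sets_lim)
qed

lemma space_path_space [simp]: "space path_space = (UNIV :: (nat \<Rightarrow> 'n::finite site) set)"
  by (simp add: space_PiM)

lemma space_quenched [simp]: "space (quenched x \<omega>) = UNIV"
  using sets_eq_imp_space_eq[OF sets_quenched] by (simp add: space_PiM)

lemma emeasure_quenched_rect: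
  fixes \<omega> :: "('n::finite) env"
  shows "emeasure (quenched x \<omega>) (rect n A) = walk_op \<omega> n (\<lambda>i. indicator (A i)) x"
proof -
  interpret IT: Ionescu_Tulcea "walk_kernel \<omega> x" "\<lambda>_. count_space UNIV"
    by (rule Ionescu_Tulcea_walk_kernel)
  let ?B = "Pi\<^sub>E {0..<Suc n} A"
  have B: "?B \<in> sets (Pi\<^sub>M {0..<Suc n} (\<lambda>_. count_space UNIV))"
    by (intro sets_PiM_I_finite) auto
  have r: "rect n A = IT.PF.emb UNIV {0..<Suc n} ?B"
    by (auto simp: rect_def prod_emb_def PiE_iff)
  have "emeasure (quenched x \<omega>) (rect n A) = emeasure (IT.C 0 (Suc n) (\<lambda>_. undefined)) (IT.PF.emb {0..<Suc n} {0..<Suc n} ?B)"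
    unfolding quenched_def r by (subst IT.lim, simp, rule B, rule IT.emeasure_CI) (use B in auto)
  also have "IT.PF.emb {0..<Suc n} {0..<Suc n} ?B = ?B"
    by (auto simp: prod_emb_def PiE_iff)
  also have "emeasure (IT.C 0 (Suc n) (\<lambda>_. undefined)) ?B
     = (\<integral>\<^sup>+X. indicator ?B X \<partial>IT.C 0 (Suc n) (\<lambda>_. undefined))"
    using B IT.sets_C[of "\<lambda>_. undefined" 0 "Suc n"]
    by (subst nn_integral_indicator) (auto simp: space_PiM simp del: IT.C.simps)
  also have "\<dots> = (\<integral>\<^sup>+X. (\<Prod>i\<le>n. indicator (A i) (X i)) \<partial>IT.C 0 (Suc n) (\<lambda>_. undefined))"
  proof (rule nn_integral_cong)
    fix X assume "X \<in> space (IT.C 0 (Suc n) (\<lambda>_. undefined))"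
    then have X: "X \<in> space (Pi\<^sub>M {0..<Suc n} (\<lambda>_. count_space UNIV))"
      by (subst (asm) IT.space_C) (auto simp: space_PiM)
    show "indicator ?B X = (\<Prod>i\<le>n. indicator (A i) (X i) :: ennreal)"
    proof (cases "X \<in> ?B")
      case True
      then show ?thesis by (auto simp: PiE_iff)
    next
      case False
      then obtain i where "i \<le> n" "X i \<notin> A i" using X by (auto simp: space_PiM PiE_iff less_Suc_eq_le)
      then have "(\<Prod>i\<le>n. indicator (A i) (X i) :: ennreal) = 0"
        by (intro prod_zero) (auto intro!: bexI[of _ i])
      then show ?thesis using False by simp
    qed
  qed
  also have "\<dots> = walk_op \<omega> n (\<lambda>i. indicator (A i)) x"
    by (rule nn_integral_walk_C)
  finally show ?thesis .
qed

lemma prob_space_quenched: "prob_space (quenched x \<omega>)"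
proof
  have "emeasure (quenched x \<omega>) (rect 0 (\<lambda>_. UNIV)) = 1"
    unfolding emeasure_quenched_rect by simp
  then show "emeasure (quenched x \<omega>) (space (quenched x \<omega>)) = 1"
    by (simp add: rect_def)
qed

lemma path_measure_eqI:
  fixes P Q :: "(nat \<Rightarrow> 'n::finite site) measure"
  assumes "sets P = sets path_space" "sets Q = sets path_space" "finite_measure P"
    and eq: "\<And>n A. emeasure P (rect n A) = emeasure Q (rect n A)"
  shows "P = Q"
proof (rule measure_eqI_PiM_infinite[OF assms(1,2) _ assms(3)])
  fix A :: "nat \<Rightarrow> 'n site set" and J :: "nat set"
  assume J: "finite J"
  define n where "n = Max (insert 0 J)"
  have n: "\<And>i. i \<in> J \<Longrightarrow> i \<le> n" using J by (auto simp: n_def)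
  have "prod_emb UNIV (\<lambda>_. count_space UNIV) J (Pi\<^sub>E J A) = rect n (\<lambda>i. if i \<in> J then A i else UNIV)"
    using n by (auto simp: prod_emb_def rect_def PiE_iff split: if_splits)
  then show "emeasure P (prod_emb UNIV (\<lambda>_. count_space UNIV) J (Pi\<^sub>E J A))
     = emeasure Q (prod_emb UNIV (\<lambda>_. count_space UNIV) J (Pi\<^sub>E J A))"
    by (simp only: eq)
qed

lemma measurable_case_nat_path [measurable]:
  "case_nat x \<in> path_space \<rightarrow>\<^sub>M (path_space :: (nat \<Rightarrow> 'n::finite site) measure)"
proof (rule measurable_PiM_single')
  fix i :: nat
  show "(\<lambda>X. (case i of 0 \<Rightarrow> x | Suc m \<Rightarrow> X m)) \<in> path_space \<rightarrow>\<^sub>M count_space UNIV"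
    by (cases i) (auto intro: measurable_component_singleton)
qed auto

lemma rect_measurable [measurable]: "rect n A \<in> sets (path_space :: (nat \<Rightarrow> 'n::finite site) measure)"
proof -
  have "rect n A = (\<Inter>i\<in>{..n}. (\<lambda>X. X i) -` A i \<inter> space path_space)"
    by (auto simp: rect_def)
  also have "\<dots> \<in> sets path_space"
    by (intro sets.finite_INT measurable_sets[OF measurable_component_singleton]) auto
  finally show ?thesis .
qed

text \<open>Both sides are path measures that agree on rectangles, where the claim is the defining recursion
  of \<open>walk_op\<close>.\<close>

theorem quenched_first_step:
  fixes \<omega> :: "('n::finite) env"
  assumes A: "A \<in> sets path_space"
  shows "emeasure (quenched x \<omega>) A
    = (\<integral>\<^sup>+y. emeasure (quenched y \<omega>) (case_nat x -` A) \<partial>measure_pmf (jump \<omega> x))"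
proof -
  let ?k = "\<lambda>y. distr (quenched y \<omega>) path_space (case_nat x)"
  let ?N = "measure_pmf (jump \<omega> x) \<bind> ?k"
  have k: "?k \<in> measure_pmf (jump \<omega> x) \<rightarrow>\<^sub>M subprob_algebra path_space"
    by (auto simp: space_subprob_algebra intro!: prob_space_imp_subprob_space prob_space.prob_space_distr[OF prob_space_quenched])
  have kA: "emeasure ?N A = (\<integral>\<^sup>+y. emeasure (quenched y \<omega>) (case_nat x -` A) \<partial>measure_pmf (jump \<omega> x))"
    if "A \<in> sets path_space" for A
    by (subst emeasure_bind[OF _ k that]) (auto simp: emeasure_distr that)
  have N: "sets ?N = sets path_space"
    by (rule sets_bind) auto
  have "quenched x \<omega> = ?N"
  proof (rule path_measure_eqI[OF sets_quenched N])
    show "finite_measure (quenched x \<omega>)"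
      using prob_space_quenched by (rule prob_space.finite_measure)
    fix n and A :: "nat \<Rightarrow> 'n site set"
    show "emeasure (quenched x \<omega>) (rect n A) = emeasure ?N (rect n A)"
    proof (cases n)
      case 0
      have *: "case_nat x -` rect 0 A = (if x \<in> A 0 then UNIV else {})"
        by (auto simp: rect_def)
      have "emeasure (quenched y \<omega>) UNIV = 1" for y
        using prob_space.emeasure_space_1[OF prob_space_quenched] by simp
      then show ?thesis
        using 0 by (subst kA) (auto simp: emeasure_quenched_rect *)
    next
      case (Suc m)
      have *: "case_nat x -` rect (Suc m) A = (if x \<in> A 0 then rect m (\<lambda>i. A (Suc i)) else {})"
      proof -
        have "(\<forall>i\<le>Suc m. (case i of 0 \<Rightarrow> x | Suc j \<Rightarrow> X j) \<in> A i) \<longleftrightarrow> x \<in> A 0 \<and> (\<forall>i\<le>m. X i \<in> A (Suc i))" for X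
          by (auto simp: all_conj_distrib split: nat.splits) 
        then show ?thesis by (auto simp: rect_def)
      qed
      then show ?thesis
        unfolding Suc by (subst kA) (auto simp: emeasure_quenched_rect *)
    qed
  qed
  then show ?thesis using kA[OF A] by simp
qed

lemma finite_nn_steps: "finite (nn_steps :: (int ^ 'n::finite) set)"
proof -
  let ?S = "(\<lambda>f. (\<chi> i. f i) :: int ^ 'n) ` (UNIV \<rightarrow>\<^sub>E {-1..1})"
  have "e \<in> ?S" if "e \<in> nn_steps" for e :: "int ^ 'n"
  proof
    have "(\<Sum>i\<in>UNIV. \<bar>e $ i\<bar>) = 1"
      using that by (simp add: nn_steps_def norm1_def del: of_int_sum)
    then have "\<bar>e $ i\<bar> \<le> 1" for i
      using member_le_sum[of i UNIV "\<lambda>i. \<bar>e $ i\<bar>"] by simp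
    then show "(\<lambda>i. e $ i) \<in> UNIV \<rightarrow>\<^sub>E {-1..1}"
      by (auto simp: abs_le_iff minus_le_iff)
  qed (simp add: vec_eq_iff)
  moreover have "finite ?S" by (intro finite_imageI finite_PiE) auto
  ultimately show ?thesis by (rule finite_subset[OF subsetI])
qed

text \<open>Membership in the space of environments, spelled out pointwise: deterministic statements about
  one environment then need no measure.\<close>

definition env_ok :: "real \<Rightarrow> ('n::finite) env \<Rightarrow> bool" where
  "env_ok \<kappa> \<omega> \<longleftrightarrow> (\<forall>x. \<omega> x \<in> simplex_kappa \<kappa>)"

lemma space_site_space: "space (site_space \<kappa>) = simplex_kappa \<kappa>"
  by (auto simp: site_space_def space_restrict_space space_PiM simplex_kappa_def PiE_def)

lemma space_conf_space: "space (conf_space \<kappa> V) = (\<Pi>\<^sub>E x\<in>V. simplex_kappa \<kappa>)"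
  by (simp add: conf_space_def space_PiM space_site_space)

lemma space_conf_UNIV: "space (conf_space \<kappa> UNIV) = {\<omega>. env_ok \<kappa> \<omega>}"
  by (auto simp: space_conf_space env_ok_def)

lemma env_ok_sum: "env_ok \<kappa> \<omega> \<Longrightarrow> (\<Sum>e\<in>nn_steps. \<omega> x e) = 1"
  and env_ok_ge: "env_ok \<kappa> \<omega> \<Longrightarrow> e \<in> nn_steps \<Longrightarrow> \<omega> x e \<ge> 2 * \<kappa>"
  by (auto simp: env_ok_def simplex_kappa_def)

lemma env_ok_shift: "env_ok \<kappa> \<omega> \<Longrightarrow> env_ok \<kappa> (env_shift z \<omega>)"
  by (auto simp: env_ok_def env_shift_def)

lemma nn_integral_jump:
  fixes \<omega> :: "('n::finite) env"
  assumes ok: "env_ok \<kappa> \<omega>" and "\<kappa> > 0"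
  shows "(\<integral>\<^sup>+y. g y \<partial>measure_pmf (jump \<omega> x)) = (\<Sum>e\<in>nn_steps. ennreal (\<omega> x e) * g (x + e))"
proof -
  let ?f = "\<lambda>e. if e \<in> nn_steps then \<omega> x e else 0"
  have nn: "0 \<le> \<omega> x e" if "e \<in> nn_steps" for e
    using env_ok_ge[OF ok that, of x] \<open>\<kappa> > 0\<close> by simp
  have "(\<integral>\<^sup>+e. ennreal (?f e) \<partial>count_space UNIV) = (\<Sum>e\<in>nn_steps. ennreal (?f e))"
    by (rule nn_integral_count_space'[OF finite_nn_steps]) auto
  also have "\<dots> = 1"
    using env_ok_sum[OF ok, of x] nn by (simp add: sum_ennreal)
  finally have p: "pmf (embed_pmf ?f) e = ?f e" for e
    using nn by (intro pmf_embed_pmf) auto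
  have "(\<integral>\<^sup>+y. g y \<partial>measure_pmf (jump \<omega> x))
     = (\<integral>\<^sup>+e. ennreal (?f e) * g (x + e) \<partial>count_space UNIV)"
    unfolding jump_def nn_integral_map_pmf by (subst nn_integral_measure_pmf) (simp only: p)
  also have "\<dots> = (\<Sum>e\<in>nn_steps. ennreal (?f e) * g (x + e))"
    by (rule nn_integral_count_space'[OF finite_nn_steps]) auto
  also have "\<dots> = (\<Sum>e\<in>nn_steps. ennreal (\<omega> x e) * g (x + e))"
    by (rule sum.cong) auto
  finally show ?thesis .
qed

lemma measurable_env_coordinate [measurable]:
  fixes x e :: "int ^ 'n::finite"
  assumes "e \<in> nn_steps" "x \<in> V"
  shows "(\<lambda>\<omega>. \<omega> x e) \<in> borel_measurable (conf_space \<kappa> V)"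
proof -
  have "(\<lambda>p. p e) \<in> borel_measurable (site_space \<kappa>)"
    unfolding site_space_def
    by (intro measurable_restrict_space1 measurable_component_singleton assms)
  moreover have "(\<lambda>\<omega>. \<omega> x) \<in> conf_space \<kappa> V \<rightarrow>\<^sub>M site_space \<kappa>"
    unfolding conf_space_def by (intro measurable_component_singleton assms)
  ultimately show ?thesis by (rule measurable_compose[rotated])
qed

lemma measurable_walk_op:
  fixes x :: "int ^ 'n::finite"
  assumes "\<kappa> > 0"
  shows "(\<lambda>\<omega>. walk_op \<omega> n F x) \<in> borel_measurable (conf_space \<kappa> UNIV)"
proof (induction n arbitrary: F x)
  case (Suc n)
  have 1: "(\<lambda>\<omega>. ennreal (\<omega> x e)) \<in> borel_measurable (conf_space \<kappa> UNIV)" if "e \<in> nn_steps" for e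
    using measurable_compose[OF measurable_env_coordinate[OF that] measurable_ennreal] by simp
  have 2: "(\<lambda>\<omega>. F 0 x * (\<Sum>e\<in>nn_steps. ennreal (\<omega> x e) * walk_op \<omega> n (\<lambda>i. F (Suc i)) (x + e)))
    \<in> borel_measurable (conf_space \<kappa> UNIV)"
    by (intro borel_measurable_times_ennreal borel_measurable_sum measurable_const 1 Suc) simp_all
  have 3: "walk_op \<omega> (Suc n) F x = F 0 x * (\<Sum>e\<in>nn_steps. ennreal (\<omega> x e) * walk_op \<omega> n (\<lambda>i. F (Suc i)) (x + e))"
    if "\<omega> \<in> space (conf_space \<kappa> UNIV)" for \<omega>
    using that unfolding walk_op.simps space_conf_UNIV mem_Collect_eq by (simp only: nn_integral_jump[OF _ assms])
  show ?case
    using 2 by (subst measurable_cong[OF 3])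
qed simp

lemma sets_path_space_rect:
  "sets (path_space :: (nat \<Rightarrow> 'n::finite site) measure) = sigma_sets UNIV (range (\<lambda>(n, A). rect n A))"
proof
  show "sigma_sets UNIV (range (\<lambda>(n, A). rect n A)) \<subseteq> sets (path_space :: (nat \<Rightarrow> 'n site) measure)"
    by (rule sets.sigma_sets_subset[of _ path_space, unfolded space_path_space]) (auto simp: rect_measurable)
  have r: "{f \<in> UNIV \<rightarrow>\<^sub>E UNIV. f i \<in> A} = rect i (\<lambda>j. if j = i then A else UNIV)" for i and A :: "'n site set"
    by (auto simp: rect_def)
  have "sets path_space = sigma_sets UNIV {{f \<in> UNIV \<rightarrow>\<^sub>E UNIV. f i \<in> A} | i (A :: 'n site set). True}"
    unfolding sets_PiM_single by simp
  also have "\<dots> \<subseteq> sigma_sets UNIV (range (\<lambda>(n, A). rect n (A :: nat \<Rightarrow> 'n site set)))"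
    unfolding r by (rule sigma_sets_mono) (auto intro!: sigma_sets.Basic)
  finally show "sets path_space \<subseteq> sigma_sets UNIV (range (\<lambda>(n, A). rect n (A :: nat \<Rightarrow> 'n site set)))" .
qed

text \<open>On rectangles the quenched law is a polynomial in finitely many coordinates of the environment.\<close>

lemma measurable_quenched:
  fixes x :: "int ^ 'n::finite"
  assumes "\<kappa> > 0"
  shows "quenched x \<in> conf_space \<kappa> UNIV \<rightarrow>\<^sub>M subprob_algebra path_space"
proof (rule measurable_subprob_algebra_generated[OF sets_path_space_rect])
  show "Int_stable (range (\<lambda>(n, A). rect n (A :: nat \<Rightarrow> 'n site set)))"
  proof (rule Int_stableI)
    fix a b :: "(nat \<Rightarrow> 'n site) set"
    assume "a \<in> range (\<lambda>(n, A). rect n A)" "b \<in> range (\<lambda>(n, A). rect n A)"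
    then obtain n A m B where [simp]: "a = rect n A" "b = rect m B" by auto
    have "a \<inter> b = rect (max n m) (\<lambda>i. {x. (i \<le> n \<longrightarrow> x \<in> A i) \<and> (i \<le> m \<longrightarrow> x \<in> B i)})"
    proof (intro set_eqI iffI)
      fix X assume "X \<in> rect (max n m) (\<lambda>i. {x. (i \<le> n \<longrightarrow> x \<in> A i) \<and> (i \<le> m \<longrightarrow> x \<in> B i)})"
      then have X: "i \<le> max n m \<Longrightarrow> (i \<le> n \<longrightarrow> X i \<in> A i) \<and> (i \<le> m \<longrightarrow> X i \<in> B i)" for i
        by (simp add: rect_def)
      have "X i \<in> A i" if "i \<le> n" for i using X[of i] that by simp
      moreover have "X i \<in> B i" if "i \<le> m" for i using X[of i] that by simp
      ultimately show "X \<in> a \<inter> b" by (simp add: rect_def)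
    qed (simp add: rect_def)
    then show "a \<inter> b \<in> range (\<lambda>(n, A). rect n A)"
      by (intro range_eqI[of _ _ "(max n m, \<lambda>i. {x. (i \<le> n \<longrightarrow> x \<in> A i) \<and> (i \<le> m \<longrightarrow> x \<in> B i)})"]) simp
  qed
  have 1: "(\<lambda>a. emeasure (quenched x a) (rect n A)) \<in> borel_measurable (conf_space \<kappa> UNIV)"
    for n and A :: "nat \<Rightarrow> 'n site set"
    unfolding emeasure_quenched_rect by (rule measurable_walk_op[OF assms])
  show "(\<lambda>a. emeasure (quenched x a) A) \<in> borel_measurable (conf_space \<kappa> UNIV)"
    if "A \<in> range (\<lambda>(n, A). rect n A)" for A
  proof -
    from that obtain n B where "A = rect n B" by auto
    from 1[of n B] show ?thesis unfolding \<open>A = rect n B\<close> .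
  qed
  have U: "rect 0 (\<lambda>_. UNIV) = (UNIV :: (nat \<Rightarrow> 'n site) set)" by (auto simp: rect_def)
  show "(\<lambda>a. emeasure (quenched x a) UNIV) \<in> borel_measurable (conf_space \<kappa> UNIV)"
    using 1[of 0 "\<lambda>_. UNIV"] unfolding U .
  show "subprob_space (quenched x a)" for a :: "'n env"
    by (rule prob_space_imp_subprob_space, rule prob_space_quenched)
  show "sets (quenched x a) = sets path_space" for a :: "'n env" by (rule sets_quenched)
qed (simp only: Pow_UNIV subset_UNIV)

definition exits :: "'a set \<Rightarrow> 'a set \<Rightarrow> (nat \<Rightarrow> 'a) set" where
  "exits V F = {X. \<exists>n. (\<forall>i<n. X i \<in> V) \<and> X n \<in> F - V}"

lemma first_time_eq:
  assumes "Q n" "\<And>i. i < n \<Longrightarrow> \<not> Q i" shows "first_time Q = enat n"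
  unfolding first_time_def
  using assms by (intro antisym INF_lower INF_greatest) (auto simp: not_less[symmetric])

lemma first_time_infinity: "first_time Q = \<infinity> \<longleftrightarrow> (\<forall>n. \<not> Q n)"
proof
  show "first_time Q = \<infinity> \<Longrightarrow> \<forall>n. \<not> Q n"
    by (metis (no_types) enat.distinct(2) first_time_eq exists_least_iff)
  show "\<forall>n. \<not> Q n \<Longrightarrow> first_time Q = \<infinity>"
    by (simp add: first_time_def top_enat_def)
qed

lemma first_timeE:
  assumes "first_time Q \<noteq> \<infinity>"
  obtains n where "first_time Q = enat n" "Q n" "\<And>i. i < n \<Longrightarrow> \<not> Q i"
proof -
  from assms have "\<exists>n. Q n" by (simp add: first_time_infinity)
  then obtain n where "Q n" "\<And>i. i < n \<Longrightarrow> \<not> Q i"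
    using exists_least_iff[of Q] by auto
  then show thesis using first_time_eq[of Q n] that by blast
qed

lemma exits_eq:
  "exits V F = {X. exit_time V X \<noteq> \<infinity> \<and> X (the_enat (exit_time V X)) \<in> F}" (is "?L = ?R")
proof (intro set_eqI iffI)
  fix X assume "X \<in> ?L"
  then obtain n where n: "\<forall>i<n. X i \<in> V" "X n \<in> F - V" by (auto simp: exits_def)
  have "exit_time V X = enat n"
    unfolding exit_time_def by (rule first_time_eq) (use n in auto)
  then show "X \<in> ?R" using n by auto
next
  fix X assume X: "X \<in> ?R"
  then have "first_time (\<lambda>n. X n \<notin> V) \<noteq> \<infinity>" by (simp add: exit_time_def)
  then obtain n where "first_time (\<lambda>n. X n \<notin> V) = enat n" "X n \<notin> V" "\<And>i. i < n \<Longrightarrow> \<not> X i \<notin> V"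
    by (rule first_timeE) blast
  with X show "X \<in> ?L" by (auto simp: exits_def exit_time_def)
qed

lemma exits_measurable [measurable]:
  "exits V F \<in> sets (path_space :: (nat \<Rightarrow> 'n::finite site) measure)"
proof -
  have "exits V F = (\<Union>n. rect n (\<lambda>i. if i < n then V else F - V))"
  proof (intro set_eqI iffI)
    fix X :: "nat \<Rightarrow> 'n site" assume "X \<in> exits V F"
    then obtain n where n: "\<forall>i<n. X i \<in> V" "X n \<in> F - V" by (auto simp: exits_def)
    then have "X \<in> rect n (\<lambda>i. if i < n then V else F - V)" by (simp add: rect_def)
    then show "X \<in> (\<Union>n. rect n (\<lambda>i. if i < n then V else F - V))" by blast
  next
    fix X :: "nat \<Rightarrow> 'n site" assume "X \<in> (\<Union>n. rect n (\<lambda>i. if i < n then V else F - V))"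
    then obtain n where n: "X \<in> rect n (\<lambda>i. if i < n then V else F - V)" by blast
    have "X i \<in> (if i < n then V else F - V)" if "i \<le> n" for i
      using n that unfolding rect_def by blast
    then have "\<forall>i<n. X i \<in> V" "X n \<in> F - V" by (metis less_imp_le, metis less_irrefl order_refl)
    then show "X \<in> exits V F" unfolding exits_def by blast
  qed
  also have "\<dots> \<in> sets path_space" by (intro sets.countable_UN) auto
  finally show ?thesis .
qed

lemma case_nat_vimage_exits:
  "case_nat x -` exits V F = (if x \<in> V then exits V F else if x \<in> F then UNIV else {})"
proof (cases "x \<in> V")
  case True
  have "(\<exists>n. (\<forall>i<n. case_nat x X i \<in> V) \<and> case_nat x X n \<in> F - V)
    \<longleftrightarrow> (\<exists>n. (\<forall>i<n. X i \<in> V) \<and> X n \<in> F - V)" (is "?L \<longleftrightarrow> ?R") for X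
  proof
    assume ?L
    then obtain n where n: "\<forall>i<n. case_nat x X i \<in> V" "case_nat x X n \<in> F - V" by auto
    with True obtain m where "n = Suc m" by (cases n) auto
    with n show ?R by (intro exI[of _ m]) auto
  next
    assume ?R
    then obtain n where "\<forall>i<n. X i \<in> V" "X n \<in> F - V" by auto
    with True show ?L by (intro exI[of _ "Suc n"]) (auto simp: less_Suc_eq_0_disj)
  qed
  with True show ?thesis by (auto simp: exits_def)
next
  case False
  have "(\<exists>n. (\<forall>i<n. case_nat x X i \<in> V) \<and> case_nat x X n \<in> F - V) \<longleftrightarrow> x \<in> F" for X
  proof
    assume "\<exists>n. (\<forall>i<n. case_nat x X i \<in> V) \<and> case_nat x X n \<in> F - V"
    then obtain n where n: "\<forall>i<n. case_nat x X i \<in> V" "case_nat x X n \<in> F - V" by auto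
    with False have "n = 0" by (metis nat.case(1) neq0_conv)
    with n show "x \<in> F" by simp
  next
    assume "x \<in> F" with False show "\<exists>n. (\<forall>i<n. case_nat x X i \<in> V) \<and> case_nat x X n \<in> F - V"
      by (intro exI[of _ 0]) auto
  qed
  with False show ?thesis by (auto simp: exits_def)
qed

definition hit :: "('n::finite) env \<Rightarrow> 'n site set \<Rightarrow> 'n site set \<Rightarrow> 'n site \<Rightarrow> real" where
  "hit \<omega> V F x = measure (quenched x \<omega>) (exits V F)"

lemma hit_nonneg: "0 \<le> hit \<omega> V F x"
  by (simp add: hit_def)

lemma hit_le_1: "hit \<omega> V F x \<le> 1"
  by (simp add: hit_def prob_space.prob_le_1[OF prob_space_quenched])

lemma ennreal_hit: "ennreal (hit \<omega> V F x) = emeasure (quenched x \<omega>) (exits V F)"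
  unfolding hit_def
  by (rule finite_measure.emeasure_eq_measure[symmetric]) (rule prob_space.finite_measure[OF prob_space_quenched])

definition mean_step :: "('n::finite) env \<Rightarrow> ('n site \<Rightarrow> real) \<Rightarrow> 'n site \<Rightarrow> real" where
  "mean_step \<omega> f x = (\<Sum>e\<in>nn_steps. \<omega> x e * f (x + e))"

lemma hit_harmonic:
  assumes "env_ok \<kappa> \<omega>" "\<kappa> > 0" "x \<in> V"
  shows "hit \<omega> V F x = mean_step \<omega> (hit \<omega> V F) x"
proof -
  have nn: "0 \<le> \<omega> x e" if "e \<in> nn_steps" for e
    using env_ok_ge[OF assms(1) that, of x] \<open>\<kappa> > 0\<close> by simp
  have "ennreal (hit \<omega> V F x) = (\<Sum>e\<in>nn_steps. ennreal (\<omega> x e) * ennreal (hit \<omega> V F (x + e)))"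
    unfolding ennreal_hit using assms(3)
    by (subst quenched_first_step[OF exits_measurable])
       (simp add: case_nat_vimage_exits nn_integral_jump[OF assms(1,2)])
  also have "\<dots> = ennreal (mean_step \<omega> (hit \<omega> V F) x)"
    unfolding mean_step_def
    by (subst sum_ennreal[symmetric]) (auto simp: nn hit_nonneg ennreal_mult)
  finally show ?thesis
    by (subst (asm) ennreal_inj) (auto simp: hit_nonneg mean_step_def intro!: sum_nonneg mult_nonneg_nonneg nn)
qed

lemma hit_boundary:
  assumes "x \<notin> V" shows "hit \<omega> V F x = (if x \<in> F then 1 else 0)"
proof -
  have "emeasure (quenched x \<omega>) (exits V F) = (if x \<in> F then 1 else 0)"
  proof (cases "x \<in> F")
    case True
    have "emeasure (quenched y \<omega>) UNIV = 1" for y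
      using prob_space.emeasure_space_1[OF prob_space_quenched] by simp
    with True show ?thesis
      by (subst quenched_first_step[OF exits_measurable]) (simp add: case_nat_vimage_exits assms)
  next
    case False
    then show ?thesis
      by (subst quenched_first_step[OF exits_measurable]) (simp add: case_nat_vimage_exits assms)
  qed
  then show ?thesis by (simp add: hit_def measure_def)
qed

lemma measurable_quenched_measure:
  assumes "\<kappa> > 0" "A \<in> sets path_space"
  shows "(\<lambda>\<omega>. measure (quenched x \<omega>) A) \<in> borel_measurable (conf_space \<kappa> UNIV)"
  by (rule measurable_compose[OF measurable_quenched[OF assms(1)] measurable_measure_subprob_algebra[OF assms(2)]])

lemma measurable_hit:
  assumes "\<kappa> > 0"
  shows "(\<lambda>\<omega>. hit \<omega> V F x) \<in> borel_measurable (conf_space \<kappa> UNIV)"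
  unfolding hit_def by (rule measurable_quenched_measure[OF assms exits_measurable])

lemma p_box_eq_hit: "p_box B \<omega> = hit \<omega> (walk_box B) (front_boundary B) 0"
proof -
  interpret prob_space "quenched 0 \<omega>" by (rule prob_space_quenched)
  have "{X \<in> space path_space. \<not> (exit_time (walk_box B) X \<noteq> \<infinity> \<and> X (the_enat (exit_time (walk_box B) X)) \<in> front_boundary B)}
      = space (quenched 0 \<omega>) - exits (walk_box B) (front_boundary B)"
    by (auto simp: exits_eq)
  then have "q_box B \<omega> = 1 - hit \<omega> (walk_box B) (front_boundary B) 0"
    unfolding q_box_def hit_def by (simp only:) (rule prob_compl, simp)
  then show ?thesis by (simp add: p_box_def)
qed

text \<open>Measurability of the quenched kernel makes the monadic bind an honest mixture.\<close>

lemma emeasure_annealed: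
  assumes "\<kappa> > 0" "sets P = sets (conf_space \<kappa> UNIV)" "prob_space P" "A \<in> sets path_space"
  shows "emeasure (annealed P x) A = (\<integral>\<^sup>+\<omega>. emeasure (quenched x \<omega>) A \<partial>P)"
proof -
  interpret prob_space P by fact
  have "quenched x \<in> P \<rightarrow>\<^sub>M subprob_algebra path_space"
    using measurable_quenched[OF assms(1)] measurable_cong_sets[OF assms(2) refl] by blast
  then show ?thesis
    unfolding annealed_def by (rule emeasure_bind[OF not_empty _ assms(4)])
qed

text \<open>Reaching the lower level strictly before the upper one forces an exit from the open slab in between
  through its lower side, whether or not the upper level is ever reached.\<close>

lemma down_before_up_subset:
  assumes "c < c'"
  shows "{X \<in> space path_space. down_time c u X < up_time c' u X}
    \<subseteq> exits {z. c < to_real z \<bullet> u \<and> to_real z \<bullet> u < c'} {z. to_real z \<bullet> u \<le> c}"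
proof clarify
  fix X :: "nat \<Rightarrow> 'a site" assume less: "down_time c u X < up_time c' u X"
  then have "first_time (\<lambda>n. to_real (X n) \<bullet> u \<le> c) \<noteq> \<infinity>" unfolding down_time_def by (metis enat_ord_simps(6))
  then obtain n where n: "first_time (\<lambda>n. to_real (X n) \<bullet> u \<le> c) = enat n" "to_real (X n) \<bullet> u \<le> c"
      "\<And>i. i < n \<Longrightarrow> \<not> to_real (X i) \<bullet> u \<le> c" by (rule first_timeE) blast
  have "to_real (X i) \<bullet> u < c'" if "i < n" for i
  proof (rule ccontr)
    assume "\<not> to_real (X i) \<bullet> u < c'"
    then have "up_time c' u X \<le> enat i" unfolding up_time_def first_time_def by (intro INF_lower) auto
    with less n(1) that show False by (simp add: down_time_def) (meson enat_ord_simps leD less_imp_le order_trans)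
  qed
  moreover have "c < to_real (X i) \<bullet> u" if "i < n" for i using n(3)[OF that] by simp
  ultimately show "X \<in> exits {z. c < to_real z \<bullet> u \<and> to_real z \<bullet> u < c'} {z. to_real z \<bullet> u \<le> c}"
    unfolding exits_def using n(2) assms by (auto intro!: exI[of _ n])
qed

section \<open>Harmonic functions and the maximum principle\<close>

lemma axis_in_nn_steps: "axis i 1 \<in> (nn_steps :: (int ^ 'n::finite) set)"
  "axis i (-1) \<in> (nn_steps :: (int ^ 'n::finite) set)"
proof -
  have "(\<Sum>j\<in>UNIV. \<bar>axis i s $ j\<bar>) = \<bar>s\<bar>" for s :: int
    by (subst sum.remove[of _ i]) (auto simp: axis_def intro!: sum.neutral)
  from this[of 1] this[of "-1"] show "axis i 1 \<in> (nn_steps :: (int ^ 'n::finite) set)"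
  "axis i (-1) \<in> (nn_steps :: (int ^ 'n::finite) set)"
    by (simp_all add: nn_steps_def norm1_def del: of_int_sum)
qed

lemma env_pos:
  assumes "env_ok \<kappa> \<omega>" "\<kappa> > 0" "e \<in> nn_steps" shows "0 < \<omega> x e"
  using env_ok_ge[OF assms(1,3), of x] assms(2) by simp

lemma mean_step_mono:
  assumes "env_ok \<kappa> \<omega>" "\<kappa> > 0" "\<And>e. e \<in> nn_steps \<Longrightarrow> f (x + e) \<le> g (x + e)"
  shows "mean_step \<omega> f x \<le> mean_step \<omega> g x"
  unfolding mean_step_def
  by (intro sum_mono mult_left_mono assms(3)) (auto intro: less_imp_le env_pos[OF assms(1,2)])

lemma mean_step_const:
  assumes "env_ok \<kappa> \<omega>" shows "mean_step \<omega> (\<lambda>_. c) x = c"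
  unfolding mean_step_def by (simp add: sum_distrib_right[symmetric] env_ok_sum[OF assms])

lemma mean_step_add: "mean_step \<omega> (\<lambda>z. f z + g z) x = mean_step \<omega> f x + mean_step \<omega> g x"
  and mean_step_diff: "mean_step \<omega> (\<lambda>z. f z - g z) x = mean_step \<omega> f x - mean_step \<omega> g x"
  and mean_step_cmult: "mean_step \<omega> (\<lambda>z. c * f z) x = c * mean_step \<omega> f x"
  and mean_step_sum: "mean_step \<omega> (\<lambda>z. \<Sum>i\<in>I. h i z) x = (\<Sum>i\<in>I. mean_step \<omega> (h i) x)"
  unfolding mean_step_def
  by (simp_all add: algebra_simps sum.distrib sum_subtractf sum_distrib_left sum.swap[of _ I])

text \<open>At a positive maximum all neighbours are again maximizers, because every step has positive
  probability.  Choosing among the maximizers one that is extremal in a coordinate direction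
  contradicts this.\<close>

theorem maximum_principle:
  fixes \<omega> :: "('n::finite) env"
  assumes ok: "env_ok \<kappa> \<omega>" "\<kappa> > 0" and fin: "finite V"
    and sub: "\<And>x. x \<in> V \<Longrightarrow> f x \<le> mean_step \<omega> f x"
    and bd: "\<And>x e. x \<in> V \<Longrightarrow> e \<in> nn_steps \<Longrightarrow> x + e \<notin> V \<Longrightarrow> f (x + e) \<le> 0"
    and x: "x \<in> V"
  shows "f x \<le> 0"
proof (rule ccontr)
  assume neg: "\<not> f x \<le> 0"
  define m where "m = Max (f ` V)"
  have le: "f y \<le> m" if "y \<in> V" for y using that fin by (simp add: m_def)
  have m: "m > 0" using neg le[OF x] by simp
  \<comment> \<open>An arbitrary coordinate direction, used to select an extremal maximizer.\<close>
  fix i :: 'n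
  let ?S = "{y \<in> V. f y = m}"
  have "m \<in> f ` V" unfolding m_def using fin x by (intro Max_in) auto
  then have S: "finite ?S" "?S \<noteq> {}" using fin by auto
  obtain y where y: "y \<in> ?S" "\<And>z. z \<in> ?S \<Longrightarrow> z $ i \<le> y $ i"
  proof -
    have "Max ((\<lambda>y. y $ i) ` ?S) \<in> (\<lambda>y. y $ i) ` ?S" using S by (intro Max_in) auto
    then obtain y where "y \<in> ?S" "Max ((\<lambda>y. y $ i) ` ?S) = y $ i" by auto
    moreover have "z $ i \<le> Max ((\<lambda>y. y $ i) ` ?S)" if "z \<in> ?S" for z
      using S that by (intro Max_ge) auto
    ultimately show ?thesis using that[of y] by auto
  qed
  let ?e = "axis i 1 :: int ^ 'n"
  have nb: "f (y + e) \<le> m" if "e \<in> nn_steps" for e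
    using bd[of y e] le[of "y + e"] y(1) that m by (cases "y + e \<in> V") auto
  have "f (y + ?e) = m"
  proof (rule ccontr)
    assume "f (y + ?e) \<noteq> m"
    then have "f (y + ?e) < m" using nb[OF axis_in_nn_steps(1)[of i]] by simp
    then have "mean_step \<omega> f y < mean_step \<omega> (\<lambda>_. m) y"
      unfolding mean_step_def
      by (intro sum_strict_mono_ex1 finite_nn_steps ballI)
         (auto intro!: mult_left_mono nb less_imp_le[OF env_pos[OF ok]] mult_strict_left_mono env_pos[OF ok]
               bexI[of _ ?e] axis_in_nn_steps)
    with sub[of y] y(1) show False by (simp add: mean_step_const[OF ok(1)])
  qed
  moreover from this have "y + ?e \<in> V"
    using bd[of y ?e] y(1) m axis_in_nn_steps(1)[of i] by auto
  ultimately have "(y + ?e) $ i \<le> y $ i" by (intro y(2)) auto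
  then show False by simp
qed

lemma comparison_principle:
  fixes \<omega> :: "('n::finite) env"
  assumes ok: "env_ok \<kappa> \<omega>" "\<kappa> > 0" and fin: "finite V"
    and sub: "\<And>x. x \<in> V \<Longrightarrow> f x \<le> mean_step \<omega> f x"
    and super: "\<And>x. x \<in> V \<Longrightarrow> mean_step \<omega> g x \<le> g x"
    and bd: "\<And>x e. x \<in> V \<Longrightarrow> e \<in> nn_steps \<Longrightarrow> x + e \<notin> V \<Longrightarrow> f (x + e) \<le> g (x + e)"
    and x: "x \<in> V"
  shows "f x \<le> g x"
proof -
  have "f x - g x \<le> 0"
    by (rule maximum_principle[OF ok fin _ _ x, of "\<lambda>z. f z - g z"])
       (auto simp: mean_step_diff intro: bd diff_mono sub super)
  then show ?thesis by simp
qed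

text \<open>Uniqueness in the Dirichlet problem: the exit probability depends on the environment inside
  \<open>V\<close> only.  This locality is what the mixing condition acts on.\<close>

lemma hit_local:
  fixes \<omega> \<omega>' :: "('n::finite) env"
  assumes ok: "env_ok \<kappa> \<omega>" "env_ok \<kappa> \<omega>'" "\<kappa> > 0" and fin: "finite V"
    and eq: "\<And>x. x \<in> V \<Longrightarrow> \<omega> x = \<omega>' x"
  shows "hit \<omega> V F x = hit \<omega>' V F x"
proof -
  have le: "hit \<omega> V F x \<le> hit \<omega>' V F x"
    if ok: "env_ok \<kappa> \<omega>" "env_ok \<kappa> \<omega>'" and eq: "\<And>x. x \<in> V \<Longrightarrow> \<omega> x = \<omega>' x" and x: "x \<in> V"
    for \<omega> \<omega>' :: "'n env"
  proof (rule comparison_principle[OF ok(1) \<open>\<kappa> > 0\<close> fin _ _ _ x])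
    fix y assume y: "y \<in> V"
    show "hit \<omega> V F y \<le> mean_step \<omega> (hit \<omega> V F) y" using hit_harmonic[OF ok(1) \<open>\<kappa> > 0\<close> y] by simp
    have "mean_step \<omega> (hit \<omega>' V F) y = mean_step \<omega>' (hit \<omega>' V F) y"
      by (simp add: mean_step_def eq[OF y])
    then show "mean_step \<omega> (hit \<omega>' V F) y \<le> hit \<omega>' V F y"
      using hit_harmonic[OF ok(2) \<open>\<kappa> > 0\<close> y] by simp
  qed (auto simp: hit_boundary)
  show ?thesis
  proof (cases "x \<in> V")
    case True
    then show ?thesis by (intro antisym le) (use ok eq in auto)
  qed (simp add: hit_boundary)
qed

text \<open>The basic tool, replacing the strong Markov property at the exit from a translate of a box: a
  function that is subharmonic in \<open>x + V\<close> is dominated at \<open>x\<close> by the mean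
  of its boundary bounds, weighted with the exit probabilities seen from \<open>x\<close>.\<close>

lemma box_comparison:
  fixes \<omega> :: "('n::finite) env"
  assumes ok: "env_ok \<kappa> \<omega>" "\<kappa> > 0" and fin: "finite V" and "0 \<in> V"
    and sub: "\<And>y. y \<in> V \<Longrightarrow> w (x + y) \<le> mean_step \<omega> w (x + y)"
    and front: "\<And>y e. y \<in> V \<Longrightarrow> e \<in> nn_steps \<Longrightarrow> y + e \<notin> V \<Longrightarrow> y + e \<in> F \<Longrightarrow> w (x + (y + e)) \<le> \<alpha>"
    and other: "\<And>y e. y \<in> V \<Longrightarrow> e \<in> nn_steps \<Longrightarrow> y + e \<notin> V \<Longrightarrow> y + e \<notin> F \<Longrightarrow> w (x + (y + e)) \<le> \<beta>"
  shows "w x \<le> \<alpha> * hit (env_shift x \<omega>) V F 0 + \<beta> * (1 - hit (env_shift x \<omega>) V F 0)"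
proof -
  let ?h = "hit (env_shift x \<omega>) V F"
  have ok': "env_ok \<kappa> (env_shift x \<omega>)" using ok(1) by (rule env_ok_shift)
  have "w (x + 0) \<le> \<beta> + (\<alpha> - \<beta>) * ?h 0"
  proof (rule comparison_principle[OF ok' ok(2) fin _ _ _ \<open>0 \<in> V\<close>, of "\<lambda>y. w (x + y)" "\<lambda>y. \<beta> + (\<alpha> - \<beta>) * ?h y"])
    fix y assume y: "y \<in> V"
    have "mean_step (env_shift x \<omega>) (\<lambda>y. w (x + y)) y = mean_step \<omega> w (x + y)"
      by (simp add: mean_step_def env_shift_def algebra_simps)
    then show "w (x + y) \<le> mean_step (env_shift x \<omega>) (\<lambda>y. w (x + y)) y" using sub[OF y] by simp
    show "mean_step (env_shift x \<omega>) (\<lambda>y. \<beta> + (\<alpha> - \<beta>) * ?h y) y \<le> \<beta> + (\<alpha> - \<beta>) * ?h y"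
      using hit_harmonic[OF ok' ok(2) y, of F]
      by (simp add: mean_step_add mean_step_cmult mean_step_const[OF ok'])
  next
    fix y e assume "y \<in> V" "e \<in> nn_steps" "y + e \<notin> V"
    with front[of y e] other[of y e] show "w (x + (y + e)) \<le> \<beta> + (\<alpha> - \<beta>) * ?h (y + e)"
      by (auto simp: hit_boundary)
  qed
  then show ?thesis by (simp add: algebra_simps)
qed

lemma measurable_env_shift [measurable]:
  "env_shift z \<in> conf_space \<kappa> UNIV \<rightarrow>\<^sub>M conf_space \<kappa> (UNIV :: ('n::finite) site set)"
  unfolding conf_space_def env_shift_def
  by (rule measurable_PiM_single') (auto simp: space_PiM intro: measurable_component_singleton)

lemma random_env_facts:
  assumes "random_environment \<kappa> P"
  shows "prob_space P" "sets P = sets (conf_space \<kappa> UNIV)" "space P = {\<omega>. env_ok \<kappa> \<omega>}" "stationary P"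
    "measurable P M = measurable (conf_space \<kappa> UNIV) M"
  using assms sets_eq_imp_space_eq[of P "conf_space \<kappa> UNIV"]
  by (auto simp: random_environment_def space_conf_UNIV intro: measurable_cong_sets)

lemma stationary_integral:
  fixes P :: "('n::finite) env measure"
  assumes "random_environment \<kappa> P" "f \<in> borel_measurable (conf_space \<kappa> UNIV)"
  shows "(\<integral>\<^sup>+\<omega>. f (env_shift z \<omega>) \<partial>P) = (\<integral>\<^sup>+\<omega>. f \<omega> \<partial>P)"
proof -
  note r = random_env_facts[OF assms(1)]
  have 1: "env_shift z \<in> P \<rightarrow>\<^sub>M P"
    using measurable_env_shift measurable_cong_sets[OF r(2) r(2)] by blast
  have "(\<integral>\<^sup>+\<omega>. f (env_shift z \<omega>) \<partial>P) = (\<integral>\<^sup>+\<omega>. f \<omega> \<partial>distr P P (env_shift z))"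
    using assms(2) by (subst nn_integral_distr[OF 1]) (simp_all add: r(5))
  then show ?thesis using r(4) by (simp add: stationary_def)
qed

section \<open>Tilted coordinates, lattice points and ellipticity\<close>

lemma to_real_simps [simp]:
  "to_real (x + y) = to_real x + to_real y" "to_real (x - y) = to_real x - to_real y"
  "to_real (- x) = - to_real x" "to_real 0 = 0"
  by (simp_all add: to_real_def vec_eq_iff)

lemma norm_to_real_le: "norm (to_real z) \<le> norm1 z"
  using norm_le_l1_cart[of "to_real z"] by (simp add: to_real_def norm1_def)

definition coord :: "real ^ 'n ^ 'n \<Rightarrow> 'n \<Rightarrow> int ^ 'n::finite \<Rightarrow> real" where
  "coord R j z = to_real z \<bullet> (R *v basis_vec j)"

lemma coord_simps [simp]:
  "coord R j (x + y) = coord R j x + coord R j y" "coord R j (x - y) = coord R j x - coord R j y"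
  "coord R j (- x) = - coord R j x" "coord R j 0 = 0"
  by (simp_all add: coord_def inner_simps)

lemma coord_eq: "coord R j z = (transpose R *v to_real z) $ j"
proof -
  have "coord R j z = (\<Sum>i\<in>UNIV. to_real z $ i * R $ i $ j)"
    by (simp add: coord_def basis_vec_def inner_vec_def matrix_vector_mul_component axis_def
        if_distrib[of "(*) _"] cong: if_cong)
  also have "\<dots> = (transpose R *v to_real z) $ j"
    by (simp add: matrix_vector_mult_def transpose_def mult.commute)
  finally show ?thesis .
qed

lemma norm_orthogonal_mult:
  assumes "orthogonal_matrix (R :: real ^ 'n ^ 'n::finite)" shows "norm (R *v x) = norm x"
  using assms orthogonal_transformation_norm[of "(*v) R"]
  by (simp add: orthogonal_transformation_matrix)

lemma norm_column: "orthogonal_matrix (R :: real ^ 'n ^ 'n::finite) \<Longrightarrow> norm (R *v basis_vec j) = 1"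
  by (simp add: norm_orthogonal_mult basis_vec_def)

lemma inner_columns:
  assumes "orthogonal_matrix (R :: real ^ 'n ^ 'n::finite)"
  shows "(R *v basis_vec i) \<bullet> (R *v basis_vec j) = (if i = j then 1 else 0)"
proof -
  have "orthogonal_transformation ((*v) R)" using assms by (simp add: orthogonal_transformation_matrix)
  then have "(R *v basis_vec i) \<bullet> (R *v basis_vec j) = basis_vec i \<bullet> basis_vec j"
    by (simp add: orthogonal_transformation_def)
  then show ?thesis by (simp add: basis_vec_def inner_axis_axis)
qed

lemma abs_coord_le:
  assumes "orthogonal_matrix R" shows "\<bar>coord R j z\<bar> \<le> norm1 z"
proof -
  have "\<bar>coord R j z\<bar> \<le> norm (to_real z) * norm (R *v basis_vec j)"
    unfolding coord_def by (rule Cauchy_Schwarz_ineq2)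
  then show ?thesis using norm_column[OF assms] norm_to_real_le[of z] by simp
qed

lemma abs_coord_step:
  assumes "orthogonal_matrix R" "e \<in> nn_steps" shows "\<bar>coord R j e\<bar> \<le> 1"
  using abs_coord_le[OF assms(1), of j e] assms(2) by (simp add: nn_steps_def)

lemma norm_le_sum_coord:
  assumes "orthogonal_matrix (R :: real ^ 'n ^ 'n::finite)"
  shows "norm (to_real z) \<le> (\<Sum>j\<in>UNIV. \<bar>coord R j z\<bar>)"
proof -
  have "norm (to_real z) = norm (transpose R *v to_real z)"
    by (rule norm_orthogonal_mult[symmetric]) (use assms in simp)
  also have "\<dots> \<le> (\<Sum>j\<in>UNIV. \<bar>coord R j z\<bar>)"
    using norm_le_l1_cart[of "transpose R *v to_real z"] by (simp add: coord_eq)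
  finally show ?thesis .
qed

lemma component_le_sum_coord:
  assumes "orthogonal_matrix (R :: real ^ 'n ^ 'n::finite)"
  shows "real_of_int \<bar>z $ i\<bar> \<le> (\<Sum>j\<in>UNIV. \<bar>coord R j z\<bar>)"
  using component_le_norm_cart[of "to_real z" i] norm_le_sum_coord[OF assms, of z]
  by (simp add: to_real_def)

lemma card_lattice_cube:
  fixes I :: "'n::finite \<Rightarrow> int set"
  assumes "\<And>i. finite (I i)"
  shows "finite {z :: int ^ 'n. \<forall>i. z $ i \<in> I i}" "card {z :: int ^ 'n. \<forall>i. z $ i \<in> I i} = (\<Prod>i\<in>UNIV. card (I i))"
proof -
  have b: "bij_betw (\<lambda>f. (\<chi> i. f i) :: int ^ 'n) (Pi\<^sub>E UNIV I) {z. \<forall>i. z $ i \<in> I i}"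
    by (rule bij_betwI[of _ _ _ "\<lambda>z i. z $ i"]) auto
  have "finite (Pi\<^sub>E UNIV I)" by (rule finite_PiE) (auto simp: assms)
  then show "finite {z :: int ^ 'n. \<forall>i. z $ i \<in> I i}" using bij_betw_finite[OF b] by simp
  show "card {z :: int ^ 'n. \<forall>i. z $ i \<in> I i} = (\<Prod>i\<in>UNIV. card (I i))"
    unfolding bij_betw_same_card[OF b, symmetric] by (rule card_PiE) simp
qed

text \<open>Number of lattice points in a cube large enough to contain any fibre of the rounding map of
  \<open>lattice_points_rotated_box\<close>.\<close>

definition lat_const :: "'n::finite itself \<Rightarrow> real" where
  "lat_const _ = real ((2 * CARD('n) + 1) ^ CARD('n))"

text \<open>Rounding down the tilted coordinates maps the lattice points into an integer box; the points
  sharing one rounded value differ by a vector of norm at most the dimension, so each fibre has boundedly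
  many elements.\<close>

lemma lattice_points_rotated_box:
  fixes R :: "real ^ 'n ^ 'n::finite"
  assumes R: "orthogonal_matrix R" and ab: "\<And>j. a j \<le> b j"
  defines "S \<equiv> {z. \<forall>j. a j \<le> coord R j z \<and> coord R j z \<le> b j}"
  shows "finite S" "real (card S) \<le> lat_const TYPE('n) * (\<Prod>j\<in>UNIV. b j - a j + 2)"
proof -
  let ?g = "\<lambda>z j. \<lfloor>coord R j z\<rfloor>"
  let ?I = "\<lambda>j. {\<lfloor>a j\<rfloor>..\<lfloor>b j\<rfloor>}"
  let ?d = "int CARD('n)"
  have img: "?g ` S \<subseteq> Pi\<^sub>E UNIV ?I" by (auto simp: S_def floor_mono)
  then have fin_img: "finite (?g ` S)" by (rule finite_subset) (auto intro: finite_PiE)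
  have fiber: "finite {z \<in> S. ?g z = y}" "card {z \<in> S. ?g z = y} \<le> (2 * CARD('n) + 1) ^ CARD('n)" if y: "y \<in> ?g ` S" for y
  proof -
    from y obtain z0 where z0: "y = ?g z0" by auto
    let ?C = "{z :: int ^ 'n. \<forall>i. z $ i \<in> {z0 $ i - ?d .. z0 $ i + ?d}}"
    have "{z \<in> S. ?g z = y} \<subseteq> ?C"
    proof
      fix z assume "z \<in> {z \<in> S. ?g z = y}"
      then have "\<And>j. \<lfloor>coord R j z\<rfloor> = \<lfloor>coord R j z0\<rfloor>" using z0 by (auto dest: fun_cong)
      then have "\<bar>coord R j (z - z0)\<bar> \<le> 1" for j
        unfolding coord_simps by (smt (verit) floor_eq_iff)
      then have "(\<Sum>j\<in>UNIV. \<bar>coord R j (z - z0)\<bar>) \<le> real CARD('n)"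
        using sum_mono[of UNIV "\<lambda>j. \<bar>coord R j (z - z0)\<bar>" "\<lambda>_. 1"] by simp
      then have "real_of_int \<bar>(z - z0) $ i\<bar> \<le> real_of_int ?d" for i
        using component_le_sum_coord[OF R, of "z - z0" i] by simp
      then have "\<bar>(z - z0) $ i\<bar> \<le> ?d" for i by (simp only: of_int_le_iff)
      then show "z \<in> ?C" by (auto simp: abs_le_iff algebra_simps)
    qed
    moreover have "finite ?C" "card ?C = (2 * CARD('n) + 1) ^ CARD('n)"
      using card_lattice_cube[of "\<lambda>i. {z0 $ i - ?d .. z0 $ i + ?d}"] by (simp_all add: nat_add_distrib nat_mult_distrib)
    ultimately show "finite {z \<in> S. ?g z = y}" "card {z \<in> S. ?g z = y} \<le> (2 * CARD('n) + 1) ^ CARD('n)"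
      using finite_subset card_mono by (blast, metis (no_types, lifting))
  qed
  have S: "S = (\<Union>y\<in>?g ` S. {z \<in> S. ?g z = y})" by auto
  show "finite S" by (subst S) (use fin_img fiber(1) in blast)
  have "card S \<le> (\<Sum>y\<in>?g ` S. card {z \<in> S. ?g z = y})"
    by (subst S) (rule card_UN_le[OF fin_img])
  also have "\<dots> \<le> card (?g ` S) * (2 * CARD('n) + 1) ^ CARD('n)"
    using sum_bounded_above[of "?g ` S" "\<lambda>y. card {z \<in> S. ?g z = y}"] fiber(2) by simp
  finally have 1: "real (card S) \<le> real (card (?g ` S)) * lat_const TYPE('n)"
    unfolding lat_const_def of_nat_mult[symmetric] of_nat_le_iff .
  have "card (?g ` S) \<le> (\<Prod>j\<in>UNIV. card (?I j))"
    using card_mono[OF _ img] by (simp add: card_PiE finite_PiE)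
  then have "real (card (?g ` S)) \<le> (\<Prod>j\<in>UNIV. real (card (?I j)))"
    unfolding of_nat_prod[symmetric] of_nat_le_iff .
  also have "\<dots> \<le> (\<Prod>j\<in>UNIV. b j - a j + 2)"
  proof (rule prod_mono)
    fix j
    have "\<lfloor>a j\<rfloor> \<le> \<lfloor>b j\<rfloor>" by (rule floor_mono[OF ab])
    then have "real (card (?I j)) = real_of_int (\<lfloor>b j\<rfloor> - \<lfloor>a j\<rfloor> + 1)" by simp
    also have "\<dots> \<le> b j - a j + 2" by linarith
    finally show "0 \<le> real (card (?I j)) \<and> real (card (?I j)) \<le> b j - a j + 2" by simp
  qed
  finally show "real (card S) \<le> lat_const TYPE('n) * (\<Prod>j\<in>UNIV. b j - a j + 2)"
    using 1 by (smt (verit, best) lat_const_def mult.commute mult_left_mono of_nat_0_le_iff)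
qed

text \<open>A concave potential whose level sets are paraboloids around the axis \<open>u\<close>:
  large values mean progress along \<open>u\<close> without much lateral displacement.\<close>

definition paraboloid :: "real ^ 'n::finite \<Rightarrow> real ^ 'n \<Rightarrow> real" where
  "paraboloid u x = x \<bullet> u - (norm (x - (x \<bullet> u) *\<^sub>R u))\<^sup>2 / (2 * sqrt (real CARD('n)))"

text \<open>The gradient at \<open>x\<close> is \<open>u\<close> minus a multiple of the lateral part of
  \<open>x\<close>, hence has norm at least one, so a unit step along its largest component gains at least
  \<open>1 / sqrt d\<close>; the curvature of the potential costs at most half of it.\<close>

lemma paraboloid_step:
  fixes u x :: "real ^ 'n::finite"
  assumes u: "norm u = 1"
  shows "\<exists>e\<in>nn_steps. paraboloid u x + 1 / (2 * sqrt (real CARD('n))) \<le> paraboloid u (x + to_real e)"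
proof -
  let ?s = "sqrt (real CARD('n))"
  have s: "?s > 0" by simp
  have uu: "u \<bullet> u = 1" using u by (simp add: norm_eq_1)
  define w where "w = x - (x \<bullet> u) *\<^sub>R u"
  have wu: "w \<bullet> u = 0" by (simp add: w_def inner_simps uu)
  define v where "v = u - (1 / ?s) *\<^sub>R w"
  have "v \<bullet> u = 1" using wu by (simp add: v_def inner_simps uu)
  then have "1 \<le> norm v" using Cauchy_Schwarz_ineq2[of v u] u by simp
  then have nv: "1 \<le> (norm v)\<^sup>2" by simp
  have "\<exists>i. 1 / ?s \<le> \<bar>v $ i\<bar>"
  proof (rule ccontr)
    assume "\<nexists>i. 1 / ?s \<le> \<bar>v $ i\<bar>"
    then have "\<bar>v $ i\<bar> < 1 / ?s" for i by (simp add: not_le)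
    then have "(v $ i)\<^sup>2 < (1 / ?s)\<^sup>2" for i by (metis abs_ge_zero power2_abs power_strict_mono zero_less_numeral)
    then have "(\<Sum>i\<in>UNIV. (v $ i)\<^sup>2) < (\<Sum>i\<in>(UNIV :: 'n set). (1 / ?s)\<^sup>2)"
      by (intro sum_strict_mono) auto
    also have "\<dots> = 1" by (simp add: power_divide)
    finally have "(\<Sum>i\<in>UNIV. (v $ i)\<^sup>2) < 1" .
    moreover have "(norm v)\<^sup>2 = (\<Sum>i\<in>UNIV. (v $ i)\<^sup>2)"
      by (simp add: norm_vec_def L2_set_def sum_nonneg)
    ultimately have "(norm v)\<^sup>2 < 1" by simp
    with nv show False by simp
  qed
  then obtain i where i: "1 / ?s \<le> \<bar>v $ i\<bar>" ..
  define e where "e = (axis i (if v $ i \<ge> 0 then 1 else -1) :: int ^ 'n)"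
  have e: "e \<in> nn_steps" by (auto simp: e_def axis_in_nn_steps)
  have te: "to_real e = axis i (if v $ i \<ge> 0 then 1 else -1)"
    by (auto simp: e_def to_real_def axis_def vec_eq_iff)
  have ev: "to_real e \<bullet> v = \<bar>v $ i\<bar>" unfolding te by (simp add: inner_axis')
  define e' where "e' = to_real e - (to_real e \<bullet> u) *\<^sub>R u"
  have "(norm e')\<^sup>2 = (norm (to_real e))\<^sup>2 - (to_real e \<bullet> u)\<^sup>2"
    unfolding e'_def power2_norm_eq_inner inner_diff_left inner_diff_right
    by (simp add: uu power2_eq_square inner_commute)
  also have "\<dots> \<le> 1"
    using power_le_one[of "norm (to_real e)" 2] norm_to_real_le[of e] e
    by (simp add: nn_steps_def) (smt (verit) zero_le_power2)
  finally have e'1: "(norm e')\<^sup>2 \<le> 1" .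
  have "x + to_real e - ((x + to_real e) \<bullet> u) *\<^sub>R u = w + e'"
    by (simp add: w_def e'_def inner_simps algebra_simps)
  then have "paraboloid u (x + to_real e) = (x + to_real e) \<bullet> u - (norm (w + e'))\<^sup>2 / (2 * ?s)"
    by (simp add: paraboloid_def)
  also have "(norm (w + e'))\<^sup>2 = (norm w)\<^sup>2 + 2 * (w \<bullet> to_real e) + (norm e')\<^sup>2"
    using wu by (simp add: power2_norm_eq_inner inner_simps e'_def inner_commute)
  also have "(x + to_real e) \<bullet> u - ((norm w)\<^sup>2 + 2 * (w \<bullet> to_real e) + (norm e')\<^sup>2) / (2 * ?s)
     = paraboloid u x + to_real e \<bullet> v - (norm e')\<^sup>2 / (2 * ?s)"
  proof -
    have "paraboloid u x = x \<bullet> u - (norm w)\<^sup>2 / (2 * ?s)" by (simp add: paraboloid_def w_def)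
    moreover have "to_real e \<bullet> v = to_real e \<bullet> u - (w \<bullet> to_real e) / ?s"
      by (simp add: v_def inner_diff_right inner_commute)
    ultimately show ?thesis by (simp add: inner_add_left add_divide_distrib)
  qed
  also have "\<dots> \<ge> paraboloid u x + 1 / ?s - 1 / (2 * ?s)"
    using i e'1 ev by (intro diff_mono add_mono divide_right_mono) auto
  finally have 1: "paraboloid u x + 1 / ?s - 1 / (2 * ?s) \<le> paraboloid u (x + to_real e)" .
  have "paraboloid u x + 1 / (2 * ?s) \<le> paraboloid u (x + to_real e)"
  proof -
    have "1 / ?s = 2 * (1 / (2 * ?s))" by simp
    with 1 show ?thesis by linarith
  qed
  with e show ?thesis by blast
qed

lemma env_two_kappa_le_1:
  fixes \<omega> :: "('n::finite) env"
  assumes ok: "env_ok \<kappa> \<omega>" "\<kappa> > 0" shows "2 * \<kappa> \<le> 1"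
proof -
  fix i :: 'n
  let ?e = "axis i 1 :: int ^ 'n"
  have "\<omega> 0 ?e \<le> (\<Sum>e\<in>nn_steps. \<omega> 0 e)"
    by (rule member_le_sum[OF axis_in_nn_steps(1)]) (auto simp: finite_nn_steps intro: less_imp_le env_pos[OF ok])
  then show ?thesis using env_ok_ge[OF ok(1) axis_in_nn_steps(1)[of i], of 0] env_ok_sum[OF ok(1), of 0] by simp
qed

text \<open>Following the steps of \<open>paraboloid_step\<close> reaches level \<open>T\<close> within
  a number of steps linear in \<open>T\<close>, without ever leaving the paraboloid, and each step has
  probability at least \<open>2 * \<kappa>\<close>.\<close>

lemma elliptic_lower_bound:
  fixes \<omega> :: "('n::finite) env"
  assumes ok: "env_ok \<kappa> \<omega>" "\<kappa> > 0" and u: "norm u = 1"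
    and nn: "\<And>x. 0 \<le> h x"
    and super: "\<And>x. x \<in> V \<Longrightarrow> mean_step \<omega> h x \<le> h x"
    and V: "\<And>x. 0 \<le> paraboloid u (to_real x) \<Longrightarrow> to_real x \<bullet> u < T \<Longrightarrow> x \<in> V"
    and goal: "\<And>x. 0 \<le> paraboloid u (to_real x) \<Longrightarrow> T \<le> to_real x \<bullet> u \<Longrightarrow> to_real x \<bullet> u < T + 1 \<Longrightarrow> 1 \<le> h x"
    and T: "T > 0"
  shows "(2 * \<kappa>) ^ nat \<lceil>2 * sqrt (real CARD('n)) * T\<rceil> \<le> h 0"
proof -
  let ?s = "sqrt (real CARD('n))"
  have s: "?s > 0" by simp
  have k: "0 \<le> 2 * \<kappa>" "2 * \<kappa> \<le> 1" using env_two_kappa_le_1[OF ok] ok(2) by auto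
  have main: "(2 * \<kappa>) ^ n \<le> h x"
    if "0 \<le> paraboloid u (to_real x)" "to_real x \<bullet> u < T + 1" "2 * ?s * (T - paraboloid u (to_real x)) \<le> real n" for n x
    using that
  proof (induction n arbitrary: x)
    case 0
    have "paraboloid u (to_real x) \<le> to_real x \<bullet> u" by (simp add: paraboloid_def)
    moreover have "T \<le> paraboloid u (to_real x)" using 0(3) s by (simp add: mult_le_0_iff)
    ultimately show ?case using goal[of x] 0 by simp
  next
    case (Suc n)
    show ?case
    proof (cases "T \<le> to_real x \<bullet> u")
      case True
      then have "1 \<le> h x" using goal[of x] Suc.prems by simp
      then show ?thesis using power_le_one[OF k, of "Suc n"] by simp
    next
      case False
      obtain e where e: "e \<in> nn_steps" "paraboloid u (to_real x) + 1 / (2 * ?s) \<le> paraboloid u (to_real x + to_real e)"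
        using paraboloid_step[OF u] by blast
      have "\<bar>to_real e \<bullet> u\<bar> \<le> norm (to_real e) * norm u" by (rule Cauchy_Schwarz_ineq2)
      also have "\<dots> \<le> 1" using norm_to_real_le[of e] e(1) u by (simp add: nn_steps_def)
      finally have eu: "to_real e \<bullet> u \<le> 1" by simp
      have "2 * ?s * (T - paraboloid u (to_real (x + e))) \<le> 2 * ?s * (T - paraboloid u (to_real x) - 1 / (2 * ?s))"
        using e(2) s by (intro mult_left_mono) auto
      also have "\<dots> \<le> real n" using Suc.prems(3) s by (simp add: right_diff_distrib)
      finally have IH: "(2 * \<kappa>) ^ n \<le> h (x + e)"
        using False eu e(2) Suc.prems(1) s
        by (intro Suc.IH) (auto simp: inner_simps intro: order_trans[OF _ e(2)])
      have "(2 * \<kappa>) ^ Suc n \<le> \<omega> x e * h (x + e)"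
        using mult_mono[OF env_ok_ge[OF ok(1) e(1), of x] IH] env_pos[OF ok e(1), of x] k by simp
      also have "\<dots> \<le> mean_step \<omega> h x"
        unfolding mean_step_def
        by (rule member_le_sum[OF e(1)]) (auto simp: finite_nn_steps nn intro!: mult_nonneg_nonneg less_imp_le[OF env_pos[OF ok]])
      also have "\<dots> \<le> h x" using V[of x] False Suc.prems(1) by (intro super) auto
      finally show ?thesis .
    qed
  qed
  have "paraboloid u (to_real 0) = 0" by (simp add: paraboloid_def)
  moreover have "2 * ?s * T \<le> real (nat \<lceil>2 * ?s * T\<rceil>)" by linarith
  ultimately show ?thesis using T by (intro main) auto
qed

definition general_box :: "((real, 'n::{finite,linorder}) vec, 'n) vec \<Rightarrow> real \<Rightarrow> real \<Rightarrow> real \<Rightarrow> 'n site set" where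
  "general_box R l1 l2 M = {z. - l1 < coord R idx1 z \<and> coord R idx1 z < l2 \<and> (\<forall>j. j \<noteq> idx1 \<longrightarrow> \<bar>coord R j z\<bar> < M)}"

definition general_front :: "((real, 'n::{finite,linorder}) vec, 'n) vec \<Rightarrow> real \<Rightarrow> real \<Rightarrow> 'n site set" where
  "general_front R l2 M = {z. l2 \<le> coord R idx1 z \<and> (\<forall>j. j \<noteq> idx1 \<longrightarrow> \<bar>coord R j z\<bar> < M)}"

text \<open>The box with lower level \<open>-(L - 1)\<close> and upper level \<open>L + 1\<close>: a
  successful crossing gains more than \<open>L\<close>, and a failure loses less than
  \<open>L\<close>, even after the overshoot of one lattice step.\<close>

definition tilt_box :: "((real, 'n::{finite,linorder}) vec, 'n) vec \<Rightarrow> real \<Rightarrow> real \<Rightarrow> 'n site set" where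
  "tilt_box R L M = {z. - (L - 1) < coord R idx1 z \<and> coord R idx1 z < L + 1 \<and> (\<forall>j. j \<noteq> idx1 \<longrightarrow> \<bar>coord R j z\<bar> < M)}"

text \<open>All points beyond the frontal face, not only those adjacent to the box; the exit point is adjacent
  anyway.\<close>

definition tilt_front :: "((real, 'n::{finite,linorder}) vec, 'n) vec \<Rightarrow> real \<Rightarrow> real \<Rightarrow> 'n site set" where
  "tilt_front R L M = {z. L + 1 \<le> coord R idx1 z \<and> (\<forall>j. j \<noteq> idx1 \<longrightarrow> \<bar>coord R j z\<bar> < M)}"

definition pfront :: "((real, 'n::{finite,linorder}) vec, 'n) vec \<Rightarrow> real \<Rightarrow> real \<Rightarrow> 'n env \<Rightarrow> real" where
  "pfront R L M \<omega> = hit \<omega> (tilt_box R L M) (tilt_front R L M) 0"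

lemma finite_tilt_box:
  assumes "orthogonal_matrix R" shows "finite (tilt_box R L M)"
proof -
  let ?m = "\<bar>L\<bar> + \<bar>M\<bar> + 1"
  have "tilt_box R L M \<subseteq> {z. \<forall>j. - ?m \<le> coord R j z \<and> coord R j z \<le> ?m}"
  proof
    fix z assume z: "z \<in> tilt_box R L M"
    have "- ?m \<le> coord R j z \<and> coord R j z \<le> ?m" for j
      using z by (cases "j = idx1") (auto simp: tilt_box_def dest!: spec[of _ j])
    then show "z \<in> {z. \<forall>j. - ?m \<le> coord R j z \<and> coord R j z \<le> ?m}" by simp
  qed
  then show ?thesis
    by (rule finite_subset) (rule lattice_points_rotated_box[OF assms], simp)
qed

lemma paraboloid_lateral:
  fixes R :: "((real, 'n::{finite,linorder}) vec, 'n) vec"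
  assumes R: "orthogonal_matrix R" and s: "s = 1 \<or> s = -1"
    and pos: "0 \<le> paraboloid (s *\<^sub>R (R *v basis_vec idx1)) (to_real z)" and j: "j \<noteq> idx1"
    and less: "s * coord R idx1 z < T" and TM: "2 * sqrt (real CARD('n)) * T \<le> M\<^sup>2" and M: "M > 0"
  shows "\<bar>coord R j z\<bar> < M"
proof -
  let ?u = "s *\<^sub>R (R *v basis_vec idx1)" and ?v = "R *v basis_vec j"
  let ?w = "to_real z - (to_real z \<bullet> ?u) *\<^sub>R ?u"
  have "?u \<bullet> ?v = 0" using inner_columns[OF R, of idx1 j] j by simp
  then have "coord R j z = ?w \<bullet> ?v" by (simp add: coord_def inner_diff_left)
  then have "\<bar>coord R j z\<bar> \<le> norm ?w"
    using Cauchy_Schwarz_ineq2[of ?w ?v] norm_column[OF R, of j] by simp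
  then have "(coord R j z)\<^sup>2 \<le> (norm ?w)\<^sup>2" by (metis abs_ge_zero power2_abs power_mono)
  also have "(norm ?w)\<^sup>2 \<le> 2 * sqrt (real CARD('n)) * (to_real z \<bullet> ?u)"
    using pos by (simp add: paraboloid_def field_simps)
  also have "\<dots> = 2 * sqrt (real CARD('n)) * (s * coord R idx1 z)" by (simp add: coord_def)
  also have "\<dots> < 2 * sqrt (real CARD('n)) * T" using less by (intro mult_strict_left_mono) auto
  finally have "\<bar>coord R j z\<bar>\<^sup>2 < M\<^sup>2" using TM by simp
  then show ?thesis using M by (intro power2_less_imp_less[of "\<bar>coord R j z\<bar>" M]) auto
qed

lemma paraboloid_le: "paraboloid u x \<le> x \<bullet> u"
  by (simp add: paraboloid_def)

text \<open>The paraboloid stays inside the box laterally because its radius at height \<open>h\<close> is of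
  order \<open>sqrt h\<close>.  The upper bound applies the same argument to the failure probability,
  walking in the opposite direction.\<close>

lemma general_front_prob_bounds:
  fixes \<omega> :: "('n::{finite,linorder}) env"
  assumes ok: "env_ok \<kappa> \<omega>" "\<kappa> > 0" and R: "orthogonal_matrix R"
    and l: "0 < l1" "0 < l2" and M: "0 < M" "2 * sqrt (real CARD('n)) * (l1 + 1) \<le> M\<^sup>2" "2 * sqrt (real CARD('n)) * (l2 + 1) \<le> M\<^sup>2"
  shows "(2 * \<kappa>) ^ nat \<lceil>2 * sqrt (real CARD('n)) * l2\<rceil> \<le> hit \<omega> (general_box R l1 l2 M) (general_front R l2 M) 0"
    "hit \<omega> (general_box R l1 l2 M) (general_front R l2 M) 0 < 1"
proof -
  let ?V = "general_box R l1 l2 M" and ?F = "general_front R l2 M"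
  show "(2 * \<kappa>) ^ nat \<lceil>2 * sqrt (real CARD('n)) * l2\<rceil> \<le> hit \<omega> ?V ?F 0"
  proof (rule elliptic_lower_bound[OF ok norm_column[OF R, of idx1] hit_nonneg, where V = ?V])
    let ?u = "R *v basis_vec idx1"
    have lat: "\<bar>coord R j x\<bar> < M" if "0 \<le> paraboloid ?u (to_real x)" "to_real x \<bullet> ?u < l2 + 1" "j \<noteq> idx1" for x j
      using paraboloid_lateral[OF R, of 1 x j "l2 + 1" M] that M by (simp add: coord_def)
    show "x \<in> ?V" if "0 \<le> paraboloid ?u (to_real x)" "to_real x \<bullet> ?u < l2" for x
      using lat[of x] that paraboloid_le[of ?u "to_real x"] l by (auto simp: general_box_def coord_def[of R idx1])
    show "1 \<le> hit \<omega> ?V ?F x"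
      if "0 \<le> paraboloid ?u (to_real x)" "l2 \<le> to_real x \<bullet> ?u" "to_real x \<bullet> ?u < l2 + 1" for x
    proof -
      have "x \<in> ?F" using lat[of x] that by (auto simp: general_front_def coord_def[of R idx1])
      moreover have "x \<notin> ?V" using that by (auto simp: general_box_def coord_def[of R idx1])
      ultimately show ?thesis by (simp add: hit_boundary)
    qed
  qed (use l hit_harmonic[OF ok] in auto)
  let ?u = "(-1) *\<^sub>R (R *v basis_vec idx1)"
  let ?h = "\<lambda>x. 1 - hit \<omega> ?V ?F x"
  have lat: "\<bar>coord R j x\<bar> < M" if "0 \<le> paraboloid ?u (to_real x)" "to_real x \<bullet> ?u < l1 + 1" "j \<noteq> idx1" for x j
    using paraboloid_lateral[OF R, of "-1" x j "l1 + 1" M] that M by (simp add: coord_def)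
  have "(2 * \<kappa>) ^ nat \<lceil>2 * sqrt (real CARD('n)) * l1\<rceil> \<le> ?h 0"
  proof (rule elliptic_lower_bound[OF ok, where V = ?V and u = ?u])
    show "norm ?u = 1" using norm_column[OF R, of idx1] by simp
    show "0 \<le> ?h x" for x by (simp add: hit_le_1)
    show "x \<in> ?V" if "0 \<le> paraboloid ?u (to_real x)" "to_real x \<bullet> ?u < l1" for x
      using lat[of x] that paraboloid_le[of ?u "to_real x"] l by (auto simp: general_box_def coord_def[of R idx1])
    show "1 \<le> ?h x" if "l1 \<le> to_real x \<bullet> ?u" for x
    proof -
      have "x \<notin> ?F" "x \<notin> ?V"
        using that l by (auto simp: general_front_def general_box_def coord_def[of R idx1])
      then show ?thesis by (simp add: hit_boundary)
    qed
    show "mean_step \<omega> ?h x \<le> ?h x" if "x \<in> ?V" for x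
      using hit_harmonic[OF ok that, of ?F] by (simp add: mean_step_diff mean_step_const[OF ok(1)])
  qed (use l in auto)
  moreover have "0 < (2 * \<kappa>) ^ nat \<lceil>2 * sqrt (real CARD('n)) * l1\<rceil>" using ok(2) by simp
  ultimately show "hit \<omega> ?V ?F 0 < 1" by simp
qed

lemma tilt_box_eq: "tilt_box R L M = general_box R (L - 1) (L + 1) M"
  and tilt_front_eq: "tilt_front R L M = general_front R (L + 1) M"
  by (simp_all add: tilt_box_def general_box_def tilt_front_def general_front_def)

lemma pfront_bounds:
  fixes \<omega> :: "('n::{finite,linorder}) env"
  assumes ok: "env_ok \<kappa> \<omega>" "\<kappa> > 0" and R: "orthogonal_matrix R"
    and L: "L > 1" and M: "M > 0" "2 * sqrt (real CARD('n)) * (L + 2) \<le> M\<^sup>2"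
  shows "(2 * \<kappa>) ^ nat \<lceil>2 * sqrt (real CARD('n)) * (L + 1)\<rceil> \<le> pfront R L M \<omega>" "pfront R L M \<omega> < 1"
proof -
  have "2 * sqrt (real CARD('n)) * (L - 1 + 1) \<le> 2 * sqrt (real CARD('n)) * (L + 2)" by (intro mult_left_mono) auto
  then have M': "2 * sqrt (real CARD('n)) * (L - 1 + 1) \<le> M\<^sup>2" "2 * sqrt (real CARD('n)) * (L + 1 + 1) \<le> M\<^sup>2"
    using M(2) by (linarith, simp add: add.assoc)
  have l: "0 < L - 1" "0 < L + 1" using L by auto
  show "(2 * \<kappa>) ^ nat \<lceil>2 * sqrt (real CARD('n)) * (L + 1)\<rceil> \<le> pfront R L M \<omega>" "pfront R L M \<omega> < 1"
    unfolding pfront_def tilt_box_eq tilt_front_eq by (rule general_front_prob_bounds[OF ok R l M(1) M'])+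
qed

section \<open>Decoupling of separated regions\<close>

definition decay_const :: "'n::finite itself \<Rightarrow> real \<Rightarrow> real" where
  "decay_const _ h = (2 / (1 - exp (- h))) ^ CARD('n)"

text \<open>The sum over a cube factorizes into geometric series.\<close>

lemma sum_exp_norm1_le:
  fixes F :: "(int ^ 'n::finite) set"
  assumes "finite F" "h > 0"
  shows "(\<Sum>z\<in>F. exp (- h * norm1 z)) \<le> decay_const TYPE('n) h"
proof -
  define n where "n = Max (insert 0 ((\<lambda>z. \<Sum>i\<in>UNIV. \<bar>z $ i\<bar>) ` F))"
  have n: "\<bar>z $ i\<bar> \<le> n" if "z \<in> F" for z i
  proof -
    have "\<bar>z $ i\<bar> \<le> (\<Sum>i\<in>UNIV. \<bar>z $ i\<bar>)" by (rule member_le_sum) auto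
    also have "\<dots> \<le> n" unfolding n_def using that assms by (intro Max_ge) auto
    finally show ?thesis .
  qed
  have n0: "0 \<le> n" unfolding n_def using assms by (intro Max_ge) auto
  let ?I = "{-n..n}"
  have b: "bij_betw (\<lambda>f. (\<chi> i. f i) :: int ^ 'n) (Pi\<^sub>E UNIV (\<lambda>_. ?I)) {z. \<forall>i. z $ i \<in> ?I}"
    by (rule bij_betwI[of _ _ _ "\<lambda>z i. z $ i"]) auto
  have fin: "finite {z :: int ^ 'n. \<forall>i. z $ i \<in> ?I}" by (rule card_lattice_cube) simp
  have "F \<subseteq> {z. \<forall>i. z $ i \<in> ?I}" using n by (auto simp: abs_le_iff minus_le_iff)
  then have "(\<Sum>z\<in>F. exp (- h * norm1 z)) \<le> (\<Sum>z\<in>{z :: int ^ 'n. \<forall>i. z $ i \<in> ?I}. exp (- h * norm1 z))"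
    by (intro sum_mono2[OF fin]) simp_all
  also have "\<dots> = (\<Sum>f\<in>Pi\<^sub>E UNIV (\<lambda>_. ?I). exp (- h * norm1 ((\<chi> i. f i) :: int ^ 'n)))"
    by (rule sum.reindex_bij_betw[OF b, symmetric])
  also have "\<dots> = (\<Sum>f\<in>Pi\<^sub>E UNIV (\<lambda>_. ?I). \<Prod>i\<in>(UNIV :: 'n set). exp (- h * real_of_int \<bar>f i\<bar>))"
    by (simp add: norm1_def exp_sum[symmetric] sum_distrib_left sum_negf)
  also have "\<dots> = (\<Prod>i\<in>(UNIV :: 'n set). \<Sum>k\<in>?I. exp (- h * real_of_int \<bar>k\<bar>))"
    by (rule prod_sum_PiE[symmetric]) auto
  also have "\<dots> = (\<Sum>k\<in>?I. exp (- h * real_of_int \<bar>k\<bar>)) ^ CARD('n)" by simp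
  also have "\<dots> \<le> (2 / (1 - exp (- h))) ^ CARD('n)"
  proof (rule power_mono)
    have I: "?I \<subseteq> int ` {..nat n} \<union> (\<lambda>k. - int k) ` {..nat n}"
    proof
      fix k assume k: "k \<in> ?I"
      show "k \<in> int ` {..nat n} \<union> (\<lambda>k. - int k) ` {..nat n}"
      proof (cases "0 \<le> k")
        case True then show ?thesis using k by (intro UnI1 image_eqI[of _ _ "nat k"]) auto
      next
        case False then show ?thesis using k by (intro UnI2 image_eqI[of _ _ "nat (- k)"]) auto
      qed
    qed
    let ?f = "\<lambda>k :: int. exp (- h * real_of_int \<bar>k\<bar>)"
    have 1: "(\<Sum>k\<le>m. exp (- h * real k)) \<le> 1 / (1 - exp (- h))" for m
    proof -
      have e: "exp (- h) < 1" using assms by simp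
      have "(\<Sum>k\<le>m. exp (- h * real k)) = (\<Sum>k\<le>m. exp (- h) ^ k)"
        by (simp add: exp_of_nat_mult[symmetric] mult.commute)
      also have "\<dots> \<le> (\<Sum>k. exp (- h) ^ k)"
        using e by (intro sum_le_suminf summable_geometric) auto
      also have "\<dots> = 1 / (1 - exp (- h))" using e by (intro suminf_geometric) auto
      finally show ?thesis .
    qed
    have "sum ?f ?I \<le> sum ?f (int ` {..nat n} \<union> (\<lambda>k. - int k) ` {..nat n})"
      using I by (intro sum_mono2) auto
    also have "\<dots> \<le> sum ?f (int ` {..nat n}) + sum ?f ((\<lambda>k. - int k) ` {..nat n})"
      using sum.union_inter[of "int ` {..nat n}" "(\<lambda>k. - int k) ` {..nat n}" ?f]
        sum_nonneg[of "int ` {..nat n} \<inter> (\<lambda>k. - int k) ` {..nat n}" ?f] by simp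
    also have "\<dots> = (\<Sum>k\<le>nat n. exp (- h * real k)) + (\<Sum>k\<le>nat n. exp (- h * real k))"
      by (simp add: sum.reindex inj_on_def)
    also have "\<dots> \<le> 2 / (1 - exp (- h))" using 1[of "nat n"] by (simp add: field_simps)
    finally show "sum ?f ?I \<le> 2 / (1 - exp (- h))" .
  qed (auto intro: sum_nonneg)
  finally show ?thesis by (simp add: decay_const_def)
qed

text \<open>Half of the exponential rate pays for the distance \<open>s\<close>, the other half for summability.\<close>

lemma infsum_exp_le:
  fixes \<Delta> A :: "(int ^ 'n::finite) set"
  assumes fin: "finite \<Delta>" and g: "g > 0" and s: "\<And>x y. x \<in> \<Delta> \<Longrightarrow> y \<in> A \<Longrightarrow> s \<le> norm1 (x - y)"
  shows "(\<Sum>\<^sub>\<infinity>(x, y)\<in>\<Delta> \<times> A. exp (- g * norm1 (x - y)))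
    \<le> real (card \<Delta>) * decay_const TYPE('n) (g / 2) * exp (- g * s / 2)" (is "_ \<le> ?b")
proof -
  let ?f = "\<lambda>(x, y). exp (- g * norm1 (x - y))"
  have bound: "sum ?f F \<le> ?b" if F: "finite F" "F \<subseteq> \<Delta> \<times> A" for F
  proof -
    have "F \<subseteq> \<Delta> \<times> snd ` F"
    proof
      fix p assume "p \<in> F"
      with F(2) show "p \<in> \<Delta> \<times> snd ` F" by (cases p) (force simp: image_iff)
    qed
    then have "sum ?f F \<le> sum ?f (\<Delta> \<times> (snd ` F))"
      using F(1) fin by (intro sum_mono2) auto
    also have "\<dots> = (\<Sum>x\<in>\<Delta>. \<Sum>y\<in>snd ` F. exp (- g * norm1 (x - y)))"
      by (rule sum.cartesian_product[symmetric])
    also have "\<dots> \<le> (\<Sum>x\<in>\<Delta>. exp (- g * s / 2) * decay_const TYPE('n) (g / 2))"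
    proof (rule sum_mono)
      fix x assume x: "x \<in> \<Delta>"
      have "(\<Sum>y\<in>snd ` F. exp (- g * norm1 (x - y))) \<le> (\<Sum>y\<in>snd ` F. exp (- g * s / 2) * exp (- (g / 2) * norm1 (x - y)))"
      proof (rule sum_mono)
        fix y assume "y \<in> snd ` F"
        then have "s \<le> norm1 (x - y)" using F x by (intro s) auto
        then have "g * s \<le> g * norm1 (x - y)" using g by simp
        then show "exp (- g * norm1 (x - y)) \<le> exp (- g * s / 2) * exp (- (g / 2) * norm1 (x - y))"
          unfolding exp_add[symmetric] by simp
      qed
      also have "\<dots> = exp (- g * s / 2) * (\<Sum>z\<in>(\<lambda>y. x - y) ` snd ` F. exp (- (g / 2) * norm1 z))"
        by (subst sum.reindex) (simp_all add: inj_on_def sum_distrib_left)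
      also have "\<dots> \<le> exp (- g * s / 2) * decay_const TYPE('n) (g / 2)"
        using F g by (intro mult_left_mono sum_exp_norm1_le) auto
      finally show "(\<Sum>y\<in>snd ` F. exp (- g * norm1 (x - y))) \<le> exp (- g * s / 2) * decay_const TYPE('n) (g / 2)" .
    qed
    finally show ?thesis by (simp add: mult_ac)
  qed
  have "?f summable_on (\<Delta> \<times> A)"
  proof (rule nonneg_bdd_above_summable_on)
    show "bdd_above (sum ?f ` {F. F \<subseteq> \<Delta> \<times> A \<and> finite F})"
    proof (rule bdd_aboveI)
      fix t assume "t \<in> sum ?f ` {F. F \<subseteq> \<Delta> \<times> A \<and> finite F}"
      then obtain F where "F \<subseteq> \<Delta> \<times> A" "finite F" "t = sum ?f F" by blast
      then show "t \<le> ?b" using bound[of F] by simp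
    qed
  qed (simp add: case_prod_beta)
  then show ?thesis by (rule infsum_le_finite_sums) (rule bound)
qed

lemma RN_boundedD:
  assumes "RN_bounded \<mu> \<nu> c" "prob_space \<nu>" "prob_space \<mu>" "sets \<mu> = sets \<nu>" "E \<in> sets \<nu>" "c \<ge> 0"
  shows "measure \<mu> E \<le> c * measure \<nu> E"
proof -
  interpret \<nu>: prob_space \<nu> by fact
  interpret \<mu>: prob_space \<mu> by fact
  have "emeasure \<mu> E = emeasure (density \<nu> (RN_deriv \<nu> \<mu>)) E"
    using assms by (subst \<nu>.density_RN_deriv) (auto simp: RN_bounded_def)
  also have "\<dots> = (\<integral>\<^sup>+x. RN_deriv \<nu> \<mu> x * indicator E x \<partial>\<nu>)"
    using assms by (intro emeasure_density) auto
  also have "\<dots> \<le> (\<integral>\<^sup>+x. ennreal c * indicator E x \<partial>\<nu>)"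
    using assms(1) by (intro nn_integral_mono_AE) (auto simp: RN_bounded_def elim!: eventually_mono intro: mult_right_mono)
  also have "\<dots> = ennreal c * emeasure \<nu> E" using assms by (simp add: nn_integral_cmult)
  finally have "ennreal (measure \<mu> E) \<le> ennreal (c * measure \<nu> E)"
    using \<open>c \<ge> 0\<close> by (simp add: \<mu>.emeasure_eq_measure \<nu>.emeasure_eq_measure ennreal_mult)
  then show ?thesis using \<open>c \<ge> 0\<close> by (subst (asm) ennreal_le_iff) auto
qed

lemma measurable_conf_restrict:
  assumes "W \<subseteq> V" shows "(\<lambda>\<omega>. restrict \<omega> W) \<in> conf_space \<kappa> V \<rightarrow>\<^sub>M conf_space \<kappa> W"
  unfolding conf_space_def by (rule measurable_restrict_subset[OF assms])

lemma env_algebra_subalgebra: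
  assumes "random_environment \<kappa> P" shows "subalgebra P (env_algebra \<kappa> A)"
proof -
  note r = random_env_facts[OF assms]
  have 1: "(\<lambda>\<omega>. restrict \<omega> A) \<in> P \<rightarrow>\<^sub>M conf_space \<kappa> A"
    using measurable_conf_restrict[of A UNIV] by (simp add: r(5))
  have sp: "space P = space (conf_space \<kappa> UNIV)" by (simp add: r(3) space_conf_UNIV)
  show ?thesis
    unfolding subalgebra_def env_algebra_def
  proof (intro conjI)
    show "sets (vimage_algebra (space (conf_space \<kappa> UNIV)) (\<lambda>\<omega>. restrict \<omega> A) (conf_space \<kappa> A)) \<subseteq> sets P"
      using sets_image_in_sets[OF sets_eq_imp_space_eq[OF r(2)] 1] by simp
  qed (simp add: sp)
qed

text \<open>The conditional law of the coordinates in \<open>\<Delta>\<close> given those at distance at least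
  \<open>s\<close> varies by at most the factor \<open>c\<close>; averaging one of the two
  conditions compares it with the unconditional law.\<close>

lemma mixing_events:
  fixes P :: "('n::finite) env measure"
  assumes env: "random_environment \<kappa> P" and smg: "SMG \<kappa> r C g P" and C: "C > 0" "g > 0"
    and fin: "finite \<Delta>" and s: "r \<le> s" "s > 0"
    and W: "\<And>x y. x \<in> \<Delta> \<Longrightarrow> y \<in> W \<Longrightarrow> s \<le> norm1 (x - y)"
    and E: "E \<in> sets (conf_space \<kappa> \<Delta>)" and B: "B \<in> sets (conf_space \<kappa> W)"
    and c: "C * (real (card \<Delta>) * decay_const TYPE('n) (g / 2) * exp (- g * s / 2)) \<le> ln c" "c > 0"
  shows "measure P {\<omega> \<in> space P. restrict \<omega> \<Delta> \<in> E \<and> restrict \<omega> W \<in> B}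
    \<le> c * measure P {\<omega> \<in> space P. restrict \<omega> \<Delta> \<in> E} * measure P {\<omega> \<in> space P. restrict \<omega> W \<in> B}"
proof -
  note rf = random_env_facts[OF env]
  interpret prob_space P by (rule rf)
  \<comment> \<open>The conditioning set is everything at distance at least \<open>s\<close>, and the two
    conditions may differ on all of it.\<close>
  define V where "V = {y. \<exists>x\<in>\<Delta>. norm1 (x - y) < s}"
  let ?F = "env_algebra \<kappa> (- V)"
  have V: "y \<in> - V \<Longrightarrow> x \<in> \<Delta> \<Longrightarrow> s \<le> norm1 (x - y)" for x y by (auto simp: V_def not_less)
  have WV: "W \<subseteq> - V" using W by (fastforce simp: V_def)
  interpret sub: finite_measure_subalgebra P ?F
    using env_algebra_subalgebra[OF env] by unfold_locales
  have finV: "finite V"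
  proof -
    have "V \<subseteq> (\<Union>x\<in>\<Delta>. {y. \<forall>i. y $ i \<in> {x $ i - \<lceil>s\<rceil> .. x $ i + \<lceil>s\<rceil>}})"
    proof
      fix y assume "y \<in> V"
      then obtain x where x: "x \<in> \<Delta>" "norm1 (x - y) < s" by (auto simp: V_def)
      have "\<bar>(x - y) $ i\<bar> \<le> \<lceil>s\<rceil>" for i
      proof -
        have "\<bar>(x - y) $ i\<bar> \<le> (\<Sum>i\<in>UNIV. \<bar>(x - y) $ i\<bar>)" by (rule member_le_sum) auto
        also have "\<dots> \<le> \<lceil>s\<rceil>" using x(2) unfolding norm1_def by linarith
        finally show ?thesis .
      qed
      then have "\<forall>i. y $ i \<in> {x $ i - \<lceil>s\<rceil> .. x $ i + \<lceil>s\<rceil>}" by (auto simp: abs_le_iff algebra_simps)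
      with x show "y \<in> (\<Union>x\<in>\<Delta>. {y. \<forall>i. y $ i \<in> {x $ i - \<lceil>s\<rceil> .. x $ i + \<lceil>s\<rceil>}})" by blast
    qed
    moreover have "finite (\<Union>x\<in>\<Delta>. {y. \<forall>i. y $ i \<in> {x $ i - \<lceil>s\<rceil> .. x $ i + \<lceil>s\<rceil>}})"
      by (intro finite_UN_I fin card_lattice_cube) simp
    ultimately show ?thesis by (rule finite_subset)
  qed
  have DV: "\<Delta> \<subseteq> V"
  proof
    fix x assume "x \<in> \<Delta>"
    moreover have "norm1 (x - x) < s" using s(2) by (simp add: norm1_def)
    ultimately show "x \<in> V" unfolding V_def by blast
  qed
    have d: "ereal r \<le> dist1 \<Delta> (- V)"
      unfolding dist1_def using V s(1) by (intro INF_greatest) (auto intro: order_trans)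
    obtain K G where K: "regular_cond_law \<kappa> P \<Delta> V K" and GAE: "AE \<omega> in P. restrict \<omega> (- V) \<in> G"
      and Gsp: "G \<subseteq> space (conf_space \<kappa> (- V))"
      and RN: "\<forall>\<eta>\<in>G. \<forall>\<eta>'\<in>G. (\<forall>x\<in>- V - (- V). \<eta> x = \<eta>' x) \<longrightarrow>
              RN_bounded (K \<eta>) (K \<eta>') (exp (C * (\<Sum>\<^sub>\<infinity>(x, y)\<in>\<Delta> \<times> (- V). exp (- g * norm1 (x - y)))))"
      using smg[unfolded SMG_def, THEN conjunct2, THEN spec[of _ \<Delta>], THEN spec[of _ V], THEN spec[of _ "- V"],
          THEN mp, OF conjI[OF finV conjI[OF DV conjI[OF d subset_refl]]]]
      by (elim exE conjE)
    let ?c0 = "exp (C * (\<Sum>\<^sub>\<infinity>(x, y)\<in>\<Delta> \<times> (- V). exp (- g * norm1 (x - y))))"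
    have "C * (\<Sum>\<^sub>\<infinity>(x, y)\<in>\<Delta> \<times> (- V). exp (- g * norm1 (x - y))) \<le> ln c"
      using mult_left_mono[OF infsum_exp_le[OF fin C(2), of "- V" s]] V C(1) c(1) by (smt (verit))
    then have "?c0 \<le> exp (ln c)" by (rule iffD2[OF exp_le_cancel_iff])
    then have c0: "?c0 \<le> c" using c(2) by simp
    have Kp: "prob_space (K \<eta>)" "sets (K \<eta>) = sets (conf_space \<kappa> \<Delta>)" if "\<eta> \<in> G" for \<eta>
      using K that Gsp measurable_space[of K "conf_space \<kappa> (- V)" "prob_algebra (conf_space \<kappa> \<Delta>)" \<eta>]
      by (auto simp: regular_cond_law_def space_prob_algebra)
    have KK: "measure (K \<eta>) E \<le> c * measure (K \<eta>') E" if "\<eta> \<in> G" "\<eta>' \<in> G" for \<eta> \<eta>'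
    proof -
      have "measure (K \<eta>) E \<le> ?c0 * measure (K \<eta>') E"
        using RN that E by (intro RN_boundedD) (auto simp: Kp)
      also have "\<dots> \<le> c * measure (K \<eta>') E" using c0 by (intro mult_right_mono) auto
      finally show ?thesis .
    qed
    let ?E = "{\<omega> \<in> space P. restrict \<omega> \<Delta> \<in> E}" and ?B = "{\<omega> \<in> space P. restrict \<omega> W \<in> B}"
    let ?cond = "real_cond_exp P ?F (indicator ?E)"
    have mE: "?E \<in> sets P"
      using measurable_sets[of "\<lambda>\<omega>. restrict \<omega> \<Delta>" P "conf_space \<kappa> \<Delta>" E] measurable_conf_restrict[of \<Delta> UNIV \<kappa>] E
      by (simp add: rf(5) vimage_def Int_def conj_commute)
    have intE: "integrable P (indicator ?E :: _ \<Rightarrow> real)"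
      by (rule integrable_real_indicator[OF mE]) (simp add: emeasure_eq_measure)
    have eq: "AE \<omega> in P. measure (K (restrict \<omega> (- V))) E = ?cond \<omega>"
      using K E by (simp add: regular_cond_law_def cond_prob_env_def)
    have int_cond: "integrable P ?cond" "(\<integral>\<omega>. ?cond \<omega> \<partial>P) = measure P ?E"
      using sub.real_cond_exp_int[OF intE] mE by auto
    have le: "AE \<omega> in P. ?cond \<omega> \<le> c * measure P ?E"
      using eq GAE
    proof eventually_elim
      case (elim \<omega>)
      have "AE \<omega>' in P. ?cond \<omega> \<le> c * ?cond \<omega>'"
        using eq GAE
      proof eventually_elim
        case (elim \<omega>')
        then show ?case using KK[of "restrict \<omega> (- V)" "restrict \<omega>' (- V)"] \<open>restrict \<omega> (- V) \<in> G\<close> \<open>_ = ?cond \<omega>\<close> by simp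
      qed
      then have "(\<integral>\<omega>'. ?cond \<omega> \<partial>P) \<le> (\<integral>\<omega>'. c * ?cond \<omega>' \<partial>P)"
        using int_cond(1) by (intro integral_mono_AE) auto
      then show ?case using int_cond(2) prob_space by simp
    qed
    have mB: "?B \<in> sets ?F"
    proof -
      let ?B' = "(\<lambda>\<omega>. restrict \<omega> W) -` B \<inter> space (conf_space \<kappa> (- V))"
      have "?B' \<in> sets (conf_space \<kappa> (- V))"
        using measurable_conf_restrict[OF WV] B by (rule measurable_sets)
      then have "(\<lambda>\<omega>. restrict \<omega> (- V)) -` ?B' \<inter> space (conf_space \<kappa> UNIV) \<in> sets ?F"
        unfolding env_algebra_def by (rule in_vimage_algebra)
      also have "(\<lambda>\<omega>. restrict \<omega> (- V)) -` ?B' \<inter> space (conf_space \<kappa> UNIV) = ?B"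
      proof -
        have "restrict (restrict \<omega> (- V)) W = restrict \<omega> W" for \<omega> :: "'n env"
          using WV by (simp add: Int_absorb1)
        then show ?thesis
          by (auto simp: rf(3) space_conf_UNIV space_conf_space env_ok_def)
      qed
      finally show ?thesis .
    qed
    have mB': "?B \<in> sets P" using mB sub.subalg by (auto simp: subalgebra_def)
    have "measure P {\<omega> \<in> space P. restrict \<omega> \<Delta> \<in> E \<and> restrict \<omega> W \<in> B} = measure P (?B \<inter> ?E)"
      by (rule arg_cong[of _ _ "measure P"]) auto
    also have "\<dots> = (\<integral>\<omega>. indicator ?B \<omega> * indicator ?E \<omega> \<partial>P)"
      using mE mB' by (simp add: indicator_inter_arith[symmetric])
    also have "\<dots> = (\<integral>\<omega>. indicator ?B \<omega> * ?cond \<omega> \<partial>P)"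
    proof (rule sub.real_cond_exp_intg(2)[symmetric])
      show "integrable P (\<lambda>\<omega>. indicator ?B \<omega> * indicator ?E \<omega> :: real)"
        unfolding indicator_inter_arith[symmetric]
        by (rule integrable_real_indicator) (use mE mB' in \<open>auto simp: emeasure_eq_measure\<close>)
    qed (use mE mB in auto)
    also have "\<dots> \<le> (\<integral>\<omega>. indicator ?B \<omega> * (c * measure P ?E) \<partial>P)"
    proof (rule integral_mono_AE)
      show "integrable P (\<lambda>\<omega>. indicator ?B \<omega> * ?cond \<omega>)"
        using integrable_mult_indicator[OF mB' int_cond(1)] by simp
      show "AE \<omega> in P. indicator ?B \<omega> * ?cond \<omega> \<le> indicator ?B \<omega> * (c * measure P ?E)"
        using le by eventually_elim (auto simp: indicator_def)
      show "integrable P (\<lambda>\<omega>. indicator ?B \<omega> * (c * measure P ?E))"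
        by (intro integrable_mult_left integrable_real_indicator[OF mB']) (simp add: emeasure_eq_measure)
    qed
    also have "\<dots> = c * measure P ?E * measure P ?B" using mB' by simp
    finally show ?thesis .
qed

definition local_on :: "real \<Rightarrow> 'n site set \<Rightarrow> (('n::finite) env \<Rightarrow> ennreal) \<Rightarrow> bool" where
  "local_on \<kappa> W F \<longleftrightarrow> F \<in> borel_measurable (conf_space \<kappa> UNIV) \<and>
     (\<forall>\<omega> \<omega>'. env_ok \<kappa> \<omega> \<longrightarrow> env_ok \<kappa> \<omega>' \<longrightarrow> (\<forall>x\<in>W. \<omega> x = \<omega>' x) \<longrightarrow> F \<omega> = F \<omega>')"

text \<open>Freezing the coordinates outside \<open>W\<close> exhibits the dependence as a measurable function of
  the restriction.\<close>

lemma local_on_factor: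
  fixes F :: "('n::finite) env \<Rightarrow> ennreal" and \<omega>0 :: "'n env"
  assumes F: "local_on \<kappa> W F" and \<omega>0: "env_ok \<kappa> \<omega>0"
  obtains F' where "F' \<in> borel_measurable (conf_space \<kappa> W)" "\<And>\<omega>. env_ok \<kappa> \<omega> \<Longrightarrow> F \<omega> = F' (restrict \<omega> W)"
proof
  let ?m = "\<lambda>\<eta> y. if y \<in> W then \<eta> y else \<omega>0 y"
  have m: "?m \<in> conf_space \<kappa> W \<rightarrow>\<^sub>M conf_space \<kappa> UNIV"
    unfolding conf_space_def
  proof (rule measurable_PiM_single')
    fix y :: "'n site"
    show "(\<lambda>\<eta>. ?m \<eta> y) \<in> Pi\<^sub>M W (\<lambda>x. site_space \<kappa>) \<rightarrow>\<^sub>M site_space \<kappa>"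
      using \<omega>0 by (cases "y \<in> W") (auto simp: env_ok_def space_site_space intro: measurable_component_singleton)
  qed (use \<omega>0 in \<open>auto simp: space_PiM space_site_space env_ok_def\<close>)
  show "(\<lambda>\<eta>. F (?m \<eta>)) \<in> borel_measurable (conf_space \<kappa> W)"
    using F by (intro measurable_compose[OF m]) (simp add: local_on_def)
  fix \<omega> :: "'n env" assume \<omega>: "env_ok \<kappa> \<omega>"
  then have "env_ok \<kappa> (?m (restrict \<omega> W))" using \<omega>0 by (simp add: env_ok_def)
  moreover have "\<forall>x\<in>W. \<omega> x = ?m (restrict \<omega> W) x" by simp
  ultimately show "F \<omega> = F (?m (restrict \<omega> W))" using F \<omega> unfolding local_on_def by blast
qed

lemma nn_integral_mono_measures:
  assumes "sets M = sets N" and le: "\<And>A. A \<in> sets N \<Longrightarrow> emeasure M A \<le> c * emeasure N A"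
    and f: "f \<in> borel_measurable N"
  shows "(\<integral>\<^sup>+x. f x \<partial>M) \<le> c * (\<integral>\<^sup>+x. f x \<partial>N)"
proof -
  have "emeasure M A \<le> emeasure (scale_measure c N) A" for A
  proof (cases "A \<in> sets N")
    case True then show ?thesis using le by simp
  next
    case False then show ?thesis using assms(1) by (simp add: emeasure_notin_sets)
  qed
  then have "M \<le> scale_measure c N"
    using assms(1) by (subst le_measure) (auto simp: le_fun_def)
  then have "(\<integral>\<^sup>+x. f x \<partial>M) \<le> (\<integral>\<^sup>+x. f x \<partial>scale_measure c N)"
    using assms by (intro nn_integral_mono_measure) auto
  then show ?thesis using f by (simp add: nn_integral_scale_measure)
qed

text \<open>The inequality for events says that one measure is dominated by a multiple of another; this passes
  to integrals, first in one functional and then in the other.\<close>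

lemma mixing_functions:
  fixes P :: "('n::finite) env measure"
  assumes env: "random_environment \<kappa> P" and smg: "SMG \<kappa> r C g P" and C: "C > 0" "g > 0"
    and fin: "finite \<Delta>" and s: "r \<le> s" "s > 0"
    and W: "\<And>x y. x \<in> \<Delta> \<Longrightarrow> y \<in> W \<Longrightarrow> s \<le> norm1 (x - y)"
    and F: "local_on \<kappa> \<Delta> F" and H: "local_on \<kappa> W H"
    and c: "C * (real (card \<Delta>) * decay_const TYPE('n) (g / 2) * exp (- g * s / 2)) \<le> ln c" "c > 0"
  shows "(\<integral>\<^sup>+\<omega>. F \<omega> * H \<omega> \<partial>P) \<le> ennreal c * (\<integral>\<^sup>+\<omega>. F \<omega> \<partial>P) * (\<integral>\<^sup>+\<omega>. H \<omega> \<partial>P)"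
proof -
  note rf = random_env_facts[OF env]
  interpret prob_space P by (rule rf)
  have "{\<omega> :: 'n env. env_ok \<kappa> \<omega>} \<noteq> {}" using not_empty unfolding rf(3) .
  then obtain \<omega>0 :: "'n env" where \<omega>0: "env_ok \<kappa> \<omega>0" by blast
  obtain F' where F': "F' \<in> borel_measurable (conf_space \<kappa> \<Delta>)" "\<And>\<omega>. env_ok \<kappa> \<omega> \<Longrightarrow> F \<omega> = F' (restrict \<omega> \<Delta>)"
    by (rule local_on_factor[OF F \<omega>0]) blast
  obtain H' where H': "H' \<in> borel_measurable (conf_space \<kappa> W)" "\<And>\<omega>. env_ok \<kappa> \<omega> \<Longrightarrow> H \<omega> = H' (restrict \<omega> W)"
    by (rule local_on_factor[OF H \<omega>0]) blast
  have FP: "F \<in> borel_measurable P" "H \<in> borel_measurable P"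
    using F H by (simp_all add: local_on_def rf(5))
  have rD: "(\<lambda>\<omega>. restrict \<omega> A) \<in> P \<rightarrow>\<^sub>M conf_space \<kappa> A" for A
    using measurable_conf_restrict[of A UNIV \<kappa>] by (simp add: rf(5))
  have set: "{\<omega> \<in> space P. restrict \<omega> A \<in> E} \<in> sets P" if "E \<in> sets (conf_space \<kappa> A)" for A E
    using measurable_sets[OF rD[of A] that] by (simp add: vimage_def Int_def conj_commute)
  have ev: "emeasure P {\<omega> \<in> space P. restrict \<omega> \<Delta> \<in> E \<and> restrict \<omega> W \<in> B}
      \<le> ennreal c * emeasure P {\<omega> \<in> space P. restrict \<omega> \<Delta> \<in> E} * emeasure P {\<omega> \<in> space P. restrict \<omega> W \<in> B}"
    if "E \<in> sets (conf_space \<kappa> \<Delta>)" "B \<in> sets (conf_space \<kappa> W)" for E B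
    using mixing_events[OF env smg C fin s W that c] \<open>c > 0\<close>
    by (simp add: emeasure_eq_measure ennreal_mult[symmetric])
  have 1: "(\<integral>\<^sup>+\<omega>. F \<omega> * indicator {\<omega> \<in> space P. restrict \<omega> W \<in> B} \<omega> \<partial>P)
      \<le> (ennreal c * emeasure P {\<omega> \<in> space P. restrict \<omega> W \<in> B}) * (\<integral>\<^sup>+\<omega>. F \<omega> \<partial>P)"
    if B: "B \<in> sets (conf_space \<kappa> W)" for B
  proof -
    let ?B = "{\<omega> \<in> space P. restrict \<omega> W \<in> B}"
    let ?D = "density P (indicator ?B)"
    let ?M = "distr ?D (conf_space \<kappa> \<Delta>) (\<lambda>\<omega>. restrict \<omega> \<Delta>)"
    let ?N = "distr P (conf_space \<kappa> \<Delta>) (\<lambda>\<omega>. restrict \<omega> \<Delta>)"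
    have mB: "?B \<in> sets P" by (rule set[OF B])
    have rD': "(\<lambda>\<omega>. restrict \<omega> \<Delta>) \<in> ?D \<rightarrow>\<^sub>M conf_space \<kappa> \<Delta>" using rD by simp
    have "(\<integral>\<^sup>+\<eta>. F' \<eta> \<partial>?M) \<le> (ennreal c * emeasure P ?B) * (\<integral>\<^sup>+\<eta>. F' \<eta> \<partial>?N)"
    proof (rule nn_integral_mono_measures)
      fix A assume "A \<in> sets ?N"
      then have A: "A \<in> sets (conf_space \<kappa> \<Delta>)" by simp
      have "emeasure ?M A = emeasure ?D {\<omega> \<in> space P. restrict \<omega> \<Delta> \<in> A}"
        using A rD' by (simp add: emeasure_distr vimage_def Int_def conj_commute)
      also have "\<dots> = emeasure P (?B \<inter> {\<omega> \<in> space P. restrict \<omega> \<Delta> \<in> A})"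
        using mB set[OF A] by (subst emeasure_density) (auto simp: indicator_inter_arith[symmetric])
      also have "?B \<inter> {\<omega> \<in> space P. restrict \<omega> \<Delta> \<in> A} = {\<omega> \<in> space P. restrict \<omega> \<Delta> \<in> A \<and> restrict \<omega> W \<in> B}" by auto
      also have "emeasure P \<dots> \<le> ennreal c * emeasure P {\<omega> \<in> space P. restrict \<omega> \<Delta> \<in> A} * emeasure P ?B"
        by (rule ev[OF A B])
      also have "emeasure P {\<omega> \<in> space P. restrict \<omega> \<Delta> \<in> A} = emeasure ?N A"
        using A rD by (simp add: emeasure_distr vimage_def Int_def conj_commute)
      finally show "emeasure ?M A \<le> (ennreal c * emeasure P ?B) * emeasure ?N A" by (simp only: mult_ac)
    qed (use F' in auto)
    also have "(\<integral>\<^sup>+\<eta>. F' \<eta> \<partial>?M) = (\<integral>\<^sup>+\<omega>. F' (restrict \<omega> \<Delta>) \<partial>?D)"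
      using F'(1) by (subst nn_integral_distr[OF rD']) auto
    also have "\<dots> = (\<integral>\<^sup>+\<omega>. indicator ?B \<omega> * F' (restrict \<omega> \<Delta>) \<partial>P)"
      using mB measurable_compose[OF rD[of \<Delta>] F'(1)] by (subst nn_integral_density) auto
    also have "\<dots> = (\<integral>\<^sup>+\<omega>. F \<omega> * indicator ?B \<omega> \<partial>P)"
      by (rule nn_integral_cong) (simp add: rf(3) F'(2) mult.commute)
    also have "(\<integral>\<^sup>+\<eta>. F' \<eta> \<partial>?N) = (\<integral>\<^sup>+\<omega>. F' (restrict \<omega> \<Delta>) \<partial>P)"
      using F'(1) by (subst nn_integral_distr[OF rD]) auto
    also have "\<dots> = (\<integral>\<^sup>+\<omega>. F \<omega> \<partial>P)"
      by (rule nn_integral_cong) (simp add: rf(3) F'(2))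
    finally show ?thesis .
  qed
  let ?D = "density P F"
  let ?M = "distr ?D (conf_space \<kappa> W) (\<lambda>\<omega>. restrict \<omega> W)"
  let ?N = "distr P (conf_space \<kappa> W) (\<lambda>\<omega>. restrict \<omega> W)"
  have rD': "(\<lambda>\<omega>. restrict \<omega> W) \<in> ?D \<rightarrow>\<^sub>M conf_space \<kappa> W" using rD by simp
  have "(\<integral>\<^sup>+\<eta>. H' \<eta> \<partial>?M) \<le> (ennreal c * (\<integral>\<^sup>+\<omega>. F \<omega> \<partial>P)) * (\<integral>\<^sup>+\<eta>. H' \<eta> \<partial>?N)"
  proof (rule nn_integral_mono_measures)
    fix A assume "A \<in> sets ?N"
    then have A: "A \<in> sets (conf_space \<kappa> W)" by simp
    have "emeasure ?M A = emeasure ?D {\<omega> \<in> space P. restrict \<omega> W \<in> A}"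
      using A rD' by (simp add: emeasure_distr vimage_def Int_def conj_commute)
    also have "\<dots> = (\<integral>\<^sup>+\<omega>. F \<omega> * indicator {\<omega> \<in> space P. restrict \<omega> W \<in> A} \<omega> \<partial>P)"
      using FP set[OF A] by (subst emeasure_density) auto
    also note 1[OF A]
    also have "emeasure P {\<omega> \<in> space P. restrict \<omega> W \<in> A} = emeasure ?N A"
      using A rD by (simp add: emeasure_distr vimage_def Int_def conj_commute)
    finally show "emeasure ?M A \<le> (ennreal c * (\<integral>\<^sup>+\<omega>. F \<omega> \<partial>P)) * emeasure ?N A" by (simp only: mult_ac)
  qed (use H' in auto)
  also have "(\<integral>\<^sup>+\<eta>. H' \<eta> \<partial>?M) = (\<integral>\<^sup>+\<omega>. H' (restrict \<omega> W) \<partial>?D)"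
    using H'(1) by (subst nn_integral_distr[OF rD']) auto
  also have "\<dots> = (\<integral>\<^sup>+\<omega>. F \<omega> * H' (restrict \<omega> W) \<partial>P)"
    using FP measurable_compose[OF rD[of W] H'(1)] by (subst nn_integral_density) auto
  also have "\<dots> = (\<integral>\<^sup>+\<omega>. F \<omega> * H \<omega> \<partial>P)"
    by (rule nn_integral_cong) (simp add: rf(3) H'(2))
  also have "(\<integral>\<^sup>+\<eta>. H' \<eta> \<partial>?N) = (\<integral>\<^sup>+\<omega>. H' (restrict \<omega> W) \<partial>P)"
    using H'(1) by (subst nn_integral_distr[OF rD]) auto
  also have "\<dots> = (\<integral>\<^sup>+\<omega>. H \<omega> \<partial>P)"
    by (rule nn_integral_cong) (simp add: rf(3) H'(2))
  finally show ?thesis .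
qed

lemma local_on_prod:
  fixes F :: "'j \<Rightarrow> ('n::finite) env \<Rightarrow> ennreal"
  assumes "finite J" "\<And>j. j \<in> J \<Longrightarrow> local_on \<kappa> (D j) (F j)"
  shows "local_on \<kappa> (\<Union>j\<in>J. D j) (\<lambda>\<omega>. \<Prod>j\<in>J. F j \<omega>)"
  unfolding local_on_def
proof (intro conjI allI impI)
  show "(\<lambda>\<omega>. \<Prod>j\<in>J. F j \<omega>) \<in> borel_measurable (conf_space \<kappa> UNIV)"
    using assms(2) by (intro borel_measurable_prod_ennreal) (simp add: local_on_def)
  fix \<omega> \<omega>' :: "'n env"
  assume ok: "env_ok \<kappa> \<omega>" "env_ok \<kappa> \<omega>'" and eq: "\<forall>x\<in>(\<Union>j\<in>J. D j). \<omega> x = \<omega>' x"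
  have "F j \<omega> = F j \<omega>'" if j: "j \<in> J" for j
  proof -
    have "\<omega> x = \<omega>' x" if "x \<in> D j" for x using eq j that by blast
    then show ?thesis using assms(2)[OF j, unfolded local_on_def, THEN conjunct2, rule_format, OF ok] by blast
  qed
  then show "(\<Prod>j\<in>J. F j \<omega>) = (\<Prod>j\<in>J. F j \<omega>')" by (rule prod.cong[OF refl])
qed

text \<open>The constant \<open>3\<close> is a bound for \<open>exp 1\<close>.\<close>

lemma mixing_product:
  fixes P :: "('n::finite) env measure"
  assumes env: "random_environment \<kappa> P" and smg: "SMG \<kappa> r C g P" and C: "C > 0" "g > 0"
    and s: "r \<le> s" "s > 0" and J: "finite J"
    and fin: "\<And>j. j \<in> J \<Longrightarrow> finite (D j)"
    and sep: "\<And>i j x y. i \<in> J \<Longrightarrow> j \<in> J \<Longrightarrow> i \<noteq> j \<Longrightarrow> x \<in> D i \<Longrightarrow> y \<in> D j \<Longrightarrow> s \<le> norm1 (x - y)"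
    and F: "\<And>j. j \<in> J \<Longrightarrow> local_on \<kappa> (D j) (F j)"
    and c: "\<And>j. j \<in> J \<Longrightarrow> C * (real (card (D j)) * decay_const TYPE('n) (g / 2) * exp (- g * s / 2)) \<le> 1"
  shows "(\<integral>\<^sup>+\<omega>. (\<Prod>j\<in>J. F j \<omega>) \<partial>P) \<le> (\<Prod>j\<in>J. ennreal 3 * (\<integral>\<^sup>+\<omega>. F j \<omega> \<partial>P))"
  using J fin sep F c
proof (induction J rule: finite_induct)
  case empty
  then show ?case using prob_space.emeasure_space_1[OF random_env_facts(1)[OF env]] by simp
next
  case (insert i J)
  have "(1::real) \<le> ln 3" using exp_le by (subst ln_ge_iff) auto
  then have "(\<integral>\<^sup>+\<omega>. F i \<omega> * (\<Prod>j\<in>J. F j \<omega>) \<partial>P)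
     \<le> ennreal 3 * (\<integral>\<^sup>+\<omega>. F i \<omega> \<partial>P) * (\<integral>\<^sup>+\<omega>. (\<Prod>j\<in>J. F j \<omega>) \<partial>P)"
  proof (intro mixing_functions[OF env smg C, where \<Delta> = "D i" and W = "\<Union>j\<in>J. D j" and s = s])
    show "C * (real (card (D i)) * decay_const TYPE('n) (g / 2) * exp (- g * s / 2)) \<le> ln 3" if "1 \<le> ln (3::real)"
      using insert.prems(4)[of i] that by simp
    show "s \<le> norm1 (x - y)" if "x \<in> D i" "y \<in> (\<Union>j\<in>J. D j)" for x y
      using that insert.prems(2) insert.hyps(2) by blast
  qed (use insert s in \<open>auto intro: local_on_prod\<close>)
  also have "(\<integral>\<^sup>+\<omega>. (\<Prod>j\<in>J. F j \<omega>) \<partial>P) \<le> (\<Prod>j\<in>J. ennreal 3 * (\<integral>\<^sup>+\<omega>. F j \<omega> \<partial>P))"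
  proof (rule insert.IH)
    show "s \<le> norm1 (x - y)" if "k \<in> J" "j \<in> J" "k \<noteq> j" "x \<in> D k" "y \<in> D j" for k j x y
      using that by (intro insert.prems(2)[of k j]) auto
  qed (use insert.prems in auto)
  finally show ?case using insert.hyps by (simp add: mult_left_mono)
qed

section \<open>Crossing a large box: quenched comparison with a one-dimensional walk\<close>

definition ratio :: "((real, 'n::{finite,linorder}) vec, 'n) vec \<Rightarrow> real \<Rightarrow> real \<Rightarrow> 'n env \<Rightarrow> real" where
  "ratio R L M \<omega> = (1 - pfront R L M \<omega>) / pfront R L M \<omega>"

definition slab :: "((real, 'n::{finite,linorder}) vec, 'n) vec \<Rightarrow> real \<Rightarrow> real \<Rightarrow> int \<Rightarrow> 'n site set" where
  "slab R L M i = {x. of_int i * L \<le> coord R idx1 x \<and> coord R idx1 x < (of_int i + 1) * L \<and>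
     (\<forall>j. j \<noteq> idx1 \<longrightarrow> \<bar>coord R j x\<bar> < M)}"

locale tilted_boxes =
  fixes \<kappa> :: real and R :: "((real, 'n::{finite,linorder}) vec, 'n) vec" and L M :: real
  assumes kappa_pos: "0 < \<kappa>" and orth: "orthogonal_matrix R"
    and L_gt: "real CARD('n) < L" and L_ge: "4 \<le> L" and L_le_M: "L \<le> M"
    and M_sq: "2 * sqrt (real CARD('n)) * (L + 2) \<le> M\<^sup>2"
begin

abbreviation "pf \<equiv> pfront R L M"
abbreviation "B0 \<equiv> tilt_box R L M"

lemma pf_bounds:
  assumes "env_ok \<kappa> \<omega>"
  shows "0 < pf \<omega>" "pf \<omega> < 1"
proof -
  have "0 < (2 * \<kappa>) ^ nat \<lceil>2 * sqrt (real CARD('n)) * (L + 1)\<rceil>" using kappa_pos by simp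
  also have "\<dots> \<le> pf \<omega>"
    by (rule pfront_bounds(1)[OF assms kappa_pos orth]) (use L_ge L_le_M M_sq in auto)
  finally show "0 < pf \<omega>" .
  show "pf \<omega> < 1"
    by (rule pfront_bounds(2)[OF assms kappa_pos orth]) (use L_ge L_le_M M_sq in auto)
qed

lemma ratio_pos: "env_ok \<kappa> \<omega> \<Longrightarrow> 0 < ratio R L M \<omega>"
  using pf_bounds[of \<omega>] by (simp add: ratio_def)

lemma fail_le_ratio: "env_ok \<kappa> \<omega> \<Longrightarrow> 1 - pf \<omega> \<le> ratio R L M \<omega>"
  using pf_bounds[of \<omega>] mult_left_le[of "pf \<omega>" "1 - pf \<omega>"] by (simp add: ratio_def le_divide_eq)

lemma zero_in_box: "0 \<in> B0"
  using L_ge L_le_M by (simp add: tilt_box_def)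

text \<open>\<open>box_comparison\<close> for a translate of the small box, in tilted coordinates.  The extra
  unit in the second boundary condition is the overshoot at the exit.\<close>

lemma walk_comparison:
  assumes ok: "env_ok \<kappa> \<omega>"
    and sub: "\<And>z. \<bar>coord R idx1 z - coord R idx1 x\<bar> < L + 1 \<Longrightarrow> coord R idx1 x - (L - 1) < coord R idx1 z \<Longrightarrow>
       (\<And>j. j \<noteq> idx1 \<Longrightarrow> \<bar>coord R j z - coord R j x\<bar> < M) \<Longrightarrow> w z \<le> mean_step \<omega> w z"
    and front: "\<And>z. coord R idx1 x + L + 1 \<le> coord R idx1 z \<Longrightarrow> coord R idx1 z \<le> coord R idx1 x + L + 2 \<Longrightarrow>
       (\<And>j. j \<noteq> idx1 \<Longrightarrow> \<bar>coord R j z - coord R j x\<bar> < M) \<Longrightarrow> w z \<le> \<alpha>"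
    and other: "\<And>z. coord R idx1 x - L \<le> coord R idx1 z \<Longrightarrow> coord R idx1 z \<le> coord R idx1 x + L + 2 \<Longrightarrow>
       (\<And>j. j \<noteq> idx1 \<Longrightarrow> \<bar>coord R j z - coord R j x\<bar> \<le> M + 1) \<Longrightarrow> w z \<le> \<beta>"
  shows "w x \<le> \<alpha> * pf (env_shift x \<omega>) + \<beta> * (1 - pf (env_shift x \<omega>))"
  unfolding pfront_def
proof (rule box_comparison[OF ok kappa_pos finite_tilt_box[OF orth] zero_in_box])
  fix y assume y: "y \<in> B0"
  then show "w (x + y) \<le> mean_step \<omega> w (x + y)"
    using L_ge by (intro sub) (auto simp: tilt_box_def)
  fix e :: "'n site" assume e: "e \<in> nn_steps"
  have st: "\<bar>coord R j e\<bar> \<le> 1" for j by (rule abs_coord_step[OF orth e])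
  have c1: "coord R idx1 y > -(L - 1)" "coord R idx1 y < L + 1"
    and cj: "\<And>j. j \<noteq> idx1 \<Longrightarrow> \<bar>coord R j y\<bar> < M" using y by (auto simp: tilt_box_def)
  { assume "y + e \<in> tilt_front R L M"
    then show "w (x + (y + e)) \<le> \<alpha>"
      using c1 st[of idx1] by (intro front) (auto simp: tilt_front_def) }
  show "w (x + (y + e)) \<le> \<beta>"
  proof (rule other)
    show "coord R idx1 x - L \<le> coord R idx1 (x + (y + e))" "coord R idx1 (x + (y + e)) \<le> coord R idx1 x + L + 2"
      using c1 st[of idx1] by auto
    show "\<bar>coord R j (x + (y + e)) - coord R j x\<bar> \<le> M + 1" if "j \<noteq> idx1" for j
      using cj[OF that] st[of j] by auto
  qed
qed

text \<open>Rounding a point of the axis; this guarantees that all slab odds are positive, which is needed for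
  strictness in \<open>bottom_exit_le_weights\<close>.\<close>

lemma slab_nonempty:
  assumes "real CARD('n) < M'" shows "slab R L M' i \<noteq> {}"
proof -
  let ?t = "(of_int i + 1 / 2) * L"
  let ?c = "?t *\<^sub>R (R *v basis_vec idx1)"
  define z where "z = (\<chi> k. round (?c $ k))"
  have "\<bar>(to_real z - ?c) $ k\<bar> \<le> 1 / 2" for k
    using of_int_round_abs_le[of "?c $ k"] by (simp add: z_def to_real_def)
  then have "(\<Sum>k\<in>UNIV. \<bar>(to_real z - ?c) $ k\<bar>) \<le> (\<Sum>k\<in>(UNIV :: 'n set). 1 / 2)"
    by (rule sum_mono)
  then have n: "norm (to_real z - ?c) \<le> real CARD('n) / 2"
    using norm_le_l1_cart[of "to_real z - ?c"] by simp
  have c: "\<bar>coord R j z - (if j = idx1 then ?t else 0)\<bar> \<le> real CARD('n) / 2" for j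
  proof -
    have "coord R j z - (if j = idx1 then ?t else 0) = (to_real z - ?c) \<bullet> (R *v basis_vec j)"
      using inner_columns[OF orth, of idx1 j] by (simp add: coord_def inner_diff_left)
    also have "\<bar>\<dots>\<bar> \<le> norm (to_real z - ?c) * norm (R *v basis_vec j)" by (rule Cauchy_Schwarz_ineq2)
    finally show ?thesis using n norm_column[OF orth, of j] by simp
  qed
  have "z \<in> slab R L M' i"
    unfolding slab_def
  proof (intro CollectI conjI allI impI)
    show "of_int i * L \<le> coord R idx1 z" "coord R idx1 z < (of_int i + 1) * L"
    proof -
      have "\<bar>coord R idx1 z - ?t\<bar> \<le> real CARD('n) / 2" using c[of idx1] by (simp only: if_True refl)
      then show "of_int i * L \<le> coord R idx1 z" "coord R idx1 z < (of_int i + 1) * L"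
        using L_gt unfolding abs_le_iff distrib_right by linarith+
    qed
    fix j :: 'n assume "j \<noteq> idx1"
    then show "\<bar>coord R j z\<bar> < M'" using c[of j] assms by simp
  qed
  then show ?thesis by blast
qed

lemma finite_slab: "finite (slab R L M' i)"
proof -
  let ?a = "\<lambda>j. if j = idx1 then of_int i * L else - \<bar>M'\<bar>" and ?b = "\<lambda>j. if j = idx1 then (of_int i + 1) * L else \<bar>M'\<bar>"
  have "slab R L M' i \<subseteq> {z. \<forall>j. ?a j \<le> coord R j z \<and> coord R j z \<le> ?b j}"
  proof
    fix z assume z: "z \<in> slab R L M' i"
    have "?a j \<le> coord R j z \<and> coord R j z \<le> ?b j" for j
      using z by (cases "j = idx1") (auto simp: slab_def dest!: spec[of _ j])
    then show "z \<in> {z. \<forall>j. ?a j \<le> coord R j z \<and> coord R j z \<le> ?b j}" by blast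
  qed
  then show ?thesis
    by (rule finite_subset) (rule lattice_points_rotated_box[OF orth], use L_ge in \<open>auto simp: algebra_simps\<close>)
qed

text \<open>The sum over the slab replaces the supremum of the odds: it still dominates each term, and its
  fractional moments are bounded by sums of moments.\<close>

definition slab_ratio :: "real \<Rightarrow> 'n env \<Rightarrow> int \<Rightarrow> real" where
  "slab_ratio M' \<omega> i = (\<Sum>x\<in>slab R L M' i. ratio R L M (env_shift x \<omega>))"

lemma slab_ratio_pos:
  assumes "env_ok \<kappa> \<omega>" "real CARD('n) < M'" shows "0 < slab_ratio M' \<omega> i"
  unfolding slab_ratio_def
  by (rule sum_pos[OF finite_slab slab_nonempty[OF assms(2)]]) (rule ratio_pos[OF env_ok_shift[OF assms(1)]])

text \<open>Increments of the harmonic function of the one-dimensional walk with odds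
  \<open>2 * slab_ratio\<close>, indexed from the bottom slab upwards; the slab number
  \<open>k + 1 - N\<close> belongs to the factor \<open>k\<close>.  The factor two only serves
  to make the comparison strict.\<close>

definition weight :: "nat \<Rightarrow> real \<Rightarrow> 'n env \<Rightarrow> nat \<Rightarrow> real" where
  "weight N M' \<omega> m = (\<Prod>k<m. 2 * slab_ratio M' \<omega> (int k + 1 - int N))"

lemma weight_pos:
  assumes "env_ok \<kappa> \<omega>" "real CARD('n) < M'" shows "0 < weight N M' \<omega> m"
  unfolding weight_def using slab_ratio_pos[OF assms] by (intro prod_pos) simp

definition bottom :: "nat \<Rightarrow> 'n site set" where
  "bottom N = {z. coord R idx1 z \<le> - (real N * L - 1)}"

lemma floor_div_bounds:
  assumes "L > 0" shows "of_int \<lfloor>t / L\<rfloor> * L \<le> t" "t < (of_int \<lfloor>t / L\<rfloor> + 1) * L"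
  using assms floor_divide_lower[OF assms, of t] floor_divide_upper[OF assms, of t] by auto

text \<open>Let \<open>f\<close> be the decreasing function of the slab with increments
  \<open>weight\<close>.  From slab \<open>n\<close> a successful crossing leads to slab
  \<open>n + 1\<close> or further and a failure to slab \<open>n - 1\<close> or higher, so
  \<open>f\<close> is strictly superharmonic for the walk observed at exits from small boxes, and
  the difference between the exit probability and \<open>f\<close> cannot have a positive maximum.
  Extending the exit probability by zero beyond the sides and the front keeps it subharmonic, which
  is why small boxes may stick out of the large one there.\<close>

lemma bottom_exit_le_weights:
  assumes ok: "env_ok \<kappa> \<omega>" and M': "real CARD('n) < M'" and N: "N > 0" and x: "x \<in> tilt_box R (real N * L) M'"
  shows "hit \<omega> (tilt_box R (real N * L) M') (bottom N) x * (\<Sum>m\<le>2*N. weight N M' \<omega> m)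
    \<le> (\<Sum>m\<in>{nat (\<lfloor>coord R idx1 x / L\<rfloor> + int N)..2*N}. weight N M' \<omega> m)"
proof -
  let ?B = "tilt_box R (real N * L) M'"
  define u where "u = hit \<omega> ?B (bottom N)"
  define wt where "wt = weight N M' \<omega>"
  define f where "f n = (\<Sum>m\<in>{n..2*N}. wt m)" for n
  define ix where "ix z = nat (\<lfloor>coord R idx1 z / L\<rfloor> + int N)" for z
  define c where "c = f 0"
  have L0: "L > 0" using L_ge by simp
  have wt: "wt m > 0" for m unfolding wt_def by (rule weight_pos[OF ok M'])
  have f_anti: "f n \<le> f m" if "m \<le> n" for m n
    unfolding f_def using that by (intro sum_mono2) (auto intro: less_imp_le[OF wt])
  have f_nn: "0 \<le> f n" for n unfolding f_def by (intro sum_nonneg less_imp_le[OF wt])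
  have f_Suc: "f n = wt n + f (Suc n)" if "n \<le> 2 * N" for n
    unfolding f_def by (rule sum.atLeast_Suc_atMost[OF that])
  have c0: "c > 0" using f_Suc[of 0] wt[of 0] f_nn[of 1] by (simp add: c_def)
  have u1: "0 \<le> u z" "u z \<le> 1" for z by (auto simp: u_def hit_nonneg hit_le_1)
  define D where "D z = u z * c - f (ix z)" for z
  have fin: "finite ?B" by (rule finite_tilt_box[OF orth])
  define d where "d = Max (insert 0 (D ` ?B))"
  have d0: "0 \<le> d" and dB: "z \<in> ?B \<Longrightarrow> D z \<le> d" for z
    using fin by (auto simp: d_def)
  have layer: "of_int \<lfloor>coord R idx1 z / L\<rfloor> * L \<le> coord R idx1 z" "coord R idx1 z < (of_int \<lfloor>coord R idx1 z / L\<rfloor> + 1) * L" for z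
    using floor_div_bounds[OF L0] by auto
  have Dall: "D z \<le> d" for z
  proof (cases "z \<in> ?B")
    case True then show ?thesis by (rule dB)
  next
    case False
    show ?thesis
    proof (cases "z \<in> bottom N")
      case True
      then have z: "coord R idx1 z \<le> - (real N * L) + 1" by (simp add: bottom_def)
      have "\<lfloor>coord R idx1 z / L\<rfloor> \<le> - int N"
      proof -
        have "coord R idx1 z < (- real N + 1) * L" using z L_ge by (simp add: algebra_simps)
        then have "coord R idx1 z / L < - real N + 1" using L0 by (simp add: divide_less_eq)
        then show ?thesis by linarith
      qed
      then have "ix z = 0" by (simp add: ix_def)
      then have "D z \<le> 0" using u1[of z] c0 by (simp add: D_def c_def[symmetric])
      then show ?thesis using d0 by simp
    next
      case nb: False
      then have "u z = 0" using False by (simp add: u_def hit_boundary)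
      then show ?thesis using f_nn[of "ix z"] d0 by (simp add: D_def)
    qed
  qed
  \<comment> \<open>The factor two in the weights makes the increment of \<open>f\<close> strictly larger than needed.\<close>
  have strict: "D z < d" if z: "z \<in> ?B" and dpos: "0 < d" for z
  proof (cases "ix z = 0")
    case True
    then have "D z \<le> 0" using u1[of z] c0 by (simp add: D_def c_def[symmetric])
    then show ?thesis using dpos by simp
  next
    case False
    define i where "i = \<lfloor>coord R idx1 z / L\<rfloor>"
    define n where "n = ix z"
    have n: "int n = i + int N" "n \<ge> 1" using False by (auto simp: n_def ix_def i_def)
    have zi: "of_int i * L \<le> coord R idx1 z" "coord R idx1 z < (of_int i + 1) * L"
      using layer[of z] by (auto simp: i_def)
    have "of_int i * L < real N * L + L" using z zi(1) L_ge by (simp add: tilt_box_def)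
    then have "of_int i * L < (real N + 1) * L" by (simp add: algebra_simps)
    then have "i \<le> int N" using L0 by (simp add: mult_less_cancel_right)
    then have n2: "n \<le> 2 * N" using n by linarith
    have zs: "z \<in> slab R L M' i" using zi z by (simp add: slab_def tilt_box_def)
    let ?p = "pf (env_shift z \<omega>)"
    have ok': "env_ok \<kappa> (env_shift z \<omega>)" by (rule env_ok_shift[OF ok])
    have p: "0 < ?p" "?p < 1" using pf_bounds[OF ok'] by auto
    have iN: "of_int i \<ge> - real N + 1" using n by linarith
    have lb: "- (real N * L) + L \<le> coord R idx1 z"
      using zi(1) mult_right_mono[OF iN, of L] L0 by (simp add: algebra_simps)
    have ix_ge: "int k \<le> \<lfloor>coord R idx1 y / L\<rfloor> + int N \<Longrightarrow> f (ix y) \<le> f k" for k y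
      by (intro f_anti) (simp add: ix_def)
    have "u z * c \<le> (d + f (n + 1)) * ?p + (d + f (n - 1)) * (1 - ?p)"
    proof (rule walk_comparison[OF ok, of z "\<lambda>z. u z * c"])
      fix y assume "coord R idx1 z - (L - 1) < coord R idx1 y"
      then have "y \<notin> bottom N" using lb by (simp add: bottom_def)
      have "u y \<le> mean_step \<omega> u y"
      proof (cases "y \<in> ?B")
        case True
        then show ?thesis unfolding u_def using hit_harmonic[OF ok kappa_pos] by simp
      next
        case False
        then have "u y = 0" using \<open>y \<notin> bottom N\<close> by (simp add: u_def hit_boundary)
        also have "\<dots> \<le> mean_step \<omega> u y"
          unfolding mean_step_def by (intro sum_nonneg mult_nonneg_nonneg u1 less_imp_le[OF env_pos[OF ok kappa_pos]])
        finally show ?thesis .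
      qed
      then show "u y * c \<le> mean_step \<omega> (\<lambda>z. u z * c) y"
        using c0 by (simp add: mean_step_cmult mult.commute[of _ c])
    next
      fix y assume y: "coord R idx1 z + L + 1 \<le> coord R idx1 y"
      have "(of_int i + 1) * L \<le> coord R idx1 y" using y zi(1) by (simp add: algebra_simps)
      then have "of_int i + 1 \<le> coord R idx1 y / L" using L0 by (simp add: le_divide_eq)
      then have "i + 1 \<le> \<lfloor>coord R idx1 y / L\<rfloor>" by linarith
      then have "f (ix y) \<le> f (n + 1)" using n by (intro ix_ge) simp
      then show "u y * c \<le> d + f (n + 1)" using Dall[of y] by (simp add: D_def)
    next
      fix y assume y: "coord R idx1 z - L \<le> coord R idx1 y"
      have "(of_int i - 1) * L \<le> coord R idx1 y" using y zi(1) by (simp add: algebra_simps)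
      then have "of_int i - 1 \<le> coord R idx1 y / L" using L0 by (simp add: le_divide_eq)
      then have "i - 1 \<le> \<lfloor>coord R idx1 y / L\<rfloor>" by linarith
      then have "f (ix y) \<le> f (n - 1)" using n by (intro ix_ge) simp
      then show "u y * c \<le> d + f (n - 1)" using Dall[of y] by (simp add: D_def)
    qed
    also have "\<dots> = d + f n - (wt n * ?p - wt (n - 1) * (1 - ?p))"
      using f_Suc[of n] f_Suc[of "n - 1"] n n2 by (simp add: algebra_simps)
    finally have 1: "D z \<le> d - (wt n * ?p - wt (n - 1) * (1 - ?p))" by (simp add: D_def n_def)
    have "wt n = wt (n - 1) * (2 * slab_ratio M' \<omega> i)"
    proof -
      obtain k where k: "n = Suc k" using n(2) by (cases n) auto
      then have "int k + 1 - int N = i" using n(1) by simp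
      then show ?thesis by (simp add: k wt_def weight_def)
    qed
    moreover have "(1 - ?p) / ?p \<le> slab_ratio M' \<omega> i"
      unfolding slab_ratio_def ratio_def[symmetric]
      by (rule member_le_sum[OF zs]) (auto simp: finite_slab intro!: less_imp_le[OF ratio_pos] env_ok_shift[OF ok])
    ultimately have "wt (n - 1) * (2 * ((1 - ?p) / ?p)) \<le> wt n"
      using less_imp_le[OF wt[of "n - 1"]] by (simp only:) (intro mult_left_mono, auto)
    then have "wt (n - 1) * (2 * ((1 - ?p) / ?p)) * ?p \<le> wt n * ?p" using p by (intro mult_right_mono) auto
    then have "wt (n - 1) * (2 * (1 - ?p)) \<le> wt n * ?p" using p by simp
    moreover have "0 < wt (n - 1) * (1 - ?p)" using wt[of "n - 1"] p by simp
    ultimately have "0 < wt n * ?p - wt (n - 1) * (1 - ?p)" by (simp add: algebra_simps)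
    with 1 show ?thesis by simp
  qed
  have "d = 0"
  proof (rule ccontr)
    assume "d \<noteq> 0"
    then have "0 < d" using d0 by simp
    have "d \<in> insert 0 (D ` ?B)" unfolding d_def using fin by (intro Max_in) auto
    then obtain z where "z \<in> ?B" "D z = d" using \<open>d \<noteq> 0\<close> by auto
    with strict[OF _ \<open>0 < d\<close>, of z] show False by simp
  qed
  then have "D x \<le> 0" using dB[OF x] by simp
  then show ?thesis
    by (simp add: D_def u_def c_def f_def ix_def wt_def atMost_atLeast0)
qed

text \<open>The increments below the starting slab contribute at least \<open>weight 0 = 1\<close> to the total, which
  turns the bound for the probability into a bound for the odds.\<close>

lemma bottom_exit_odds:
  assumes ok: "env_ok \<kappa> \<omega>" and M': "real CARD('n) < M'" and N: "N > 0"
  defines "u \<equiv> hit \<omega> (tilt_box R (real N * L) M') (bottom N) 0"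
  shows "u \<le> (\<Sum>m\<in>{N..2*N}. weight N M' \<omega> m) * (1 - u)"
proof -
  let ?S = "\<Sum>m\<in>{N..2*N}. weight N M' \<omega> m"
  have w: "0 < weight N M' \<omega> m" for m by (rule weight_pos[OF ok M'])
  have "L * 1 \<le> L * real N" using N L_ge by (intro mult_left_mono) auto
  then have "1 < real N * L" using L_ge unfolding mult.commute[of L] by linarith
  moreover have "0 < M'" using M' by (rule le_less_trans[OF of_nat_0_le_iff])
  ultimately have "0 \<in> tilt_box R (real N * L) M'" by (simp add: tilt_box_def)
  from bottom_exit_le_weights[OF ok M' N this]
  have 1: "u * (\<Sum>m\<le>2*N. weight N M' \<omega> m) \<le> ?S" by (simp add: u_def)
  have "1 + ?S \<le> (\<Sum>m\<in>{0} \<union> {N..2*N}. weight N M' \<omega> m)"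
    using N by (subst sum.union_disjoint) (auto simp: weight_def)
  also have "\<dots> \<le> (\<Sum>m\<le>2*N. weight N M' \<omega> m)"
    by (rule sum_mono2) (auto intro: less_imp_le[OF w])
  finally have "u * (1 + ?S) \<le> u * (\<Sum>m\<le>2*N. weight N M' \<omega> m)"
    by (intro mult_left_mono) (auto simp: u_def hit_nonneg)
  with 1 have "u * (1 + ?S) \<le> ?S" by simp
  then show ?thesis by (simp add: algebra_simps)
qed


text \<open>A walk that starts on the centre line of a strip and makes only successful crossings is out of the
  large box, through its front, after at most \<open>2 * N + 1\<close> of them, before it can traverse half of the
  strip.  So the strip is crossed only if one of these crossings fails, and the failure
  probabilities are at most \<open>Q\<close>.  The induction runs over the number of slabs left above
  the current position.\<close>

lemma lateral_strip:
  assumes ok: "env_ok \<kappa> \<omega>" and j: "j \<noteq> idx1" and sg: "sg = 1 \<or> sg = (-1::real)" and N: "N > 0"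
    and U: "0 \<le> U" "\<And>z. sg * coord R j z \<le> b' \<Longrightarrow> hit \<omega> (tilt_box R (real N * L) M') {z. M' \<le> sg * coord R j z} z \<le> U"
    and bb: "b + (2 * real N + 2) * (M + 1) \<le> b'" "b' \<le> M'"
    and Q: "\<And>x. x \<in> tilt_box R (real N * L) M' \<Longrightarrow> \<bar>sg * coord R j x - b\<bar> \<le> (2 * real N + 2) * (M + 1) \<Longrightarrow>
       1 - pf (env_shift x \<omega>) \<le> Q" "0 \<le> Q"
    and z: "sg * coord R j z \<le> b"
  shows "hit \<omega> (tilt_box R (real N * L) M') {z. M' \<le> sg * coord R j z} z \<le> (2 * real N + 1) * Q * U"
proof -
  let ?B = "tilt_box R (real N * L) M'" and ?F = "{z. M' \<le> sg * coord R j z}"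
  define v where "v z = sg * coord R j z" for z
  define u where "u = hit \<omega> ?B ?F"
  define X where "X = coord R idx1"
  have L0: "L > 0" and M0: "M > 0" using L_ge L_le_M by auto
  have v_diff: "\<bar>v y - v x\<bar> = \<bar>coord R j y - coord R j x\<bar>" for x y
    using sg by (auto simp: v_def)
  have sub: "u y \<le> mean_step \<omega> u y" if "v y < M'" for y
  proof (cases "y \<in> ?B")
    case True
    then show ?thesis unfolding u_def using hit_harmonic[OF ok kappa_pos] by simp
  next
    case False
    then have "u y = 0" using that by (simp add: u_def v_def hit_boundary)
    also have "\<dots> \<le> mean_step \<omega> u y"
      unfolding mean_step_def u_def
      by (intro sum_nonneg mult_nonneg_nonneg hit_nonneg less_imp_le[OF env_pos[OF ok kappa_pos]])
    finally show ?thesis .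
  qed
  have out: "u y = 0" if "y \<notin> ?B" "v y < M'" for y
    using that by (simp add: u_def v_def hit_boundary)
  have M_pos: "0 < (2 * real N + 2) * (M + 1)" using M0 by simp
  have main: "u x \<le> real (n + 1) * Q * U"
    if "x \<in> ?B" "n \<le> 2 * N" "(real N - real n) * L \<le> X x" "\<bar>v x - b\<bar> \<le> (2 * real N + 1 - real n) * (M + 1)" for x n
    using that
  proof (induction n arbitrary: x rule: less_induct)
    case (less n)
    let ?p = "pf (env_shift x \<omega>)"
    have p: "0 < ?p" "?p < 1" using pf_bounds[OF env_ok_shift[OF ok]] by auto
    have e1: "(2 * real N + 2) * (M + 1) = (2 * real N + 1 - real n) * (M + 1) + real n * (M + 1) + (M + 1)"
      by (simp add: algebra_simps)
    have nM: "0 \<le> real n * (M + 1)" using M0 by simp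
    have reach: "v y \<le> b'" if "\<bar>v y - v x\<bar> \<le> M + 1" for y
      using that less.prems(4) bb(1) e1 nM by linarith
    have reach': "v y < M'" if "\<bar>v y - v x\<bar> < M" for y
      using that less.prems(4) bb e1 nM by linarith
    have "u x \<le> (real n * Q * U) * ?p + U * (1 - ?p)"
    proof (rule walk_comparison[OF ok])
      fix y assume "\<And>k. k \<noteq> idx1 \<Longrightarrow> \<bar>coord R k y - coord R k x\<bar> < M"
      from this[OF j] show "u y \<le> mean_step \<omega> u y"
        unfolding v_diff[symmetric] by (intro sub reach')
    next
      fix y assume y: "coord R idx1 x + L + 1 \<le> coord R idx1 y" "\<And>k. k \<noteq> idx1 \<Longrightarrow> \<bar>coord R k y - coord R k x\<bar> < M"
      have vy: "\<bar>v y - v x\<bar> < M" using y(2)[OF j] unfolding v_diff .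
      show "u y \<le> real n * Q * U"
      proof (cases "y \<in> ?B")
        case False
        then have "u y = 0" using reach'[OF vy] by (rule out)
        then show ?thesis using Q(2) U(1) by simp
      next
        case True
        have "real N * L - real n * L + L + 1 \<le> X y" using less.prems(3) y(1) unfolding X_def left_diff_distrib by linarith
        moreover have "X y < real N * L + 1" using True by (simp add: tilt_box_def X_def)
        ultimately have "L * 1 < L * real n" unfolding mult.commute[of L] by linarith
        then have n1: "n \<ge> 1" using L0 by simp
        have Xy: "(real N - real (n - 1)) * L \<le> X y"
          using less.prems(3) y(1) n1 by (simp add: X_def of_nat_diff algebra_simps)
        have "(2 * real N + 1 - real (n - 1)) * (M + 1) = (2 * real N + 1 - real n) * (M + 1) + (M + 1)"
          using n1 by (simp add: of_nat_diff algebra_simps)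
        then have vb: "\<bar>v y - b\<bar> \<le> (2 * real N + 1 - real (n - 1)) * (M + 1)"
          using less.prems(4) vy by linarith
        have "u y \<le> real (n - 1 + 1) * Q * U"
          using n1 less.prems(2) by (intro less.IH True Xy vb) auto
        then show ?thesis using n1 by simp
      qed
    next
      fix y assume "\<And>k. k \<noteq> idx1 \<Longrightarrow> \<bar>coord R k y - coord R k x\<bar> \<le> M + 1"
      from this[OF j] have "v y \<le> b'" unfolding v_diff[symmetric] by (rule reach)
      then show "u y \<le> U" unfolding u_def v_def by (rule U(2))
    qed
    also have "\<dots> \<le> (real n * Q * U) * 1 + U * Q"
    proof (intro add_mono mult_left_mono U(1))
      have "\<bar>v x - b\<bar> \<le> (2 * real N + 2) * (M + 1)" using less.prems(4) e1 nM M0 by linarith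
      then show "1 - ?p \<le> Q" using less.prems(1) unfolding v_def by (intro Q(1))
    qed (use p Q U in auto)
    finally show ?case by (simp add: algebra_simps)
  qed
  have c0: "0 \<le> (2 * real N + 1) * Q * U" using Q(2) U(1) by simp
  have start: "u x \<le> (2 * real N + 1) * Q * U" if x: "x \<in> ?B" "\<bar>v x - b\<bar> \<le> M + 1" for x
  proof -
    have "(real N - real (2 * N)) * L \<le> X x" using x(1) by (simp add: tilt_box_def X_def algebra_simps)
    from main[OF x(1) order_refl this] x(2) show ?thesis by (simp add: add.commute)
  qed
  have bM: "b + (M + 1) \<le> M'"
  proof -
    have "b + 1 * (M + 1) \<le> b + (2 * real N + 2) * (M + 1)"
      using M0 by (intro add_left_mono mult_right_mono) auto
    also have "\<dots> \<le> b'" by (rule bb)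
    also have "\<dots> \<le> M'" by (rule bb)
    finally show ?thesis by simp
  qed
  show ?thesis
  proof (cases "z \<in> ?B")
    case False
    then have "u z = 0" using z bM M0 by (intro out) (auto simp: v_def)
    then show ?thesis using c0 by (simp add: u_def)
  next
    case True
    let ?V = "{y \<in> ?B. v y \<le> b}"
    have "u z \<le> (2 * real N + 1) * Q * U"
    proof (rule comparison_principle[OF ok kappa_pos, of ?V])
      show "finite ?V" using finite_tilt_box[OF orth, of "real N * L" M'] by simp
      show "z \<in> ?V" using True z by (simp add: v_def)
      show "u y \<le> mean_step \<omega> u y" if "y \<in> ?V" for y using that bM M0 by (intro sub) auto
      show "mean_step \<omega> (\<lambda>_. (2 * real N + 1) * Q * U) y \<le> (2 * real N + 1) * Q * U" for y
        by (simp add: mean_step_const[OF ok])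
      fix y e assume y: "y \<in> ?V" "e \<in> nn_steps" "y + e \<notin> ?V"
      have "\<bar>coord R j e\<bar> \<le> 1" using abs_coord_step[OF orth y(2)] .
      then have ve: "v (y + e) \<le> v y + 1" using sg by (auto simp: v_def algebra_simps)
      show "u (y + e) \<le> (2 * real N + 1) * Q * U"
      proof (cases "y + e \<in> ?B")
        case False
        have "v (y + e) < M'" using ve y(1) bM M0 by auto
        then have "u (y + e) = 0" using False by (intro out)
        then show ?thesis using c0 by simp
      next
        case True
        then have "b < v (y + e)" using y(3) by auto
        then show ?thesis using ve y(1) M0 True by (intro start) auto
      qed
    qed
    then show ?thesis by (simp add: u_def)
  qed
qed

definition strip :: "nat \<Rightarrow> real \<Rightarrow> 'n \<Rightarrow> real \<Rightarrow> real \<Rightarrow> 'n site set" where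
  "strip N M' j sg b = {x \<in> tilt_box R (real N * L) M'. \<bar>sg * coord R j x - b\<bar> \<le> (2 * real N + 2) * (M + 1)}"

text \<open>The centre lines of the strips are \<open>(4 * N + 8) * (M + 1)\<close> apart, which leaves a gap
  larger than \<open>L\<close> between the boxes attached to neighbouring strips.\<close>

definition strip_fail :: "nat \<Rightarrow> real \<Rightarrow> 'n \<Rightarrow> real \<Rightarrow> 'n env \<Rightarrow> nat \<Rightarrow> real" where
  "strip_fail N M' j sg \<omega> m =
     (\<Sum>x\<in>strip N M' j sg (real m * ((4 * real N + 8) * (M + 1))). 1 - pf (env_shift x \<omega>))"

lemma finite_strip: "finite (strip N M' j sg b)"
  unfolding strip_def using finite_tilt_box[OF orth] by simp

lemma strip_fail_nonneg: "env_ok \<kappa> \<omega> \<Longrightarrow> 0 \<le> strip_fail N M' j sg \<omega> m"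
  unfolding strip_fail_def by (intro sum_nonneg) (auto simp: less_imp_le[OF pf_bounds(2)[OF env_ok_shift]])

text \<open>Iteration of \<open>lateral_strip\<close> over the \<open>K\<close> strips between the axis and the
  side of the box.\<close>

lemma lateral_exit_le:
  assumes ok: "env_ok \<kappa> \<omega>" and j: "j \<noteq> idx1" and sg: "sg = 1 \<or> sg = (-1::real)" and N: "N > 0"
    and K: "real K * ((4 * real N + 8) * (M + 1)) \<le> M'"
  shows "hit \<omega> (tilt_box R (real N * L) M') {z. M' \<le> sg * coord R j z} 0
    \<le> (\<Prod>m<K. (2 * real N + 1) * strip_fail N M' j sg \<omega> m)"
proof -
  let ?W = "(4 * real N + 8) * (M + 1)"
  let ?u = "hit \<omega> (tilt_box R (real N * L) M') {z. M' \<le> sg * coord R j z}"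
  let ?\<Phi> = "\<lambda>m. (2 * real N + 1) * strip_fail N M' j sg \<omega> m"
  have M0: "M > 0" using L_ge L_le_M by auto
  have main: "?u z \<le> (\<Prod>m\<in>{K - n..<K}. ?\<Phi> m)"
    if "n \<le> K" "sg * coord R j z \<le> real (K - n) * ?W" for n z
    using that
  proof (induction n arbitrary: z)
    case 0
    then show ?case by (simp add: hit_le_1)
  next
    case (Suc n)
    define m where "m = K - Suc n"
    have m: "K - n = Suc m" "m < K" using Suc.prems(1) by (auto simp: m_def)
    have split: "{m..<K} = insert m {Suc m..<K}" using m by auto
    have "?u z \<le> (2 * real N + 1) * strip_fail N M' j sg \<omega> m * (\<Prod>m\<in>{Suc m..<K}. ?\<Phi> m)"
    proof (rule lateral_strip[OF ok j sg N, where b = "real m * ?W" and b' = "real (Suc m) * ?W"])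
      show "0 \<le> (\<Prod>m\<in>{Suc m..<K}. ?\<Phi> m)"
        by (intro prod_nonneg ballI mult_nonneg_nonneg strip_fail_nonneg[OF ok]) auto
      show "?u y \<le> (\<Prod>m\<in>{Suc m..<K}. ?\<Phi> m)" if "sg * coord R j y \<le> real (Suc m) * ?W" for y
        using Suc.IH[of y] Suc.prems(1) that by (simp only: m(1))
      have "(2 * real N + 2) * (M + 1) \<le> ?W" using M0 by (intro mult_right_mono) auto
      then show "real m * ?W + (2 * real N + 2) * (M + 1) \<le> real (Suc m) * ?W" by (simp add: distrib_right)
      have "real (Suc m) * ?W \<le> real K * ?W" using m M0 by (intro mult_right_mono) auto
      then show "real (Suc m) * ?W \<le> M'" using K by linarith
      show "1 - pf (env_shift x \<omega>) \<le> strip_fail N M' j sg \<omega> m"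
        if "x \<in> tilt_box R (real N * L) M'" "\<bar>sg * coord R j x - real m * ?W\<bar> \<le> (2 * real N + 2) * (M + 1)" for x
        unfolding strip_fail_def
        by (rule member_le_sum) (use that in \<open>auto simp: strip_def finite_tilt_box[OF orth] less_imp_le[OF pf_bounds(2)[OF env_ok_shift[OF ok]]]\<close>)
      show "0 \<le> strip_fail N M' j sg \<omega> m" by (rule strip_fail_nonneg[OF ok])
      show "sg * coord R j z \<le> real m * ?W" using Suc.prems(2) by (simp add: m_def)
    qed
    then show ?case unfolding m_def[symmetric] split by simp
  qed
  have "?u 0 \<le> (\<Prod>m\<in>{K - K..<K}. ?\<Phi> m)" by (rule main) auto
  then show ?thesis by (simp add: atLeast0LessThan)
qed

definition lateral_exit :: "nat \<Rightarrow> real \<Rightarrow> 'n env \<Rightarrow> real" where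
  "lateral_exit N M' \<omega> = (\<Sum>(j, sg)\<in>(UNIV - {idx1}) \<times> {1, -1}. hit \<omega> (tilt_box R (real N * L) M') {z. M' \<le> sg * coord R j z} 0)"

text \<open>If the lateral exit probability is at most half of the probability \<open>1 - u\<close> of avoiding the bottom, the
  odds are at most twice those of the bottom exit plus a lateral term; otherwise the crude bound
  \<open>1 / pm\<close> is absorbed by the lateral term.\<close>

theorem ratio_bound:
  assumes ok: "env_ok \<kappa> \<omega>" and M': "real CARD('n) < M'" and N: "N > 0"
    and pm: "0 < pm" "pm \<le> pfront R (real N * L) M' \<omega>"
  shows "ratio R (real N * L) M' \<omega> \<le> 2 * (\<Sum>m\<in>{N..2*N}. weight N M' \<omega> m) + 2 * lateral_exit N M' \<omega> / pm\<^sup>2"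
proof -
  let ?B = "tilt_box R (real N * L) M'" and ?F = "tilt_front R (real N * L) M'"
  let ?I = "(UNIV - {idx1 :: 'n}) \<times> {1, -1 :: real}"
  let ?lat = "\<lambda>(j, sg). {z. M' \<le> sg * coord R j z}"
  let ?S = "\<Sum>m\<in>{N..2*N}. weight N M' \<omega> m"
  let ?ub = "hit \<omega> ?B (bottom N) 0" and ?ul = "lateral_exit N M' \<omega>"
  let ?p = "pfront R (real N * L) M' \<omega>"
  have "L * 1 \<le> L * real N" using N L_ge by (intro mult_left_mono) auto
  then have NL: "1 < real N * L" using L_ge unfolding mult.commute[of L] by linarith
  have M'0: "0 < M'" using M' by (rule le_less_trans[OF of_nat_0_le_iff])
  have z0: "0 \<in> ?B" using NL M'0 by (simp add: tilt_box_def)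
  have fin: "finite ?B" by (rule finite_tilt_box[OF orth])
  have "?p \<le> 1" by (simp add: pfront_def hit_le_1)
  then have pm1: "pm \<le> 1" using pm by linarith
  have cover: "1 - ?p \<le> ?ub + ?ul"
  proof -
    have "1 - hit \<omega> ?B ?F 0 \<le> hit \<omega> ?B (bottom N) 0 + (\<Sum>i\<in>?I. hit \<omega> ?B (?lat i) 0)"
    proof (rule comparison_principle[OF ok kappa_pos fin _ _ _ z0,
        of "\<lambda>x. 1 - hit \<omega> ?B ?F x" "\<lambda>x. hit \<omega> ?B (bottom N) x + (\<Sum>i\<in>?I. hit \<omega> ?B (?lat i) x)"])
      fix x assume x: "x \<in> ?B"
      show "1 - hit \<omega> ?B ?F x \<le> mean_step \<omega> (\<lambda>x. 1 - hit \<omega> ?B ?F x) x"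
        using hit_harmonic[OF ok kappa_pos x, of ?F] by (simp add: mean_step_diff mean_step_const[OF ok])
      have "mean_step \<omega> (\<lambda>x. \<Sum>i\<in>?I. hit \<omega> ?B (?lat i) x) x = (\<Sum>i\<in>?I. hit \<omega> ?B (?lat i) x)"
        unfolding mean_step_sum by (rule sum.cong[OF refl]) (rule hit_harmonic[OF ok kappa_pos x, symmetric])
      then show "mean_step \<omega> (\<lambda>x. hit \<omega> ?B (bottom N) x + (\<Sum>i\<in>?I. hit \<omega> ?B (?lat i) x)) x
          \<le> hit \<omega> ?B (bottom N) x + (\<Sum>i\<in>?I. hit \<omega> ?B (?lat i) x)"
        using hit_harmonic[OF ok kappa_pos x, of "bottom N"] by (simp add: mean_step_add)
    next
      fix x e assume "x + e \<notin> ?B"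
      then show "1 - hit \<omega> ?B ?F (x + e) \<le> hit \<omega> ?B (bottom N) (x + e) + (\<Sum>i\<in>?I. hit \<omega> ?B (?lat i) (x + e))"
      proof -
        define z where "z = x + e"
        have z: "z \<notin> ?B" using \<open>x + e \<notin> ?B\<close> by (simp add: z_def)
        have nn: "0 \<le> (\<Sum>i\<in>?I. hit \<omega> ?B (?lat i) z)" by (intro sum_nonneg hit_nonneg)
        have "1 - hit \<omega> ?B ?F z \<le> hit \<omega> ?B (bottom N) z + (\<Sum>i\<in>?I. hit \<omega> ?B (?lat i) z)"
        proof (cases "\<forall>j. j \<noteq> idx1 \<longrightarrow> \<bar>coord R j z\<bar> < M'")
          case True
          then have "z \<in> ?F \<or> z \<in> bottom N"
            using z by (auto simp: tilt_box_def tilt_front_def bottom_def)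
          then show ?thesis
          proof
            assume "z \<in> ?F"
            then have "hit \<omega> ?B ?F z = 1" using z by (simp add: hit_boundary)
            then show ?thesis using nn hit_nonneg[of \<omega> ?B "bottom N" z] by simp
          next
            assume "z \<in> bottom N"
            then have "hit \<omega> ?B (bottom N) z = 1" using z by (simp add: hit_boundary)
            then show ?thesis using nn hit_nonneg[of \<omega> ?B ?F z] by simp
          qed
        next
          case False
          then obtain j where j: "j \<noteq> idx1" "M' \<le> \<bar>coord R j z\<bar>" by (auto simp: not_less)
          define sg :: real where "sg = (if 0 \<le> coord R j z then 1 else -1)"
          have sg: "M' \<le> sg * coord R j z" using j(2) by (auto simp: sg_def split: if_splits)
          have "(j, sg) \<in> ?I" using j(1) by (auto simp: sg_def)
          then have "hit \<omega> ?B (?lat (j, sg)) z \<le> (\<Sum>i\<in>?I. hit \<omega> ?B (?lat i) z)"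
            by (rule member_le_sum) (auto simp: hit_nonneg)
          moreover have "hit \<omega> ?B (?lat (j, sg)) z = 1" using z sg by (simp add: hit_boundary)
          ultimately show ?thesis using hit_nonneg[of \<omega> ?B "bottom N" z] hit_nonneg[of \<omega> ?B ?F z] by simp
        qed
        then show ?thesis by (simp only: z_def)
      qed
    qed
    also have "(\<Sum>i\<in>?I. hit \<omega> ?B (?lat i) 0) = ?ul"
      unfolding lateral_exit_def by (rule sum.cong) auto
    finally show ?thesis by (simp add: pfront_def)
  qed
  have disj: "?p \<le> 1 - ?ub"
    unfolding pfront_def
  proof (rule comparison_principle[OF ok kappa_pos fin _ _ _ z0, of "hit \<omega> ?B ?F" "\<lambda>x. 1 - hit \<omega> ?B (bottom N) x"])
    fix x assume x: "x \<in> ?B"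
    show "hit \<omega> ?B ?F x \<le> mean_step \<omega> (hit \<omega> ?B ?F) x"
      using hit_harmonic[OF ok kappa_pos x, of ?F] by simp
    show "mean_step \<omega> (\<lambda>x. 1 - hit \<omega> ?B (bottom N) x) x \<le> 1 - hit \<omega> ?B (bottom N) x"
      using hit_harmonic[OF ok kappa_pos x, of "bottom N"] by (simp add: mean_step_diff mean_step_const[OF ok])
  next
    fix x e assume "x + e \<notin> ?B"
    then show "hit \<omega> ?B ?F (x + e) \<le> 1 - hit \<omega> ?B (bottom N) (x + e)"
      using NL by (auto simp: hit_boundary tilt_front_def bottom_def)
  qed
  have S0: "0 \<le> ?S" by (intro sum_nonneg less_imp_le[OF weight_pos[OF ok M']])
  have ub: "?ub \<le> ?S * (1 - ?ub)" by (rule bottom_exit_odds[OF ok M' N])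
  have ul0: "0 \<le> ?ul" unfolding lateral_exit_def by (intro sum_nonneg) (auto simp: hit_nonneg)
  have pm2: "pm\<^sup>2 \<le> pm" using pm(1) pm1 by (simp add: power2_eq_square mult_left_le)
  show ?thesis
  proof (cases "?ul \<le> (1 - ?ub) / 2")
    case True
    have g: "0 < 1 - ?ub" using disj pm by linarith
    have "(1 - b) / 2 \<le> p" if "1 - p \<le> b + u" "u \<le> (1 - b) / 2" for p b u :: real
      using that by (simp add: field_simps)
    from this[OF cover True] have p2: "(1 - ?ub) / 2 \<le> ?p" .
    have "ratio R (real N * L) M' \<omega> \<le> (?ub + ?ul) / ((1 - ?ub) / 2)"
      unfolding ratio_def using cover p2 g pm ul0 hit_nonneg[of \<omega> ?B "bottom N" 0]
      by (intro frac_le) auto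
    also have "\<dots> = 2 * (?ub / (1 - ?ub)) + 2 * ?ul / (1 - ?ub)"
      by (simp add: add_divide_distrib mult.commute[of _ 2])
    also have "\<dots> \<le> 2 * ?S + 2 * ?ul / pm\<^sup>2"
    proof (rule add_mono)
      show "2 * (?ub / (1 - ?ub)) \<le> 2 * ?S" using ub g by (simp add: divide_le_eq)
      show "2 * ?ul / (1 - ?ub) \<le> 2 * ?ul / pm\<^sup>2"
        using disj pm pm2 ul0 g by (intro divide_left_mono) auto
    qed
    finally show ?thesis .
  next
    case False
    have "q / 2 \<le> u" if "\<not> u \<le> (1 - b) / 2" "p \<le> 1 - b" "q \<le> p" for p b u q :: real
      using that by (simp add: field_simps)
    from this[OF False disj pm(2)] have ul: "pm / 2 \<le> ?ul" .
    have "ratio R (real N * L) M' \<omega> \<le> 1 / pm"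
      unfolding ratio_def pfront_def using pm hit_nonneg[of \<omega> ?B ?F 0] by (intro frac_le) (auto simp: pfront_def)
    also have "\<dots> = 2 * (pm / 2) / pm\<^sup>2" using pm(1) by (simp add: power2_eq_square)
    also have "\<dots> \<le> 2 * ?ul / pm\<^sup>2" using ul by (intro divide_right_mono mult_left_mono) auto
    finally show ?thesis using S0 by simp
  qed
qed

end

section \<open>Crossing a large box: fractional moments\<close>

lemma powr_add_le:
  fixes x y a :: real
  assumes "0 \<le> x" "0 \<le> y" "0 < a" "a \<le> 1"
  shows "(x + y) powr a \<le> x powr a + y powr a"
proof (cases "x + y = 0")
  case True
  then show ?thesis using assms by simp
next
  case False
  define s where "s = x + y"
  have s: "s > 0" using False assms by (simp add: s_def)
  have part: "s powr a * (t / s) \<le> t powr a" if "0 \<le> t" "t \<le> s" for t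
  proof -
    have "t / s \<le> (t / s) powr a"
    proof (cases "t = 0")
      case False
      then show ?thesis using that s assms powr_mono'[of a 1 "t / s"] by simp
    qed simp
    then have "s powr a * (t / s) \<le> s powr a * (t / s) powr a" by (intro mult_left_mono) auto
    also have "\<dots> = t powr a" using that s by (simp add: powr_mult[symmetric])
    finally show ?thesis .
  qed
  have "s powr a = s powr a * (x / s) + s powr a * (y / s)"
    using s by (simp add: distrib_left[symmetric] add_divide_distrib[symmetric] s_def)
  also have "\<dots> \<le> x powr a + y powr a"
    using assms by (intro add_mono part) (auto simp: s_def)
  finally show ?thesis by (simp add: s_def)
qed

lemma powr_sum_le:
  fixes f :: "'i \<Rightarrow> real"
  assumes "finite I" "\<And>i. i \<in> I \<Longrightarrow> 0 \<le> f i" "0 < a" "a \<le> 1"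
  shows "(\<Sum>i\<in>I. f i) powr a \<le> (\<Sum>i\<in>I. f i powr a)"
  using assms(1,2)
proof (induction I rule: finite_induct)
  case (insert i I)
  have "(\<Sum>j\<in>insert i I. f j) powr a \<le> f i powr a + (\<Sum>j\<in>I. f j) powr a"
    using insert assms(3,4) by (simp add: powr_add_le sum_nonneg)
  then show ?case using insert by force
qed (use assms in simp)

lemma fourth_root_power: "0 \<le> s \<Longrightarrow> (s ^ 4) powr (1 / 4) = (s :: real)"
proof (cases "s = 0")
  case False
  assume "0 \<le> s"
  with False have s: "0 < s" by simp
  then have "(s ^ 4) powr (1 / 4) = (s powr 4) powr (1 / 4)" by (subst powr_numeral) auto
  also have "\<dots> = s powr 1" by (subst powr_powr) simp
  finally show ?thesis using s by simp
qed simp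

text \<open>A geometric mean is at most the maximum, hence at most the sum.  This replaces Hoelder's inequality
  for the four residue classes.\<close>

lemma prod_four_roots_le:
  fixes Y :: "nat \<Rightarrow> real"
  assumes "\<And>r. 0 \<le> Y r"
  shows "(\<Prod>r<4. Y r) powr (1 / 4) \<le> (\<Sum>r<4. Y r)"
proof -
  define S where "S = (\<Sum>r<4. Y r)"
  have S: "0 \<le> S" unfolding S_def by (intro sum_nonneg assms)
  have le: "Y r \<le> S" if "r < 4" for r
    unfolding S_def by (rule member_le_sum) (use that assms in auto)
  have "(\<Prod>r<4. Y r) \<le> (\<Prod>r<(4::nat). S)"
    by (rule prod_mono) (use assms le in auto)
  also have "\<dots> = S ^ 4" by (simp only: prod_constant card_lessThan)
  finally have "(\<Prod>r<4. Y r) powr (1 / 4) \<le> (S ^ 4) powr (1 / 4)"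
    by (intro powr_mono2 prod_nonneg) (auto simp: assms)
  also have "\<dots> = S" by (rule fourth_root_power[OF S])
  finally show ?thesis unfolding S_def .
qed

text \<open>A linearized form of Jensen's inequality for the fourth root, with \<open>\<delta>\<close> to be
  chosen as the fourth root of the expectation.\<close>

lemma fourth_root_le:
  fixes z \<delta> :: real
  assumes "0 \<le> z" "0 < \<delta>" shows "z powr (1 / 4) \<le> \<delta> + z / \<delta> ^ 3"
proof (cases "z \<le> \<delta> ^ 4")
  case True
  then have "z powr (1 / 4) \<le> (\<delta> ^ 4) powr (1 / 4)" using assms by (intro powr_mono2) auto
  also have "\<dots> = \<delta>" using assms by (intro fourth_root_power) simp
  finally show ?thesis using assms by (simp add: add_increasing2)
next
  case False
  define y where "y = z powr (1 / 4)"
  have y0: "0 \<le> y" by (simp add: y_def)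
  have "\<delta> < y"
  proof -
    have "(\<delta> ^ 4) powr (1 / 4) < z powr (1 / 4)" using False assms by (intro powr_less_mono2) auto
    then show ?thesis using fourth_root_power[of \<delta>] assms by (simp add: y_def)
  qed
  have y4: "y ^ 4 = z"
  proof -
    have "0 < z" using False zero_less_power[OF assms(2), of 4] by linarith
    then have "(z powr (1 / 4)) ^ 4 = z powr (1 / 4 * 4)" by (simp add: powr_power)
    then show ?thesis using \<open>0 < z\<close> by (simp add: y_def)
  qed
  have "\<delta> ^ 3 \<le> y ^ 3" using \<open>\<delta> < y\<close> assms by (intro power_mono) auto
  then have "y * \<delta> ^ 3 \<le> y * y ^ 3" using y0 by (intro mult_left_mono) auto
  also have "y * y ^ 3 = y ^ 4" by (simp add: eval_nat_numeral)
  finally have "y * \<delta> ^ 3 \<le> z" using y4 by simp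
  then have "y \<le> z / \<delta> ^ 3" using assms by (simp add: le_divide_eq)
  then show ?thesis using assms unfolding y_def by simp
qed

lemma gap_between_strips:
  fixes p1 p2 p3 p4 q1 q2 w W L M :: real
  assumes "\<bar>p1\<bar> < M" "\<bar>p2\<bar> < M" "\<bar>p3 - q1\<bar> \<le> w" "\<bar>p4 - q2\<bar> \<le> w"
    "q1 + W \<le> q2" "W = 2 * w + 4 * (M + 1)" "L \<le> M" "4 \<le> M"
  shows "L \<le> (p4 + p2) - (p3 + p1)"
proof -
  have "q1 + 2 * w + 4 * M + 4 \<le> q2" using assms(5,6) by simp
  moreover have "p1 < M" "- M < p2" "p3 \<le> q1 + w" "q2 - w \<le> p4" using assms(1-4) by linarith+
  ultimately have "p3 + p1 + 2 * M + 4 \<le> p4 + p2" by linarith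
  then show ?thesis using assms(7,8) by linarith
qed

context tilted_boxes
begin

text \<open>The sites on which the exit probabilities of the small boxes centred in \<open>X\<close> depend.\<close>

definition box_union :: "'n site set \<Rightarrow> 'n site set" where
  "box_union X = (\<Union>x\<in>X. (+) x ` B0)"

lemma pf_shift_local:
  assumes ok: "env_ok \<kappa> \<omega>" "env_ok \<kappa> \<omega>'" and eq: "\<And>y. y \<in> (+) x ` B0 \<Longrightarrow> \<omega> y = \<omega>' y"
  shows "pf (env_shift x \<omega>) = pf (env_shift x \<omega>')"
  unfolding pfront_def
proof (rule hit_local[OF env_ok_shift[OF ok(1)] env_ok_shift[OF ok(2)] kappa_pos finite_tilt_box[OF orth]])
  fix y assume "y \<in> B0"
  then show "env_shift x \<omega> y = env_shift x \<omega>' y"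
    unfolding env_shift_def by (intro eq) (auto simp: add.commute)
qed

lemma measurable_pfront: "(\<lambda>\<omega>. pfront R L' M' \<omega>) \<in> borel_measurable (conf_space \<kappa> UNIV)"
  unfolding pfront_def by (rule measurable_hit[OF kappa_pos])

lemma measurable_pf_shift: "(\<lambda>\<omega>. pf (env_shift x \<omega>)) \<in> borel_measurable (conf_space \<kappa> UNIV)"
  by (rule measurable_compose[OF measurable_env_shift measurable_pfront])

lemma measurable_ratio: "(\<lambda>\<omega>. ratio R L' M' \<omega>) \<in> borel_measurable (conf_space \<kappa> UNIV)"
  unfolding ratio_def by (intro borel_measurable_divide borel_measurable_diff measurable_const measurable_pfront) simp

text \<open>The two functionals to be decoupled have this form: \<open>\<phi>\<close> is the odds function for
  slabs and the failure probability for strips.\<close>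

definition moment :: "real \<Rightarrow> (real \<Rightarrow> real) \<Rightarrow> real \<Rightarrow> 'n site set \<Rightarrow> 'n env \<Rightarrow> ennreal" where
  "moment a \<phi> c X \<omega> = ennreal ((c * (\<Sum>x\<in>X. \<phi> (pf (env_shift x \<omega>)))) powr a)"

lemma moment_local:
  assumes \<phi>: "\<phi> \<in> borel_measurable borel"
  shows "local_on \<kappa> (box_union X) (moment a \<phi> c X)"
  unfolding local_on_def
proof (intro conjI allI impI)
  have "(\<lambda>\<omega>. \<phi> (pf (env_shift x \<omega>))) \<in> borel_measurable (conf_space \<kappa> UNIV)" for x
    by (rule measurable_compose[OF measurable_pf_shift \<phi>])
  then have "(\<lambda>\<omega>. c * (\<Sum>x\<in>X. \<phi> (pf (env_shift x \<omega>)))) \<in> borel_measurable (conf_space \<kappa> UNIV)"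
    by (intro borel_measurable_times borel_measurable_sum) simp_all
  then have "(\<lambda>\<omega>. (c * (\<Sum>x\<in>X. \<phi> (pf (env_shift x \<omega>)))) powr a) \<in> borel_measurable (conf_space \<kappa> UNIV)"
    by (intro powr_real_measurable) simp_all
  then show "moment a \<phi> c X \<in> borel_measurable (conf_space \<kappa> UNIV)"
    unfolding moment_def[abs_def] by (rule measurable_compose) simp
  fix \<omega> \<omega>' assume ok: "env_ok \<kappa> \<omega>" "env_ok \<kappa> \<omega>'" and eq: "\<forall>x\<in>box_union X. \<omega> x = \<omega>' x"
  have "pf (env_shift x \<omega>) = pf (env_shift x \<omega>')" if "x \<in> X" for x
    by (rule pf_shift_local[OF ok]) (use eq that in \<open>auto simp: box_union_def\<close>)
  then show "moment a \<phi> c X \<omega> = moment a \<phi> c X \<omega>'" by (simp add: moment_def)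
qed

text \<open>Subadditivity of \<open>t powr a\<close> for \<open>a \<le> 1\<close>, and stationarity.\<close>

lemma moment_integral:
  assumes env: "random_environment \<kappa> P" and a: "0 < a" "a \<le> 1"
    and eps: "(\<integral>\<^sup>+\<omega>. ennreal (ratio R L M \<omega> powr a) \<partial>P) \<le> ennreal \<epsilon>" "0 \<le> \<epsilon>"
    and X: "finite X" and c: "1 \<le> c"
    and \<phi>: "\<And>\<omega>. env_ok \<kappa> \<omega> \<Longrightarrow> 0 \<le> \<phi> (pf \<omega>) \<and> \<phi> (pf \<omega>) \<le> ratio R L M \<omega>"
  shows "(\<integral>\<^sup>+\<omega>. moment a \<phi> c X \<omega> \<partial>P) \<le> ennreal (c * real (card X) * \<epsilon>)"
proof -
  note rf = random_env_facts[OF env]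
  have m: "(\<lambda>\<omega>. ennreal (ratio R L M \<omega> powr a)) \<in> borel_measurable (conf_space \<kappa> UNIV)"
    by (rule measurable_compose[OF powr_real_measurable[OF measurable_ratio measurable_const] measurable_ennreal]) simp
  have m': "(\<lambda>\<omega>. ennreal (ratio R L M (env_shift x \<omega>) powr a)) \<in> borel_measurable P" for x
    unfolding rf(5) by (rule measurable_compose[OF measurable_env_shift m])
  have "(\<integral>\<^sup>+\<omega>. moment a \<phi> c X \<omega> \<partial>P) \<le> (\<integral>\<^sup>+\<omega>. ennreal c * (\<Sum>x\<in>X. ennreal (ratio R L M (env_shift x \<omega>) powr a)) \<partial>P)"
  proof (rule nn_integral_mono)
    fix \<omega> assume "\<omega> \<in> space P"
    then have ok: "env_ok \<kappa> (env_shift x \<omega>)" for x using rf(3) by (auto intro: env_ok_shift)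
    let ?f = "\<lambda>x. \<phi> (pf (env_shift x \<omega>))"
    have "(c * (\<Sum>x\<in>X. ?f x)) powr a = c powr a * (\<Sum>x\<in>X. ?f x) powr a"
      using c \<phi>[OF ok] by (simp add: powr_mult sum_nonneg)
    also have "\<dots> \<le> c * (\<Sum>x\<in>X. ?f x powr a)"
      using c a \<phi>[OF ok] powr_mono[of a 1 c] by (intro mult_mono powr_sum_le X) auto
    also have "\<dots> \<le> c * (\<Sum>x\<in>X. ratio R L M (env_shift x \<omega>) powr a)"
      using c a \<phi>[OF ok] by (intro mult_left_mono sum_mono powr_mono2) auto
    finally have "moment a \<phi> c X \<omega> \<le> ennreal (c * (\<Sum>x\<in>X. ratio R L M (env_shift x \<omega>) powr a))"
      unfolding moment_def by (rule ennreal_leI)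
    also have "\<dots> = ennreal c * (\<Sum>x\<in>X. ennreal (ratio R L M (env_shift x \<omega>) powr a))"
      using c by (simp add: ennreal_mult sum_nonneg)
    finally show "moment a \<phi> c X \<omega> \<le> \<dots>" .
  qed
  also have "\<dots> = ennreal c * (\<Sum>x\<in>X. \<integral>\<^sup>+\<omega>. ennreal (ratio R L M (env_shift x \<omega>) powr a) \<partial>P)"
    using m' by (subst nn_integral_cmult, intro borel_measurable_sum m', subst nn_integral_sum) simp_all
  also have "\<dots> = ennreal c * (\<Sum>x\<in>X. \<integral>\<^sup>+\<omega>. ennreal (ratio R L M \<omega> powr a) \<partial>P)"
    using stationary_integral[OF env m] by simp
  also have "\<dots> \<le> ennreal c * (\<Sum>x\<in>X. ennreal \<epsilon>)"
    by (intro mult_left_mono sum_mono eps) simp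
  also have "\<dots> = ennreal (c * real (card X) * \<epsilon>)"
    using c eps(2) by (simp add: ennreal_mult ennreal_of_nat_eq_real_of_nat mult.assoc)
  finally show ?thesis .
qed

lemma card_slab_le:
  assumes "2 \<le> M'"
  shows "real (card (slab R L M' i)) \<le> lat_const TYPE('n) * (2 * L * (3 * M') ^ (CARD('n) - 1))"
proof -
  let ?a = "\<lambda>j :: 'n. if j = idx1 then of_int i * L else - M'" and ?b = "\<lambda>j :: 'n. if j = idx1 then (of_int i + 1) * L else M'"
  have ab: "?a j \<le> ?b j" for j using assms L_ge by (auto simp: algebra_simps)
  note S = lattice_points_rotated_box[where a = ?a and b = ?b, OF orth ab]
  have "slab R L M' i \<subseteq> {z. \<forall>j. ?a j \<le> coord R j z \<and> coord R j z \<le> ?b j}"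
  proof
    fix z assume z: "z \<in> slab R L M' i"
    have "?a j \<le> coord R j z \<and> coord R j z \<le> ?b j" for j
      using z by (cases "j = idx1") (auto simp: slab_def dest!: spec[of _ j])
    then show "z \<in> {z. \<forall>j. ?a j \<le> coord R j z \<and> coord R j z \<le> ?b j}" by blast
  qed
  then have "real (card (slab R L M' i)) \<le> real (card {z. \<forall>j. ?a j \<le> coord R j z \<and> coord R j z \<le> ?b j})"
    using card_mono[OF S(1)] by simp
  also have "\<dots> \<le> lat_const TYPE('n) * (\<Prod>j\<in>UNIV. ?b j - ?a j + 2)" by (rule S(2))
  also have "(\<Prod>j\<in>UNIV. ?b j - ?a j + 2) = (L + 2) * (2 * M' + 2) ^ (CARD('n) - 1)"
    by (subst prod.remove[of _ idx1]) (auto simp: algebra_simps)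
  also have "lat_const TYPE('n) * \<dots> \<le> lat_const TYPE('n) * (2 * L * (3 * M') ^ (CARD('n) - 1))"
    using assms L_ge by (intro mult_left_mono mult_mono power_mono) (auto simp: lat_const_def)
  finally show ?thesis .
qed

lemma card_strip_le:
  assumes N: "40 \<le> N" and M': "2 \<le> M'" and j: "j \<noteq> idx1" and sg: "sg = 1 \<or> sg = (-1::real)"
  shows "real (card (strip N M' j sg b)) \<le> lat_const TYPE('n) * (3 * real N * L * (6 * real N * M) * (3 * M') ^ (CARD('n) - 2))"
proof -
  let ?w = "(2 * real N + 2) * (M + 1)"
  let ?a = "\<lambda>i. if i = idx1 then - (real N * L - 1) else if i = j then sg * b - ?w else - M'"
  let ?b = "\<lambda>i. if i = idx1 then real N * L + 1 else if i = j then sg * b + ?w else M'"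
  have w: "0 \<le> ?w" using L_ge L_le_M by simp
  have NL: "160 \<le> real N * L" using N L_ge mult_mono[of 40 "real N" 4 L] by simp
  have ab: "?a i \<le> ?b i" for i using w NL M' by auto
  note S = lattice_points_rotated_box[where a = ?a and b = ?b, OF orth ab]
  have "strip N M' j sg b \<subseteq> {z. \<forall>i. ?a i \<le> coord R i z \<and> coord R i z \<le> ?b i}"
  proof
    fix z assume z: "z \<in> strip N M' j sg b"
    then have zw: "\<bar>sg * coord R j z - b\<bar> \<le> ?w" by (simp add: strip_def)
    have "\<bar>coord R j z - sg * b\<bar> \<le> ?w" using zw sg by (auto simp: abs_le_iff)
    then have zj: "sg * b - ?w \<le> coord R j z" "coord R j z \<le> sg * b + ?w" by (auto simp: abs_le_iff)
    have "?a i \<le> coord R i z \<and> coord R i z \<le> ?b i" for i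
    proof -
      consider "i = idx1" | "i = j" "i \<noteq> idx1" | "i \<noteq> idx1" "i \<noteq> j" by blast
      then show ?thesis
      proof cases
        case 1 then show ?thesis using z by (simp add: strip_def tilt_box_def)
      next
        case 2 then show ?thesis using zj by simp
      next
        case 3
        then have "\<bar>coord R i z\<bar> < M'" using z by (simp add: strip_def tilt_box_def)
        then show ?thesis using 3 by auto
      qed
    qed
    then show "z \<in> {z. \<forall>i. ?a i \<le> coord R i z \<and> coord R i z \<le> ?b i}" by blast
  qed
  then have "real (card (strip N M' j sg b)) \<le> real (card {z. \<forall>i. ?a i \<le> coord R i z \<and> coord R i z \<le> ?b i})"
    using card_mono[OF S(1)] by simp
  also have "\<dots> \<le> lat_const TYPE('n) * (\<Prod>i\<in>UNIV. ?b i - ?a i + 2)" by (rule S(2))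
  also have "(\<Prod>i\<in>UNIV. ?b i - ?a i + 2) = (2 * (real N * L) + 2) * ((2 * ?w + 2) * (\<Prod>i\<in>UNIV - {idx1} - {j}. ?b i - ?a i + 2))"
    using j by (subst prod.remove[of _ idx1], simp, simp, subst prod.remove[of _ j]) (auto simp: algebra_simps)
  also have "(\<Prod>i\<in>UNIV - {idx1} - {j}. ?b i - ?a i + 2) = (\<Prod>i\<in>UNIV - {idx1} - {j}. 2 * M' + 2)"
    by (rule prod.cong) auto
  also have "\<dots> = (2 * M' + 2) ^ (CARD('n) - 2)"
    using j by (simp add: card_Diff_subset card_Diff_insert numeral_2_eq_2)
  also have "(2 * (real N * L) + 2) * ((2 * ?w + 2) * (2 * M' + 2) ^ (CARD('n) - 2))
     \<le> (3 * real N * L) * ((6 * real N * M) * (3 * M') ^ (CARD('n) - 2))"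
  proof (intro mult_mono power_mono)
    show "2 * (real N * L) + 2 \<le> 3 * real N * L" using NL unfolding mult.assoc by linarith
    have "?w \<le> (41/20 * real N) * (5/4 * M)"
      using N L_ge L_le_M by (intro mult_mono) auto
    then have w1: "?w \<le> 41/16 * (real N * M)" by (simp add: mult_ac)
    have w2: "160 \<le> real N * M" using N L_ge L_le_M mult_mono[of 40 "real N" 4 M] by simp
    have "2 * w + 2 \<le> 6 * x" if "w \<le> 41/16 * x" "160 \<le> x" for w x :: real using that by simp
    from this[OF w1 w2] show "2 * ?w + 2 \<le> 6 * real N * M" by (simp only: mult.assoc)
  qed (use M' w N L_ge L_le_M in auto)
  finally show ?thesis by (simp add: mult.assoc lat_const_def mult_left_mono)
qed

lemma card_box_union_le:
  assumes X: "\<And>x. x \<in> X \<Longrightarrow> \<bar>coord R idx1 x - t\<bar> \<le> h" "\<And>x j. x \<in> X \<Longrightarrow> j \<noteq> idx1 \<Longrightarrow> \<bar>coord R j x\<bar> < M'"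
    and h: "0 \<le> h" "h + L + 3 \<le> 4 * M'" "M + 1 \<le> M'"
  shows "finite (box_union X)" "real (card (box_union X)) \<le> lat_const TYPE('n) * (8 * M') ^ CARD('n)"
proof -
  let ?a = "\<lambda>j :: 'n. if j = idx1 then t - (h + L + 1) else - (M' + M)" and ?b = "\<lambda>j :: 'n. if j = idx1 then t + (h + L + 1) else M' + M"
  have M0: "M > 0" "M' > 0" using L_ge L_le_M h by auto
  have ab: "?a j \<le> ?b j" for j using h L_ge M0 by auto
  note S = lattice_points_rotated_box[where a = ?a and b = ?b, OF orth ab]
  have sub: "box_union X \<subseteq> {z. \<forall>j. ?a j \<le> coord R j z \<and> coord R j z \<le> ?b j}"
  proof
    fix z assume "z \<in> box_union X"
    then obtain x y where z: "z = x + y" "x \<in> X" "y \<in> B0" by (auto simp: box_union_def)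
    have "?a j \<le> coord R j z \<and> coord R j z \<le> ?b j" for j
    proof (cases "j = idx1")
      case True
      have "- (L - 1) < coord R idx1 y" "coord R idx1 y < L + 1" using z(3) by (auto simp: tilt_box_def)
      then show ?thesis using X(1)[OF z(2)] True z(1) by (auto simp: abs_le_iff)
    next
      case False
      have "\<bar>coord R j y\<bar> < M" using z(3) False by (auto simp: tilt_box_def)
      then show ?thesis using X(2)[OF z(2) False] False z(1) by auto
    qed
    then show "z \<in> {z. \<forall>j. ?a j \<le> coord R j z \<and> coord R j z \<le> ?b j}" by blast
  qed
  then show "finite (box_union X)" by (rule finite_subset[OF _ S(1)])
  have "real (card (box_union X)) \<le> real (card {z. \<forall>j. ?a j \<le> coord R j z \<and> coord R j z \<le> ?b j})"
    using card_mono[OF S(1) sub] by simp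
  also have "\<dots> \<le> lat_const TYPE('n) * (\<Prod>j\<in>UNIV. ?b j - ?a j + 2)" by (rule S(2))
  also have "\<dots> \<le> lat_const TYPE('n) * (\<Prod>j\<in>(UNIV :: 'n set). 8 * M')"
    using h L_ge M0 by (intro mult_left_mono prod_mono) (auto simp: lat_const_def)
  finally show "real (card (box_union X)) \<le> lat_const TYPE('n) * (8 * M') ^ CARD('n)" by simp
qed


lemma scale_facts:
  assumes "40 \<le> N"
  shows "real CARD('n) < real N ^ 3 * M" "2 \<le> real N ^ 3 * M" "M + 1 \<le> real N ^ 3 * M"
    "real N * L + L + 4 \<le> real N ^ 3 * M" "real N * L \<le> real N ^ 3 * M"
    "real N * M * 1600 \<le> real N ^ 3 * M"
proof -
  have M0: "4 \<le> M" using L_ge L_le_M by simp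
  have "(40::real) ^ 2 \<le> real N ^ 2" using assms by (intro power_mono) auto
  then have "1600 * (real N * M) \<le> real N ^ 2 * (real N * M)"
    using M0 by (intro mult_right_mono) auto
  also have "\<dots> = real N ^ 3 * M" by (simp add: power_numeral_reduce)
  finally have 1: "1600 * (real N * M) \<le> real N ^ 3 * M" .
  have 2: "40 * M \<le> real N * M" using assms M0 by (intro mult_right_mono) auto
  have 3: "real N * L \<le> real N * M" using L_le_M by (intro mult_left_mono) auto
  show "real CARD('n) < real N ^ 3 * M" "2 \<le> real N ^ 3 * M" "M + 1 \<le> real N ^ 3 * M"
    "real N * L + L + 4 \<le> real N ^ 3 * M" "real N * L \<le> real N ^ 3 * M"
    "real N * M * 1600 \<le> real N ^ 3 * M"
    using 1 2 3 M0 L_gt L_le_M by linarith+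
qed

lemma norm1_ge_coord_gap:
  assumes "s \<le> \<bar>coord R j x - coord R j y\<bar>" shows "s \<le> norm1 (x - y)"
  using abs_coord_le[OF orth, of j "x - y"] assms by simp

context
  fixes P :: "'n env measure" and r C g a \<epsilon> M1 \<sigma> :: real and N :: nat
  assumes M1_eq: "M1 = real N ^ 3 * M"
    and sigma_eq: "\<sigma> = 180 * lat_const TYPE('n) * L * (3 * M1) ^ (CARD('n) - 1) * \<epsilon>"
    and env: "random_environment \<kappa> P" and smg: "SMG \<kappa> r C g P" and Cg: "C > 0" "g > 0"
    and r: "r \<le> L" and N: "40 \<le> N" and a: "0 < a" "a \<le> 1"
    and eps: "(\<integral>\<^sup>+\<omega>. ennreal (ratio R L M \<omega> powr a) \<partial>P) \<le> ennreal \<epsilon>" "0 < \<epsilon>"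
    and mix: "C * (lat_const TYPE('n) * (8 * M1) ^ CARD('n) * decay_const TYPE('n) (g / 2) * exp (- g * L / 2)) \<le> 1"
begin

lemmas scale = scale_facts[OF N, folded M1_eq]

lemma contraction_pos: "0 < \<sigma>"
  using eps(2) L_ge scale(2) by (simp add: sigma_eq lat_const_def)

text \<open>Common part of \<open>weight_moment\<close> and \<open>lateral_moment\<close>: once the
  regions are separated by \<open>L\<close>, each factor contributes at most \<open>\<sigma>\<close>.\<close>

lemma product_moment_le:
  fixes X :: "nat \<Rightarrow> 'n site set"
  assumes J: "finite J" and X: "\<And>k. k \<in> J \<Longrightarrow> finite (X k)" and \<phi>m: "\<phi> \<in> borel_measurable borel"
    and \<phi>: "\<And>\<omega>. env_ok \<kappa> \<omega> \<Longrightarrow> 0 \<le> \<phi> (pf \<omega>) \<and> \<phi> (pf \<omega>) \<le> ratio R L M \<omega>"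
    and c: "1 \<le> c" and bound: "\<And>k. k \<in> J \<Longrightarrow> 3 * (c * real (card (X k)) * \<epsilon>) \<le> \<sigma>"
    and loc: "\<And>k x. k \<in> J \<Longrightarrow> x \<in> X k \<Longrightarrow> \<bar>coord R idx1 x - t k\<bar> \<le> h" "0 \<le> h" "h + L + 3 \<le> 4 * M1"
    and lat: "\<And>k x j. k \<in> J \<Longrightarrow> x \<in> X k \<Longrightarrow> j \<noteq> idx1 \<Longrightarrow> \<bar>coord R j x\<bar> < M1"
    and sep: "\<And>i k x y. i \<in> J \<Longrightarrow> k \<in> J \<Longrightarrow> i < k \<Longrightarrow> x \<in> box_union (X i) \<Longrightarrow> y \<in> box_union (X k) \<Longrightarrow> L \<le> norm1 (x - y)"
  shows "(\<integral>\<^sup>+\<omega>. (\<Prod>k\<in>J. moment a \<phi> c (X k) \<omega>) \<partial>P) \<le> ennreal (\<sigma> ^ card J)"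
proof -
  have e0: "0 \<le> \<epsilon>" using eps(2) by simp
  have fin: "finite (box_union (X k))" "real (card (box_union (X k))) \<le> lat_const TYPE('n) * (8 * M1) ^ CARD('n)"
    if "k \<in> J" for k
    by (rule card_box_union_le[of "X k" "t k" h M1]; use loc lat scale that in simp)+
  have dec: "0 \<le> decay_const TYPE('n) (g / 2)" using Cg by (simp add: decay_const_def)
  have "(\<integral>\<^sup>+\<omega>. (\<Prod>k\<in>J. moment a \<phi> c (X k) \<omega>) \<partial>P) \<le> (\<Prod>k\<in>J. ennreal 3 * (\<integral>\<^sup>+\<omega>. moment a \<phi> c (X k) \<omega> \<partial>P))"
  proof (rule mixing_product[OF env smg Cg r _ J])
    show "0 < L" using L_ge by simp
    show "L \<le> norm1 (x - y)" if "i \<in> J" "k \<in> J" "i \<noteq> k" "x \<in> box_union (X i)" "y \<in> box_union (X k)" for i k x y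
    proof (cases "i < k")
      case True then show ?thesis using sep[OF that(1,2) True that(4,5)] by simp
    next
      case False
      then have "L \<le> norm1 (y - x)" using sep[OF that(2,1) _ that(5,4)] that(3) by simp
      also have "norm1 (y - x) = norm1 (x - y)" unfolding norm1_def by (simp add: abs_minus_commute)
      finally show ?thesis .
    qed
    show "local_on \<kappa> (box_union (X k)) (moment a \<phi> c (X k))" for k by (rule moment_local[OF \<phi>m])
    show "C * (real (card (box_union (X k))) * decay_const TYPE('n) (g / 2) * exp (- g * L / 2)) \<le> 1" if "k \<in> J" for k
    proof -
      have "C * (real (card (box_union (X k))) * decay_const TYPE('n) (g / 2) * exp (- g * L / 2))
        \<le> C * (lat_const TYPE('n) * (8 * M1) ^ CARD('n) * decay_const TYPE('n) (g / 2) * exp (- g * L / 2))"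
        using fin(2)[OF that] Cg dec by (intro mult_left_mono mult_right_mono) auto
      then show ?thesis using mix by linarith
    qed
  qed (use fin in auto)
  also have "\<dots> \<le> (\<Prod>k\<in>J. ennreal \<sigma>)"
  proof (rule prod_mono_ennreal)
    fix k assume k: "k \<in> J"
    have "ennreal 3 * (\<integral>\<^sup>+\<omega>. moment a \<phi> c (X k) \<omega> \<partial>P) \<le> ennreal 3 * ennreal (c * real (card (X k)) * \<epsilon>)"
      by (intro mult_left_mono moment_integral[OF env a eps(1) e0 X[OF k] c \<phi>]) auto
    also have "\<dots> = ennreal (3 * (c * real (card (X k)) * \<epsilon>))"
      using c e0 by (simp add: ennreal_mult)
    also have "\<dots> \<le> ennreal \<sigma>" by (rule ennreal_leI[OF bound[OF k]])
    finally show "ennreal 3 * (\<integral>\<^sup>+\<omega>. moment a \<phi> c (X k) \<omega> \<partial>P) \<le> ennreal \<sigma>" .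
  qed
  also have "\<dots> = ennreal (\<sigma> ^ card J)" using contraction_pos by (simp add: ennreal_power)
  finally show ?thesis .
qed

lemma ratio_fun_measurable: "(\<lambda>p::real. (1 - p) / p) \<in> borel_measurable borel"
  by measurable

text \<open>Slabs whose indices agree modulo four carry boxes at distance at least \<open>L\<close>.  Splitting the
  product into the four residue classes costs the factor four in the exponent and leaves at least
  \<open>N div 4\<close> nearly independent factors in each class.\<close>

lemma weight_moment:
  assumes m: "N \<le> m" "40 dvd N" and \<sigma>: "\<sigma> \<le> 1"
  shows "(\<integral>\<^sup>+\<omega>. ennreal (weight N M1 \<omega> m powr (a / 4)) \<partial>P) \<le> ennreal (4 * \<sigma> ^ (N div 4))"
proof -
  note rf = random_env_facts[OF env]
  define J where "J q = {k. k < m \<and> k mod 4 = q}" for q :: nat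
  define X where "X k = slab R L M1 (int k + 1 - int N)" for k
  define \<phi> :: "real \<Rightarrow> real" where "\<phi> p = (1 - p) / p" for p
  have finJ: "finite (J q)" for q by (simp add: J_def)
  have \<phi>r: "\<phi> (pf \<omega>) = ratio R L M \<omega>" for \<omega> by (simp add: \<phi>_def ratio_def)
  have ratio_X: "2 * slab_ratio M1 \<omega> (int k + 1 - int N) = 2 * (\<Sum>x\<in>X k. \<phi> (pf (env_shift x \<omega>)))" for \<omega> k
    by (simp add: slab_ratio_def X_def \<phi>r)
  have bound: "(\<integral>\<^sup>+\<omega>. (\<Prod>k\<in>J q. moment a \<phi> 2 (X k) \<omega>) \<partial>P) \<le> ennreal (\<sigma> ^ (N div 4))" if q: "q < 4" for q
  proof -
    have "(\<integral>\<^sup>+\<omega>. (\<Prod>k\<in>J q. moment a \<phi> 2 (X k) \<omega>) \<partial>P) \<le> ennreal (\<sigma> ^ card (J q))"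
    proof (rule product_moment_le[OF finJ, where t = "\<lambda>k. of_int (int k + 1 - int N) * L" and h = L])
      fix k assume "k \<in> J q"
      show "finite (X k)" unfolding X_def by (rule finite_slab)
      have "3 * (2 * real (card (X k)) * \<epsilon>) \<le> 3 * (2 * (lat_const TYPE('n) * (2 * L * (3 * M1) ^ (CARD('n) - 1))) * \<epsilon>)"
        unfolding X_def using eps(2) scale
        by (intro mult_left_mono mult_right_mono card_slab_le) auto
      also have "\<dots> = 12 * (lat_const TYPE('n) * L * (3 * M1) ^ (CARD('n) - 1) * \<epsilon>)" by simp
      also have "\<dots> \<le> 180 * (lat_const TYPE('n) * L * (3 * M1) ^ (CARD('n) - 1) * \<epsilon>)"
        using L_ge scale(2) eps(2) by (intro mult_right_mono) (auto simp: lat_const_def)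
      finally show "3 * (2 * real (card (X k)) * \<epsilon>) \<le> \<sigma>" by (simp add: sigma_eq mult.assoc)
      fix x assume x: "x \<in> X k"
      show "\<bar>coord R idx1 x - of_int (int k + 1 - int N) * L\<bar> \<le> L"
        using x unfolding X_def slab_def distrib_right abs_le_iff by auto
      show "\<bar>coord R j x\<bar> < M1" if "j \<noteq> idx1" for j using x that by (simp add: X_def slab_def)
    next
      show "L + L + 3 \<le> 4 * M1" using scale L_ge L_le_M by linarith
      fix i k x y assume ik: "i \<in> J q" "k \<in> J q" "i < k" and x: "x \<in> box_union (X i)" and y: "y \<in> box_union (X k)"
      have "4 dvd k - i"
        using ik mod_eq_dvd_iff_nat[of i k 4] by (simp add: J_def)
      then have "4 \<le> k - i" using ik(3) by (intro dvd_imp_le) auto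
      then have "i + 4 \<le> k" by linarith
      then have "real_of_int (int i + 1 - int N) + 4 \<le> real_of_int (int k + 1 - int N)" by linarith
      then have d: "real_of_int (int i + 1 - int N) * L + 4 * L \<le> real_of_int (int k + 1 - int N) * L"
        using mult_right_mono[of "real_of_int (int i + 1 - int N) + 4" "real_of_int (int k + 1 - int N)" L] L_ge
        unfolding distrib_right by linarith
      obtain x1 x2 where x': "x = x1 + x2" "x1 \<in> X i" "x2 \<in> B0" using x by (auto simp: box_union_def)
      obtain y1 y2 where y': "y = y1 + y2" "y1 \<in> X k" "y2 \<in> B0" using y by (auto simp: box_union_def)
      have "coord R idx1 x < real_of_int (int i + 1 - int N) * L + L + (L + 1)"
        using x' unfolding X_def slab_def tilt_box_def distrib_right by auto
      moreover have "real_of_int (int k + 1 - int N) * L - (L - 1) < coord R idx1 y"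
        using y' unfolding X_def slab_def tilt_box_def by auto
      ultimately have "L \<le> coord R idx1 y - coord R idx1 x" using d by linarith
      then show "L \<le> norm1 (x - y)" by (intro norm1_ge_coord_gap[of _ idx1]) simp
    qed (use L_ge in \<open>auto simp: \<phi>_def[abs_def] \<phi>r ratio_fun_measurable less_imp_le[OF ratio_pos] simp flip: ratio_def\<close>)
    also have "\<dots> \<le> ennreal (\<sigma> ^ (N div 4))"
    proof (intro ennreal_leI power_decreasing)
      have "(\<lambda>i. 4 * i + q) ` {..<N div 4} \<subseteq> J q"
        using q m by (auto simp: J_def)
      then have "card ((\<lambda>i. 4 * i + q) ` {..<N div 4}) \<le> card (J q)" by (rule card_mono[OF finJ])
      then show "N div 4 \<le> card (J q)" by (simp add: card_image inj_on_def)
    qed (use contraction_pos \<sigma> in auto)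
    finally show ?thesis .
  qed
  have "(\<integral>\<^sup>+\<omega>. ennreal (weight N M1 \<omega> m powr (a / 4)) \<partial>P) \<le> (\<integral>\<^sup>+\<omega>. (\<Sum>q<4. \<Prod>k\<in>J q. moment a \<phi> 2 (X k) \<omega>) \<partial>P)"
  proof (rule nn_integral_mono)
    fix \<omega> assume "\<omega> \<in> space P"
    then have ok: "env_ok \<kappa> \<omega>" using rf(3) by simp
    define s where "s k = 2 * slab_ratio M1 \<omega> (int k + 1 - int N)" for k
    have s: "0 < s k" for k using slab_ratio_pos[OF ok scale(1)] by (simp add: s_def)
    define Y where "Y q = (\<Prod>k\<in>J q. s k powr a)" for q
    have Y: "0 \<le> Y q" for q unfolding Y_def by (intro prod_nonneg) auto
    have "weight N M1 \<omega> m powr a = (\<Prod>k<m. s k powr a)"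
      unfolding weight_def s_def[symmetric] by (rule prod_powr_distrib)
    also have "\<dots> = (\<Prod>q<4. Y q)"
    proof -
      have "{..<m} = (\<Union>q<4. J q)" by (auto simp: J_def)
      then have "(\<Prod>k<m. s k powr a) = (\<Prod>k\<in>(\<Union>q<4. J q). s k powr a)" by simp
      also have "\<dots> = (\<Prod>q<4. \<Prod>k\<in>J q. s k powr a)"
        by (rule prod.UNION_disjoint) (auto simp: J_def)
      finally show ?thesis by (simp only: Y_def)
    qed
    finally have wa: "weight N M1 \<omega> m powr a = (\<Prod>q<4. Y q)" .
    have "weight N M1 \<omega> m powr (a / 4) = (weight N M1 \<omega> m powr a) powr (1 / 4)" by (simp add: powr_powr)
    also have "\<dots> = (\<Prod>q<4. Y q) powr (1 / 4)" by (simp only: wa)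
    also have "\<dots> \<le> (\<Sum>q<4. Y q)" by (rule prod_four_roots_le[OF Y])
    finally have "ennreal (weight N M1 \<omega> m powr (a / 4)) \<le> (\<Sum>q<4. ennreal (Y q))"
      using Y by (simp add: sum_ennreal ennreal_leI)
    also have "\<dots> = (\<Sum>q<4. \<Prod>k\<in>J q. moment a \<phi> 2 (X k) \<omega>)"
      unfolding Y_def moment_def s_def ratio_X by (intro sum.cong refl prod_ennreal[symmetric]) auto
    finally show "ennreal (weight N M1 \<omega> m powr (a / 4)) \<le> \<dots>" .
  qed
  also have "\<dots> = (\<Sum>q<4. \<integral>\<^sup>+\<omega>. (\<Prod>k\<in>J q. moment a \<phi> 2 (X k) \<omega>) \<partial>P)"
  proof (rule nn_integral_sum)
    fix q
    have "moment a \<phi> 2 (X k) \<in> borel_measurable P" for k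
      using moment_local[of \<phi> "X k" a 2] ratio_fun_measurable unfolding local_on_def rf(5) \<phi>_def[abs_def] by blast
    then show "(\<lambda>\<omega>. \<Prod>k\<in>J q. moment a \<phi> 2 (X k) \<omega>) \<in> borel_measurable P"
      by (intro borel_measurable_prod_ennreal)
  qed
  also have "\<dots> \<le> (\<Sum>q<4::nat. ennreal (\<sigma> ^ (N div 4)))" by (rule sum_mono) (use bound in simp)
  also have "\<dots> = ennreal (4 * \<sigma> ^ (N div 4))"
    using contraction_pos by (simp add: ennreal_mult)
  finally show ?thesis .
qed

text \<open>Here \<open>K = 4 * K'\<close> strips fit into the box because its width \<open>N ^ 3 * M\<close> is of
  order \<open>N\<^sup>2\<close> times the distance of the strips.\<close>

lemma lateral_moment:
  assumes dv: "40 dvd N" and \<sigma>: "\<sigma> \<le> 1" and j: "j \<noteq> idx1" and sg: "sg = 1 \<or> sg = (-1::real)"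
  shows "(\<integral>\<^sup>+\<omega>. ennreal (hit \<omega> (tilt_box R (real N * L) M1) {z. M1 \<le> sg * coord R j z} 0 powr (a / 4)) \<partial>P)
    \<le> ennreal (2 * \<sigma> ^ (N * N div 40))"
proof -
  note rf = random_env_facts[OF env]
  let ?W = "(4 * real N + 8) * (M + 1)" and ?w = "(2 * real N + 2) * (M + 1)"
  define K' where "K' = N * N div 40"
  define K where "K = 4 * K'"
  define \<delta> where "\<delta> = \<sigma> ^ K'"
  define X where "X m = strip N M1 j sg (real m * ?W)" for m
  define c where "c = 2 * real N + 1"
  define \<phi> :: "real \<Rightarrow> real" where "\<phi> p = 1 - p" for p
  have \<delta>: "0 < \<delta>" using contraction_pos by (simp add: \<delta>_def)
  have M0: "4 \<le> M" using L_ge L_le_M by simp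
  have c: "1 \<le> c" by (simp add: c_def)
  have \<phi>m: "\<phi> \<in> borel_measurable borel" unfolding \<phi>_def[abs_def] by measurable
  have Z: "(\<integral>\<^sup>+\<omega>. (\<Prod>m<K. moment a \<phi> c (X m) \<omega>) \<partial>P) \<le> ennreal (\<sigma> ^ card {..<K})"
  proof (rule product_moment_le[where t = "\<lambda>_. 0" and h = "real N * L + 1", OF _ _ \<phi>m _ c])
    show "0 \<le> \<phi> (pf \<omega>) \<and> \<phi> (pf \<omega>) \<le> ratio R L M \<omega>" if "env_ok \<kappa> \<omega>" for \<omega>
      using fail_le_ratio[OF that] pf_bounds[OF that] by (simp add: \<phi>_def)
    fix m
    show "finite (X m)" unfolding X_def by (rule finite_strip)
    have d2: "CARD('n) - 1 = Suc (CARD('n) - 2)"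
    proof -
      have "card {idx1, j} \<le> CARD('n)" by (rule card_mono) auto
      then show ?thesis using j by simp
    qed
    define V where "V = (3 * M1) ^ (CARD('n) - 2)"
    have V: "0 \<le> V" using scale(2) by (simp add: V_def)
    have lc: "0 \<le> lat_const TYPE('n)" by (simp add: lat_const_def)
    have "3 * (c * real (card (X m)) * \<epsilon>)
       \<le> 3 * ((21/10 * real N) * (lat_const TYPE('n) * (3 * real N * L * (6 * real N * M) * V)) * \<epsilon>)"
      unfolding X_def V_def using eps(2) N scale(2)
      by (intro mult_left_mono mult_right_mono mult_mono card_strip_le[OF N _ j sg]) (auto simp: c_def)
    also have "\<dots> = 1134/10 * (lat_const TYPE('n) * L * M1 * V * \<epsilon>)"
      unfolding M1_eq by (simp add: power3_eq_cube)
    also have "\<dots> \<le> 540 * (lat_const TYPE('n) * L * M1 * V * \<epsilon>)"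
      using lc L_ge scale(2) V eps(2) by (intro mult_right_mono) auto
    also have "\<dots> = \<sigma>" unfolding sigma_eq d2 power_Suc V_def[symmetric] by simp
    finally show "3 * (c * real (card (X m)) * \<epsilon>) \<le> \<sigma>" .
    fix x assume x: "x \<in> X m"
    then have xB: "x \<in> tilt_box R (real N * L) M1" by (simp add: X_def strip_def)
    then show "\<bar>coord R idx1 x - 0\<bar> \<le> real N * L + 1" unfolding tilt_box_def by (simp add: abs_le_iff)
    show "\<bar>coord R i x\<bar> < M1" if "i \<noteq> idx1" for i using xB that by (simp add: tilt_box_def)
  next
    show "0 \<le> real N * L + 1" using L_ge by simp
    show "real N * L + 1 + L + 3 \<le> 4 * M1" using scale(2,4) by linarith
    fix i k x y assume ik: "i < k" and x: "x \<in> box_union (X i)" and y: "y \<in> box_union (X k)"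
    obtain x1 x2 where x': "x = x1 + x2" "x1 \<in> X i" "x2 \<in> B0" using x by (auto simp: box_union_def)
    obtain y1 y2 where y': "y = y1 + y2" "y1 \<in> X k" "y2 \<in> B0" using y by (auto simp: box_union_def)
    have x2: "\<bar>coord R j x2\<bar> < M" and y2: "\<bar>coord R j y2\<bar> < M" using x'(3) y'(3) j by (auto simp: tilt_box_def)
    have sgb: "\<bar>sg * t\<bar> = \<bar>t\<bar>" for t using sg by auto
    have x1: "\<bar>sg * coord R j x1 - real i * ?W\<bar> \<le> ?w" using x'(2) by (simp add: X_def strip_def)
    have y1: "\<bar>sg * coord R j y1 - real k * ?W\<bar> \<le> ?w" using y'(2) by (simp add: X_def strip_def)
    have "real (i + 1) * ?W \<le> real k * ?W" using ik M0 by (intro mult_right_mono) auto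
    then have W: "real i * ?W + ?W \<le> real k * ?W" by (simp add: distrib_right)
    have Ww: "?W = 2 * ?w + 4 * (M + 1)" by (simp add: algebra_simps)
    have X2: "\<bar>sg * coord R j x2\<bar> < M" "\<bar>sg * coord R j y2\<bar> < M" unfolding sgb by (rule x2 y2)+
    from gap_between_strips[OF X2 x1 y1 W Ww L_le_M M0] have "L \<le> \<bar>sg * (coord R j y - coord R j x)\<bar>"
      unfolding x'(1) y'(1) by (simp add: algebra_simps)
    then have "L \<le> \<bar>coord R j x - coord R j y\<bar>" unfolding sgb by simp
    then show "L \<le> norm1 (x - y)" by (rule norm1_ge_coord_gap)
  qed simp
  have K: "real K * ?W \<le> M1"
  proof -
    obtain q where q: "N = 40 * q" using dv by auto
    have "real K = real N * real N / 10" unfolding K_def K'_def q by simp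
    moreover have "?W \<le> (42/10 * real N) * (5/4 * M)" using N M0 by (intro mult_mono) auto
    ultimately have "real K * ?W \<le> (real N * real N / 10) * ((42/10 * real N) * (5/4 * M))"
      using N M0 by (intro mult_mono) (auto intro!: mult_nonneg_nonneg)
    also have "\<dots> = 525/1000 * M1" unfolding M1_eq by (simp add: power3_eq_cube)
    also have "\<dots> \<le> M1" using scale(2) by simp
    finally show ?thesis .
  qed
  have mm: "(\<lambda>\<omega>. \<Prod>m<K. moment a \<phi> c (X m) \<omega>) \<in> borel_measurable P"
    using moment_local[OF \<phi>m] unfolding local_on_def rf(5) by (intro borel_measurable_prod_ennreal) blast
  have "(\<integral>\<^sup>+\<omega>. ennreal (hit \<omega> (tilt_box R (real N * L) M1) {z. M1 \<le> sg * coord R j z} 0 powr (a / 4)) \<partial>P)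
     \<le> (\<integral>\<^sup>+\<omega>. ennreal \<delta> + ennreal (1 / \<delta> ^ 3) * (\<Prod>m<K. moment a \<phi> c (X m) \<omega>) \<partial>P)"
  proof (rule nn_integral_mono)
    fix \<omega> assume "\<omega> \<in> space P"
    then have ok: "env_ok \<kappa> \<omega>" using rf(3) by simp
    let ?u = "hit \<omega> (tilt_box R (real N * L) M1) {z. M1 \<le> sg * coord R j z} 0"
    define s where "s m = c * (\<Sum>x\<in>X m. \<phi> (pf (env_shift x \<omega>)))" for m
    have s0: "0 \<le> s m" for m
      using strip_fail_nonneg[OF ok, of N M1 j sg m] c unfolding s_def X_def \<phi>_def strip_fail_def by simp
    have N0: "0 < N" using N by simp
    have "?u \<le> (\<Prod>m<K. s m)"
      using lateral_exit_le[OF ok j sg N0 K] unfolding s_def X_def \<phi>_def c_def strip_fail_def .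
    then have "?u powr a \<le> (\<Prod>m<K. s m) powr a" using a by (intro powr_mono2 hit_nonneg) auto
    also have "\<dots> = (\<Prod>m<K. s m powr a)" by (rule prod_powr_distrib)
    finally have ua: "?u powr a \<le> (\<Prod>m<K. s m powr a)" .
    have "?u powr (a / 4) = (?u powr a) powr (1 / 4)" by (simp add: powr_powr)
    also have "\<dots> \<le> (\<Prod>m<K. s m powr a) powr (1 / 4)" using ua by (intro powr_mono2) auto
    also have "\<dots> \<le> \<delta> + (\<Prod>m<K. s m powr a) / \<delta> ^ 3"
      by (rule fourth_root_le[OF _ \<delta>]) (auto intro: prod_nonneg)
    finally have "ennreal (?u powr (a / 4)) \<le> ennreal (\<delta> + 1 / \<delta> ^ 3 * (\<Prod>m<K. s m powr a))"
      by (intro ennreal_leI) simp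
    also have "\<dots> = ennreal \<delta> + ennreal (1 / \<delta> ^ 3) * ennreal (\<Prod>m<K. s m powr a)"
      using \<delta> by (subst ennreal_plus) (auto simp: ennreal_mult[symmetric] prod_nonneg)
    also have "ennreal (\<Prod>m<K. s m powr a) = (\<Prod>m<K. moment a \<phi> c (X m) \<omega>)"
      unfolding moment_def s_def by (rule prod_ennreal[symmetric]) auto
    finally show "ennreal (?u powr (a / 4)) \<le> ennreal \<delta> + ennreal (1 / \<delta> ^ 3) * (\<Prod>m<K. moment a \<phi> c (X m) \<omega>)" .
  qed
  also have "\<dots> = ennreal \<delta> + ennreal (1 / \<delta> ^ 3) * (\<integral>\<^sup>+\<omega>. (\<Prod>m<K. moment a \<phi> c (X m) \<omega>) \<partial>P)"
    using mm prob_space.emeasure_space_1[OF rf(1)]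
    by (subst nn_integral_add) (auto simp: nn_integral_cmult)
  also have "\<dots> \<le> ennreal \<delta> + ennreal (1 / \<delta> ^ 3) * ennreal (\<sigma> ^ K)"
    using Z by (intro add_left_mono mult_left_mono) auto
  also have "\<dots> = ennreal (\<delta> + 1 / \<delta> ^ 3 * \<sigma> ^ K)"
    using \<delta> contraction_pos by (simp add: ennreal_mult[symmetric])
  also have "\<delta> + 1 / \<delta> ^ 3 * \<sigma> ^ K = 2 * \<delta>"
  proof -
    have "\<sigma> ^ K = \<delta> ^ 4" unfolding K_def \<delta>_def by (simp add: power_mult[symmetric] mult.commute)
    then show ?thesis using \<delta> by (simp add: eval_nat_numeral)
  qed
  finally show ?thesis by (simp add: \<delta>_def K'_def)
qed

text \<open>The first term comes from exits through the bottom, the second one from lateral exits.  The latter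
  carries the ellipticity factor \<open>1 / pm\<^sup>2\<close>, exponentially large in
  \<open>N * L\<close>, which \<open>\<sigma> ^ (N * N div 40)\<close> has to beat.\<close>

theorem one_step_renormalization:
  assumes dv: "40 dvd N" and \<sigma>: "\<sigma> \<le> 1"
    and pm: "0 < pm" "pm \<le> 1" "\<And>\<omega>. env_ok \<kappa> \<omega> \<Longrightarrow> pm \<le> pfront R (real N * L) M1 \<omega>"
  shows "(\<integral>\<^sup>+\<omega>. ennreal (ratio R (real N * L) M1 \<omega> powr (a / 4)) \<partial>P)
    \<le> ennreal (8 * (real N + 1) * \<sigma> ^ (N div 4) + 8 * real CARD('n) * \<sigma> ^ (N * N div 40) / pm\<^sup>2)"
proof -
  note rf = random_env_facts[OF env]
  let ?\<theta> = "a / 4"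
  let ?I = "(UNIV - {idx1 :: 'n}) \<times> {1, -1 :: real}"
  let ?h = "\<lambda>\<omega> i. hit \<omega> (tilt_box R (real N * L) M1) {z. M1 \<le> snd i * coord R (fst i) z} 0"
  have \<theta>: "0 < ?\<theta>" "?\<theta> \<le> 1" using a by auto
  have N0: "0 < N" using N by simp
  have pm2: "1 \<le> 2 / pm\<^sup>2" using pm power_le_one[of pm 2] by (simp add: le_divide_eq)
  have hm: "(\<lambda>\<omega>. ennreal (?h \<omega> i powr ?\<theta>)) \<in> borel_measurable P" for i
    unfolding rf(5) by (rule measurable_compose[OF powr_real_measurable[OF measurable_hit[OF kappa_pos] borel_measurable_const] measurable_ennreal])
  have wm: "(\<lambda>\<omega>. ennreal (weight N M1 \<omega> m powr ?\<theta>)) \<in> borel_measurable P" for m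
  proof -
    have r: "(\<lambda>\<omega>. ratio R L M (env_shift x \<omega>)) \<in> borel_measurable P" for x
      unfolding rf(5) by (rule measurable_compose[OF measurable_env_shift measurable_ratio])
    have s: "(\<lambda>\<omega>. slab_ratio M1 \<omega> k) \<in> borel_measurable P" for k
      unfolding slab_ratio_def by (rule borel_measurable_sum, rule r)
    have w: "(\<lambda>\<omega>. weight N M1 \<omega> m) \<in> borel_measurable P"
      unfolding weight_def by (rule borel_measurable_prod, rule borel_measurable_times[OF borel_measurable_const s])
    show ?thesis by (rule measurable_compose[OF powr_real_measurable[OF w borel_measurable_const] measurable_ennreal])
  qed
  have "(\<integral>\<^sup>+\<omega>. ennreal (ratio R (real N * L) M1 \<omega> powr ?\<theta>) \<partial>P)
    \<le> (\<integral>\<^sup>+\<omega>. ennreal 2 * (\<Sum>m\<in>{N..2*N}. ennreal (weight N M1 \<omega> m powr ?\<theta>))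
        + ennreal (2 / pm\<^sup>2) * (\<Sum>i\<in>?I. ennreal (?h \<omega> i powr ?\<theta>)) \<partial>P)"
  proof (rule nn_integral_mono)
    fix \<omega> assume "\<omega> \<in> space P"
    then have ok: "env_ok \<kappa> \<omega>" using rf(3) by simp
    let ?S = "\<Sum>m\<in>{N..2*N}. weight N M1 \<omega> m"
    have w0: "0 \<le> weight N M1 \<omega> m" for m using weight_pos[OF ok scale(1)] by (rule less_imp_le)
    have le: "lateral_exit N M1 \<omega> = (\<Sum>i\<in>?I. ?h \<omega> i)"
      unfolding lateral_exit_def by (rule sum.cong) auto
    have l0: "0 \<le> lateral_exit N M1 \<omega>" unfolding le by (intro sum_nonneg hit_nonneg)
    have p1: "pfront R (real N * L) M1 \<omega> \<le> 1" by (simp add: pfront_def hit_le_1)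
    have r0: "0 \<le> ratio R (real N * L) M1 \<omega>"
      unfolding ratio_def using p1 pm(1) pm(3)[OF ok] by simp
    have S0: "0 \<le> ?S" by (intro sum_nonneg w0)
    have "ratio R (real N * L) M1 \<omega> \<le> 2 * ?S + 2 * lateral_exit N M1 \<omega> / pm\<^sup>2"
      by (rule ratio_bound[OF ok scale(1) N0 pm(1) pm(3)[OF ok]])
    then have "ratio R (real N * L) M1 \<omega> powr ?\<theta> \<le> (2 * ?S + 2 * lateral_exit N M1 \<omega> / pm\<^sup>2) powr ?\<theta>"
      using \<theta> r0 by (intro powr_mono2) auto
    also have "\<dots> \<le> (2 * ?S) powr ?\<theta> + (2 * lateral_exit N M1 \<omega> / pm\<^sup>2) powr ?\<theta>"
      using \<theta> S0 l0 by (intro powr_add_le) auto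
    also have "(2 * ?S) powr ?\<theta> \<le> 2 * (\<Sum>m\<in>{N..2*N}. weight N M1 \<omega> m powr ?\<theta>)"
    proof -
      have "(2 * ?S) powr ?\<theta> = 2 powr ?\<theta> * ?S powr ?\<theta>" using S0 by (simp add: powr_mult)
      also have "\<dots> \<le> 2 * (\<Sum>m\<in>{N..2*N}. weight N M1 \<omega> m powr ?\<theta>)"
        using \<theta> powr_mono[of ?\<theta> 1 2] w0 by (intro mult_mono powr_sum_le) auto
      finally show ?thesis .
    qed
    also have "(2 * lateral_exit N M1 \<omega> / pm\<^sup>2) powr ?\<theta> \<le> 2 / pm\<^sup>2 * (\<Sum>i\<in>?I. ?h \<omega> i powr ?\<theta>)"
    proof -
      have "(2 * lateral_exit N M1 \<omega> / pm\<^sup>2) powr ?\<theta> = (2 / pm\<^sup>2) powr ?\<theta> * lateral_exit N M1 \<omega> powr ?\<theta>"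
        using l0 pm by (subst powr_mult[symmetric]) auto
      also have "\<dots> \<le> 2 / pm\<^sup>2 * (\<Sum>i\<in>?I. ?h \<omega> i powr ?\<theta>)"
        unfolding le using \<theta> powr_mono[of ?\<theta> 1 "2 / pm\<^sup>2"] pm2
        by (intro mult_mono powr_sum_le) (auto simp: hit_nonneg)
      finally show ?thesis .
    qed
    finally have "ennreal (ratio R (real N * L) M1 \<omega> powr ?\<theta>)
       \<le> ennreal (2 * (\<Sum>m\<in>{N..2*N}. weight N M1 \<omega> m powr ?\<theta>) + 2 / pm\<^sup>2 * (\<Sum>i\<in>?I. ?h \<omega> i powr ?\<theta>))"
      by (intro ennreal_leI) simp
    also have "\<dots> = ennreal (2 * (\<Sum>m\<in>{N..2*N}. weight N M1 \<omega> m powr ?\<theta>)) + ennreal (2 / pm\<^sup>2 * (\<Sum>i\<in>?I. ?h \<omega> i powr ?\<theta>))"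
      by (rule ennreal_plus; intro mult_nonneg_nonneg sum_nonneg) simp_all
    also have "\<dots> = ennreal 2 * (\<Sum>m\<in>{N..2*N}. ennreal (weight N M1 \<omega> m powr ?\<theta>)) + ennreal (2 / pm\<^sup>2) * (\<Sum>i\<in>?I. ennreal (?h \<omega> i powr ?\<theta>))"
      by (subst (1 2) ennreal_mult) (auto intro!: sum_nonneg simp: sum_ennreal)
    finally show "ennreal (ratio R (real N * L) M1 \<omega> powr ?\<theta>) \<le> \<dots>" .
  qed
  also have "\<dots> = ennreal 2 * (\<Sum>m\<in>{N..2*N}. \<integral>\<^sup>+\<omega>. ennreal (weight N M1 \<omega> m powr ?\<theta>) \<partial>P)
        + ennreal (2 / pm\<^sup>2) * (\<Sum>i\<in>?I. \<integral>\<^sup>+\<omega>. ennreal (?h \<omega> i powr ?\<theta>) \<partial>P)"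
  proof -
    have 1: "(\<lambda>\<omega>. \<Sum>m\<in>{N..2*N}. ennreal (weight N M1 \<omega> m powr ?\<theta>)) \<in> borel_measurable P"
      by (rule borel_measurable_sum, rule wm)
    have 2: "(\<lambda>\<omega>. \<Sum>i\<in>?I. ennreal (?h \<omega> i powr ?\<theta>)) \<in> borel_measurable P"
      by (rule borel_measurable_sum, rule hm)
    show ?thesis
      unfolding nn_integral_add[OF borel_measurable_times_ennreal[OF borel_measurable_const 1] borel_measurable_times_ennreal[OF borel_measurable_const 2]]
        nn_integral_cmult[OF 1] nn_integral_cmult[OF 2] nn_integral_sum[OF wm] nn_integral_sum[OF hm] ..
  qed
  also have "\<dots> \<le> ennreal 2 * (\<Sum>m\<in>{N..2*N}. ennreal (4 * \<sigma> ^ (N div 4)))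
        + ennreal (2 / pm\<^sup>2) * (\<Sum>i\<in>?I. ennreal (2 * \<sigma> ^ (N * N div 40)))"
    by (intro add_mono mult_left_mono sum_mono weight_moment[OF _ dv \<sigma>] lateral_moment[OF dv \<sigma>]) auto
  also have "\<dots> = ennreal (2 * (real (N + 1) * (4 * \<sigma> ^ (N div 4))) + 2 / pm\<^sup>2 * (real (2 * (CARD('n) - 1)) * (2 * \<sigma> ^ (N * N div 40))))"
  proof -
    have cI: "card ?I = 2 * (CARD('n) - 1)" by (simp add: card_cartesian_product)
    have cN: "card {N..2*N} = N + 1" by simp
    have s0: "0 \<le> \<sigma>" using contraction_pos by simp
    have e: "ennreal p * (of_nat n * ennreal q) = ennreal (p * (real n * q))" if "0 \<le> p" "0 \<le> q" for p q n
      using that by (simp add: ennreal_of_nat_eq_real_of_nat ennreal_mult)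
    have nn: "0 \<le> 4 * \<sigma> ^ (N div 4)" "0 \<le> 2 * \<sigma> ^ (N * N div 40)" using s0 by simp_all
    show ?thesis
      unfolding sum_constant cI cN e[OF _ nn(1), of 2, simplified] e[OF _ nn(2), of "2 / pm\<^sup>2", OF less_imp_le[OF less_le_trans[OF zero_less_one pm2]]]
        e[OF zero_le_numeral nn(1)]
      by (rule ennreal_plus[symmetric]) (use s0 in \<open>auto intro!: mult_nonneg_nonneg\<close>)
  qed
  also have "\<dots> \<le> ennreal (8 * (real N + 1) * \<sigma> ^ (N div 4) + 8 * real CARD('n) * \<sigma> ^ (N * N div 40) / pm\<^sup>2)"
  proof (rule ennreal_leI)
    have "real (2 * (CARD('n) - 1)) \<le> 2 * real CARD('n)" by simp
    then have "2 / pm\<^sup>2 * (real (2 * (CARD('n) - 1)) * (2 * \<sigma> ^ (N * N div 40))) \<le> 2 / pm\<^sup>2 * ((2 * real CARD('n)) * (2 * \<sigma> ^ (N * N div 40)))"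
      using contraction_pos by (intro mult_left_mono mult_right_mono) auto
    then show "2 * (real (N + 1) * (4 * \<sigma> ^ (N div 4))) + 2 / pm\<^sup>2 * (real (2 * (CARD('n) - 1)) * (2 * \<sigma> ^ (N * N div 40)))
      \<le> 8 * (real N + 1) * \<sigma> ^ (N div 4) + 8 * real CARD('n) * \<sigma> ^ (N * N div 40) / pm\<^sup>2"
      by (simp add: algebra_simps)
  qed
  finally show ?thesis .
qed

end

end

section \<open>Induction over scales\<close>

lemma polynomial_le_exp:
  fixes c h :: real
  assumes "h > 0"
  shows "\<exists>L0\<ge>1. \<forall>L\<ge>L0. c * L ^ m \<le> exp (h * L)"
proof -
  have "eventually (\<lambda>L. c * L ^ m \<le> exp (h * L)) at_top"
    using assms by real_asymp
  then obtain L1 where "\<forall>L\<ge>L1. c * L ^ m \<le> exp (h * L)" by (auto simp: eventually_at_top_linorder)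
  then show ?thesis by (intro exI[of _ "max 1 L1"]) auto
qed

primrec scale_L :: "nat \<Rightarrow> real \<Rightarrow> nat \<Rightarrow> real" where
  "scale_L n L 0 = L"
| "scale_L n L (Suc k) = real (n * 16 ^ k) * scale_L n L k"

primrec scale_M :: "nat \<Rightarrow> real \<Rightarrow> nat \<Rightarrow> real" where
  "scale_M n M 0 = M"
| "scale_M n M (Suc k) = real (n * 16 ^ k) ^ 3 * scale_M n M k"

text \<open>Exponential order of the moments at scale \<open>k\<close>; it equals one at the initial scale.\<close>

definition rate :: "nat \<Rightarrow> real \<Rightarrow> nat \<Rightarrow> real" where
  "rate n L k = scale_L n L k / (16 ^ k * L)"

text \<open>All polynomial factors of the induction are controlled by powers of the current length.\<close>

lemma scale_bounds:
  assumes n: "40 \<le> n" "real n \<le> L ^ 2" and L: "4 \<le> L" and M: "L \<le> M" "M \<le> L ^ 5"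
  shows "L \<le> scale_L n L k" "real (n * 16 ^ k) \<le> scale_L n L k ^ 2"
    "scale_L n L k \<le> scale_M n M k" "scale_M n M k \<le> scale_L n L k ^ 5"
proof (induction k)
  case (Suc k)
  let ?N = "real (n * 16 ^ k)" and ?L = "scale_L n L k" and ?M = "scale_M n M k"
  have "40 * 1 \<le> n * 16 ^ k" using n by (intro mult_mono) auto
  then have "real 40 \<le> ?N" unfolding of_nat_le_iff by simp
  then have N: "40 \<le> ?N" by simp
  have Lk: "4 \<le> ?L" using Suc(1) L by simp
  have "1 * ?L \<le> ?N * ?L" using N Lk by (intro mult_right_mono) auto
  then show 1: "L \<le> scale_L n L (Suc k)" using Suc(1) by simp
  have "real (n * 16 ^ Suc k) = 16 * ?N" by simp
  also have "\<dots> \<le> ?N * ?N" using N by (intro mult_right_mono) auto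
  also have "\<dots> \<le> (?N * ?L) ^ 2"
  proof -
    have "1 \<le> ?L ^ 2" using Lk by (intro one_le_power) auto
    then have "?N ^ 2 * 1 \<le> ?N ^ 2 * ?L ^ 2" by (intro mult_left_mono) auto
    then show ?thesis by (simp add: power_mult_distrib power2_eq_square mult_ac)
  qed
  finally show "real (n * 16 ^ Suc k) \<le> scale_L n L (Suc k) ^ 2" by simp
  have N3: "?N \<le> ?N ^ 3" using N by (intro self_le_power) auto
  then have "?N * ?L \<le> ?N ^ 3 * ?M" using Suc(3) N Lk by (intro mult_mono) auto
  then show "scale_L n L (Suc k) \<le> scale_M n M (Suc k)" by simp
  have "?N ^ 3 \<le> ?N ^ 5" using N by (intro power_increasing) auto
  then have "?N ^ 3 * ?M \<le> ?N ^ 5 * ?L ^ 5" using Suc(3,4) N Lk by (intro mult_mono) auto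
  then show "scale_M n M (Suc k) \<le> scale_L n L (Suc k) ^ 5" by (simp add: power_mult_distrib)
qed (use assms in auto)

lemma rate_Suc: "rate n L (Suc k) = rate n L k * real (n * 16 ^ k) / 16"
  by (simp add: rate_def mult.commute)

lemma rate_times_N: "rate n L k * real (n * 16 ^ k) = real n / L * scale_L n L k"
  by (simp add: rate_def)

text \<open>The constant \<open>c\<close> for which ellipticity costs at most \<open>exp (c * X)\<close> over
  length \<open>X\<close>, after squaring.\<close>

definition escape_exponent :: "'n::finite itself \<Rightarrow> real \<Rightarrow> real" where
  "escape_exponent _ \<kappa> = 8 * sqrt (real CARD('n)) * ln (1 / (2 * \<kappa>))"

lemma elliptic_power_ge:
  fixes \<kappa> X :: real
  assumes \<kappa>: "0 < \<kappa>" "2 * \<kappa> \<le> 1" and X: "2 \<le> X"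
  defines "pm \<equiv> (2 * \<kappa>) ^ nat \<lceil>2 * sqrt (real CARD('n::finite)) * (X + 1)\<rceil>"
  shows "0 < pm" "pm \<le> 1" "1 / pm\<^sup>2 \<le> exp (escape_exponent TYPE('n) \<kappa> * X)"
proof -
  let ?s = "sqrt (real CARD('n))" and ?k = "nat \<lceil>2 * sqrt (real CARD('n)) * (X + 1)\<rceil>"
  show pm: "0 < pm" "pm \<le> 1" unfolding pm_def using \<kappa> by (simp, intro power_le_one) auto
  have "1 \<le> CARD('n)" by (simp add: Suc_le_eq)
  then have s: "1 \<le> ?s" by simp
  have k: "real ?k \<le> 4 * ?s * X"
  proof -
    have "real ?k \<le> 2 * ?s * (X + 1) + 1" using s X by (simp add: of_nat_ceiling)
    also have "\<dots> = 2 * ?s * X + (2 * ?s + 1)" by (simp add: algebra_simps)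
    also have "2 * ?s + 1 \<le> 2 * ?s * 2" using s by linarith
    also have "2 * ?s * 2 \<le> 2 * ?s * X" using X s by (intro mult_left_mono) auto
    finally show ?thesis by (simp add: mult_ac)
  qed
  have ln: "0 \<le> ln (1 / (2 * \<kappa>))" using \<kappa> by simp
  have "1 / (2 * \<kappa>) = exp (ln (1 / (2 * \<kappa>)))" using \<kappa> by simp
  then have "1 / pm\<^sup>2 = exp (ln (1 / (2 * \<kappa>))) ^ (2 * ?k)"
    unfolding pm_def by (metis power_mult mult.commute power_one_over)
  also have "\<dots> = exp (real (2 * ?k) * ln (1 / (2 * \<kappa>)))" by (rule exp_of_nat_mult[symmetric])
  also have "\<dots> \<le> exp (escape_exponent TYPE('n) \<kappa> * X)"
  proof (rule iffD2[OF exp_le_cancel_iff])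
    have "real (2 * ?k) * ln (1 / (2 * \<kappa>)) \<le> (8 * ?s * X) * ln (1 / (2 * \<kappa>))"
      using k by (intro mult_right_mono ln) (simp add: mult_ac)
    then show "real (2 * ?k) * ln (1 / (2 * \<kappa>)) \<le> escape_exponent TYPE('n) \<kappa> * X"
      by (simp add: escape_exponent_def mult_ac)
  qed
  finally show "1 / pm\<^sup>2 \<le> exp (escape_exponent TYPE('n) \<kappa> * X)" .
qed

lemma tilted_boxesI:
  fixes R :: "((real, 'n::{finite,linorder}) vec, 'n) vec"
  assumes "0 < \<kappa>" "orthogonal_matrix R" "4 * real CARD('n) \<le> L" "4 \<le> L" "L \<le> M"
  shows "tilted_boxes \<kappa> R L M"
proof
  have s: "sqrt (real CARD('n)) \<le> real CARD('n)"
  proof -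
    have "1 \<le> CARD('n)" by (simp add: Suc_le_eq)
    then have "real CARD('n) \<le> real CARD('n) ^ 2" by (intro self_le_power) auto
    then show ?thesis by (intro real_le_lsqrt) auto
  qed
  have "2 * sqrt (real CARD('n)) * (L + 2) \<le> (2 * real CARD('n)) * (2 * L)"
    using s assms by (intro mult_mono) auto
  also have "\<dots> \<le> L * L" using assms by simp
  also have "\<dots> \<le> M * M" using assms by (intro mult_mono) auto
  finally show "2 * sqrt (real CARD('n)) * (L + 2) \<le> M\<^sup>2" by (simp add: power2_eq_square)
  have "0 < CARD('n)" by simp
  then show "real CARD('n) < L" using assms(3) by (smt (verit) of_nat_0_less_iff)
qed (use assms in auto)

text \<open>With \<open>\<sigma> = exp (- \<beta>)\<close>, both terms of the one-step bound are at most
  \<open>exp (- \<beta> * N / 8)\<close>: for the lateral term this is the condition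
  \<open>A * L \<le> \<beta> * N\<close> with \<open>A\<close> large against the ellipticity
  constant \<open>c1\<close>.  Half of this exponent absorbs the polynomial factors, the other half is the
  rate at the next scale.\<close>

lemma induction_arith:
  fixes \<beta> N L M K c1 :: real and d :: nat
  assumes N: "40 \<le> N" and \<beta>: "0 < \<beta>" "\<beta> \<le> L" and \<beta>N: "A * L \<le> \<beta> * N" and A: "40 * (c1 + 1 / 8) \<le> A" "16 \<le> A"
    and L: "4 \<le> L" and NL: "N \<le> L ^ 2" and M: "L \<le> M" "M \<le> L ^ 5" and K: "1 \<le> K"
    and poly: "(16 + 8 * real d) * (180 * K) * 12288 ^ (d - 1) * L ^ (5 + 17 * (d - 1)) \<le> exp L"
    and q: "0 \<le> q" "q \<le> exp (c1 * (N * L))"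
  shows "8 * (N + 1) * exp (- \<beta> * N / 4) + 8 * real d * (exp (- \<beta> * (N * N) / 40) * q)
    \<le> exp (- \<beta> * N / 16) / (180 * K * (N * L) * (3 * ((16 * N) ^ 3 * (N ^ 3 * M))) ^ (d - 1))"
proof -
  have L0: "0 < L" and N0: "0 < N" using L N by auto
  let ?E = "exp (- \<beta> * N / 8)"
  have 1: "exp (- \<beta> * N / 4) \<le> ?E" using \<beta> N by simp
  have c1L: "c1 * L + \<beta> / 8 \<le> \<beta> * N / 40"
  proof -
    have "40 * (c1 * L + L / 8) \<le> A * L"
      using mult_right_mono[OF A(1), of L] L0 by (simp add: algebra_simps)
    then show ?thesis using \<beta>N \<beta> by simp
  qed
  have 2: "exp (- \<beta> * (N * N) / 40) * q \<le> ?E"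
  proof -
    have "exp (- \<beta> * (N * N) / 40) * q \<le> exp (- \<beta> * (N * N) / 40) * exp (c1 * (N * L))"
      using q by (intro mult_left_mono) auto
    also have "\<dots> = exp (- N * (\<beta> * N / 40 - c1 * L))" by (simp add: exp_add[symmetric] algebra_simps)
    also have "\<dots> \<le> exp (- N * (\<beta> / 8))"
    proof (rule iffD2[OF exp_le_cancel_iff])
      have "\<beta> / 8 \<le> \<beta> * N / 40 - c1 * L" using c1L by linarith
      then have "N * (\<beta> / 8) \<le> N * (\<beta> * N / 40 - c1 * L)" using N0 by (intro mult_left_mono) auto
      then show "- N * (\<beta> * N / 40 - c1 * L) \<le> - N * (\<beta> / 8)" by simp
    qed
    finally show ?thesis by (simp add: mult.commute)
  qed
  have "8 * (N + 1) * exp (- \<beta> * N / 4) + 8 * real d * (exp (- \<beta> * (N * N) / 40) * q) \<le> 8 * (N + 1) * ?E + 8 * real d * ?E"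
    using 1 2 N by (intro add_mono mult_left_mono) auto
  also have "\<dots> = (8 * (N + 1) + 8 * real d) * ?E" by (simp add: algebra_simps)
  also have "\<dots> \<le> ((16 + 8 * real d) * L ^ 2) * ?E"
  proof (intro mult_right_mono)
    have "1 \<le> L ^ 2" using L by (intro one_le_power) auto
    then have "8 * real d * 1 \<le> 8 * real d * L ^ 2" by (intro mult_left_mono) auto
    then show "8 * (N + 1) + 8 * real d \<le> (16 + 8 * real d) * L ^ 2"
      using NL N by (simp add: algebra_simps)
  qed simp
  also have "?E = exp (- \<beta> * N / 16) * exp (- (\<beta> * N / 16))" by (simp add: exp_add[symmetric])
  finally have a: "8 * (N + 1) * exp (- \<beta> * N / 4) + 8 * real d * (exp (- \<beta> * (N * N) / 40) * q)
     \<le> exp (- \<beta> * N / 16) * (((16 + 8 * real d) * L ^ 2) * exp (- (\<beta> * N / 16)))" by (simp add: mult_ac)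
  let ?D = "180 * K * (N * L) * (3 * ((16 * N) ^ 3 * (N ^ 3 * M))) ^ (d - 1)"
  have D0: "0 < ?D" using K N0 L0 M by simp
  have "((16 + 8 * real d) * L ^ 2) * ?D \<le> exp (\<beta> * N / 16)"
  proof -
    have N6: "3 * ((16 * N) ^ 3 * (N ^ 3 * M)) \<le> 12288 * L ^ 17"
    proof -
      have "3 * ((16 * N) ^ 3 * (N ^ 3 * M)) = 12288 * (N ^ 6 * M)" by (simp add: power_mult_distrib flip: power_add)
      also have "\<dots> \<le> 12288 * ((L ^ 2) ^ 6 * L ^ 5)"
        using NL M N0 L0 by (intro mult_left_mono mult_mono power_mono) auto
      also have "\<dots> = 12288 * L ^ 17" by (simp flip: power_mult power_add)
      finally show ?thesis .
    qed
    have "?D \<le> 180 * K * (L ^ 2 * L) * (12288 * L ^ 17) ^ (d - 1)"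
      using NL N0 L0 K M by (intro mult_mono power_mono N6) auto
    then have "((16 + 8 * real d) * L ^ 2) * ?D \<le> ((16 + 8 * real d) * L ^ 2) * (180 * K * (L ^ 2 * L) * (12288 * L ^ 17) ^ (d - 1))"
      using L0 by (intro mult_left_mono) auto
    also have "\<dots> = (16 + 8 * real d) * (180 * K) * 12288 ^ (d - 1) * L ^ (5 + 17 * (d - 1))"
      by (simp add: power_mult_distrib power_mult power_add eval_nat_numeral)
    also have "\<dots> \<le> exp L" by (rule poly)
    also have "\<dots> \<le> exp (\<beta> * N / 16)"
    proof -
      have "16 * L \<le> A * L" using A(2) L0 by (intro mult_right_mono) auto
      then show ?thesis using \<beta>N by simp
    qed
    finally show ?thesis .
  qed
  then have "((16 + 8 * real d) * L ^ 2) * exp (- (\<beta> * N / 16)) \<le> 1 / ?D"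
    using D0 by (simp add: exp_minus field_simps)
  then have "exp (- \<beta> * N / 16) * (((16 + 8 * real d) * L ^ 2) * exp (- (\<beta> * N / 16))) \<le> exp (- \<beta> * N / 16) * (1 / ?D)"
    by (intro mult_left_mono) auto
  with a show ?thesis by simp
qed


text \<open>Chosen such that the quantity \<open>\<sigma>\<close> of the one-step bound at scale
  \<open>k\<close> is exactly \<open>exp (- rate n L k)\<close>.\<close>

definition moment_bound :: "'n::finite itself \<Rightarrow> nat \<Rightarrow> real \<Rightarrow> real \<Rightarrow> nat \<Rightarrow> real" where
  "moment_bound _ n L M k = exp (- rate n L k) /
     (180 * lat_const TYPE('n) * scale_L n L k * (3 * (real (n * 16 ^ k) ^ 3 * scale_M n M k)) ^ (CARD('n) - 1))"

text \<open>The requirements on the constants that do not involve the environment or the direction: \<open>A\<close>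
  is the least admissible ratio of the initial \<open>N\<close> and \<open>L\<close>, and
  \<open>C0\<close> is a length beyond which exponentials beat the polynomial prefactors.\<close>

definition good_constants :: "'n::finite itself \<Rightarrow> real \<Rightarrow> real \<Rightarrow> real \<Rightarrow> real \<Rightarrow> real \<Rightarrow> real \<Rightarrow> bool" where
  "good_constants _ \<kappa> C g r A C0 \<longleftrightarrow>
     40 * (escape_exponent TYPE('n) \<kappa> + 1 / 8) \<le> A \<and> 16 \<le> A \<and>
     4 * real CARD('n) \<le> C0 \<and> 4 \<le> C0 \<and> r \<le> C0 \<and>
     (\<forall>L\<ge>C0. (16 + 8 * real CARD('n)) * (180 * lat_const TYPE('n)) * 12288 ^ (CARD('n) - 1) * L ^ (5 + 17 * (CARD('n) - 1)) \<le> exp L) \<and>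
     (\<forall>L\<ge>C0. C * (lat_const TYPE('n) * (8 * L ^ 11) ^ CARD('n) * decay_const TYPE('n) (g / 2)) \<le> exp (g * L / 2))"

lemma lat_const_ge_1: "1 \<le> lat_const TYPE('n::finite)"
  unfolding lat_const_def by (simp add: Suc_le_eq)

text \<open>The order of the moments shrinks by the factor four at each scale, which is harmless since only the
  failure probabilities, not the odds, are needed in the end.\<close>

theorem scale_induction:
  fixes R :: "((real, 'n::{finite,linorder}) vec, 'n) vec" and P :: "'n env measure"
  assumes good: "good_constants TYPE('n) \<kappa> C g r A C0"
    and \<kappa>: "0 < \<kappa>" "2 * \<kappa> \<le> 1" and Cg: "0 < C" "0 < g"
    and env: "random_environment \<kappa> P" and smg: "SMG \<kappa> r C g P" and R: "orthogonal_matrix R"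
    and L: "C0 \<le> L" and M: "L \<le> M" "M \<le> L ^ 5" and n: "40 dvd n" "0 < n" "A * L \<le> real n" "real n \<le> L ^ 2"
    and a: "0 < a" "a \<le> 1"
    and start: "(\<integral>\<^sup>+\<omega>. ennreal (ratio R L M \<omega> powr a) \<partial>P) \<le> ennreal (moment_bound TYPE('n) n L M 0)"
  shows "(\<integral>\<^sup>+\<omega>. ennreal (ratio R (scale_L n L k) (scale_M n M k) \<omega> powr (a / 4 ^ k)) \<partial>P)
    \<le> ennreal (moment_bound TYPE('n) n L M k)"
proof (induction k)
  case 0
  then show ?case using start by simp
next
  case (Suc k)
  let ?L = "scale_L n L k" and ?M = "scale_M n M k" and ?K = "lat_const TYPE('n)"
  let ?N = "n * 16 ^ k" and ?d = "CARD('n)"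
  let ?M1 = "real ?N ^ 3 * ?M" and ?\<beta> = "rate n L k"
  let ?\<epsilon> = "moment_bound TYPE('n) n L M k"
  have C0: "4 * real ?d \<le> C0" "4 \<le> C0" "r \<le> C0" "16 \<le> A" "40 * (escape_exponent TYPE('n) \<kappa> + 1 / 8) \<le> A"
    using good by (auto simp: good_constants_def)
  have L4: "4 \<le> L" using C0 L by simp
  have n40: "40 \<le> n" using n by (auto dest: dvd_imp_le)
  note sb = scale_bounds[OF n40 n(4) L4 M, of k]
  have Lk: "C0 \<le> ?L" using sb(1) L by simp
  have "40 * 1 \<le> n * 16 ^ k" using n40 by (intro mult_mono) auto
  then have N40: "40 \<le> ?N" by simp
  then have "real 40 \<le> real ?N" unfolding of_nat_le_iff .
  then have N40r: "40 \<le> real ?N" by simp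
  have K1: "1 \<le> ?K" by (rule lat_const_ge_1)
  interpret tilted_boxes \<kappa> R ?L ?M
    by (rule tilted_boxesI[OF \<kappa>(1) R]) (use C0 Lk sb in auto)
  have M10: "0 < ?M1" using N40r sb(3) Lk C0 by simp
  define D where "D = 180 * ?K * ?L * (3 * ?M1) ^ (?d - 1)"
  have "0 < (3 * ?M1) ^ (?d - 1)" by (rule zero_less_power) (use M10 in linarith)
  then have D: "0 < D" unfolding D_def using K1 Lk C0 by (intro mult_pos_pos) auto
  have \<epsilon>: "?\<epsilon> = exp (- ?\<beta>) / D" by (simp add: moment_bound_def D_def)
  define \<sigma> where "\<sigma> = 180 * ?K * ?L * (3 * ?M1) ^ (?d - 1) * ?\<epsilon>"
  have \<sigma>: "\<sigma> = exp (- ?\<beta>)" unfolding \<sigma>_def D_def[symmetric] \<epsilon> using D by simp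
  have \<beta>0: "0 < ?\<beta>" unfolding rate_def using Lk C0 L4 by simp
  have \<beta>L: "?\<beta> \<le> ?L"
  proof -
    have "1 \<le> (16 ^ k :: real)" by simp
    then have "1 * 1 \<le> 16 ^ k * L" using L4 by (intro mult_mono) auto
    then show ?thesis unfolding rate_def using Lk C0 by (simp add: divide_le_eq mult_le_cancel_left1)
  qed
  have mix: "C * (?K * (8 * ?M1) ^ ?d * decay_const TYPE('n) (g / 2) * exp (- g * ?L / 2)) \<le> 1"
  proof -
    have dec: "0 \<le> decay_const TYPE('n) (g / 2)" using Cg by (simp add: decay_const_def)
    have "?M1 \<le> (?L ^ 2) ^ 3 * ?L ^ 5" using sb Lk C0 by (intro mult_mono power_mono) auto
    also have "\<dots> = ?L ^ 11" by (simp flip: power_mult power_add)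
    finally have "?M1 \<le> ?L ^ 11" .
    then have "C * (?K * (8 * ?M1) ^ ?d * decay_const TYPE('n) (g / 2)) \<le> C * (?K * (8 * ?L ^ 11) ^ ?d * decay_const TYPE('n) (g / 2))"
      using K1 Cg dec M10 by (intro mult_left_mono mult_right_mono power_mono) auto
    also have "\<dots> \<le> exp (g * ?L / 2)" using good Lk unfolding good_constants_def by blast
    finally have "C * (?K * (8 * ?M1) ^ ?d * decay_const TYPE('n) (g / 2)) * exp (- (g * ?L / 2)) \<le> exp (g * ?L / 2) * exp (- (g * ?L / 2))"
      by (intro mult_right_mono) auto
    then show ?thesis by (simp add: exp_add[symmetric] mult.assoc)
  qed
  define pm where "pm = (2 * \<kappa>) ^ nat \<lceil>2 * sqrt (real ?d) * (real ?N * ?L + 1)\<rceil>"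
  have "40 * 4 \<le> real ?N * ?L" using N40r Lk C0 by (intro mult_mono) auto
  then have NL: "2 \<le> real ?N * ?L" by simp
  note pm = elliptic_power_ge[where 'n = 'n, OF \<kappa> NL, folded pm_def]
  have pmf: "pm \<le> pfront R (real ?N * ?L) ?M1 \<omega>" if "env_ok \<kappa> \<omega>" for \<omega>
  proof -
    interpret nxt: tilted_boxes \<kappa> R "real ?N * ?L" ?M1
    proof (rule tilted_boxesI[OF \<kappa>(1) R])
      have "1 * ?L \<le> real ?N * ?L" using N40r Lk C0 by (intro mult_right_mono) auto
      then show "4 * real ?d \<le> real ?N * ?L" "4 \<le> real ?N * ?L" using C0 Lk by linarith+
      show "real ?N * ?L \<le> ?M1" by (rule scale_facts[OF N40])
    qed
    show ?thesis unfolding pm_def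
      by (rule pfront_bounds(1)[OF that \<kappa>(1) R]) (use nxt.L_ge nxt.L_le_M nxt.M_sq in auto)
  qed
  have a': "0 < a / 4 ^ k" "a / 4 ^ k \<le> 1"
  proof -
    have "a \<le> 4 ^ k" using a(2) by (rule order_trans) simp
    then show "a / 4 ^ k \<le> 1" by (simp add: divide_le_eq)
  qed (use a in simp)
  have "(\<integral>\<^sup>+\<omega>. ennreal (ratio R (real ?N * ?L) ?M1 \<omega> powr (a / 4 ^ k / 4)) \<partial>P)
     \<le> ennreal (8 * (real ?N + 1) * \<sigma> ^ (?N div 4) + 8 * real ?d * \<sigma> ^ (?N * ?N div 40) / pm\<^sup>2)"
  proof (rule one_step_renormalization[OF refl \<sigma>_def env smg Cg _ N40 a' Suc.IH _ mix])
    show "r \<le> ?L" using C0 Lk by simp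
    show "0 < ?\<epsilon>" unfolding \<epsilon> using D by simp
    show "40 dvd ?N" using n(1) by simp
    show "\<sigma> \<le> 1" unfolding \<sigma> using \<beta>0 by simp
  qed (use pm pmf in auto)
  also have "\<dots> \<le> ennreal (moment_bound TYPE('n) n L M (Suc k))"
  proof (rule ennreal_leI)
    obtain q where q: "?N = 40 * q" using n(1) by (metis dvd_def dvd_mult2)
    have e1: "\<sigma> ^ (?N div 4) = exp (- ?\<beta> * real ?N / 4)"
      unfolding \<sigma> exp_of_nat_mult[symmetric] q by simp
    have e2: "\<sigma> ^ (?N * ?N div 40) = exp (- ?\<beta> * (real ?N * real ?N) / 40)"
      unfolding \<sigma> exp_of_nat_mult[symmetric] q by (simp add: algebra_simps)
    have e3: "moment_bound TYPE('n) n L M (Suc k) = exp (- ?\<beta> * real ?N / 16) /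
       (180 * ?K * (real ?N * ?L) * (3 * ((16 * real ?N) ^ 3 * ?M1)) ^ (?d - 1))"
    proof -
      have N': "real (n * 16 ^ Suc k) = 16 * real ?N" by simp
      show ?thesis unfolding moment_bound_def rate_Suc scale_L.simps scale_M.simps N' by simp
    qed
    have "8 * (real ?N + 1) * exp (- ?\<beta> * real ?N / 4) + 8 * real ?d * (exp (- ?\<beta> * (real ?N * real ?N) / 40) * (1 / pm\<^sup>2))
      \<le> exp (- ?\<beta> * real ?N / 16) / (180 * ?K * (real ?N * ?L) * (3 * ((16 * real ?N) ^ 3 * (real ?N ^ 3 * ?M))) ^ (?d - 1))"
    proof (rule induction_arith[OF N40r \<beta>0 \<beta>L _ C0(5,4)])
      have "A * ?L \<le> real n / L * ?L"
        using n(3) L4 Lk C0 by (intro mult_right_mono) (auto simp: le_divide_eq)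
      then show "A * ?L \<le> ?\<beta> * real ?N" by (simp only: rate_times_N)
      show "(16 + 8 * real ?d) * (180 * ?K) * 12288 ^ (?d - 1) * ?L ^ (5 + 17 * (?d - 1)) \<le> exp ?L"
        using good Lk unfolding good_constants_def by blast
      show "1 / pm\<^sup>2 \<le> exp (escape_exponent TYPE('n) \<kappa> * (real ?N * ?L))" by (rule pm(3))
    qed (use sb Lk C0 K1 in auto)
    then show "8 * (real ?N + 1) * \<sigma> ^ (?N div 4) + 8 * real ?d * \<sigma> ^ (?N * ?N div 40) / pm\<^sup>2 \<le> moment_bound TYPE('n) n L M (Suc k)"
      unfolding e1 e2 e3 by simp
  qed
  finally show ?case by (simp add: mult.commute)
qed

lemma moment_bound_le:
  fixes n :: nat
  assumes "40 \<le> n" "real n \<le> L ^ 2" "4 \<le> L" "L \<le> M" "M \<le> L ^ 5"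
  shows "moment_bound TYPE('n::finite) n L M k \<le> exp (- rate n L k)"
proof -
  note sb = scale_bounds[OF assms, of k]
  have "40 * 1 \<le> n * 16 ^ k" using assms by (intro mult_mono) auto
  then have "1 \<le> n * 16 ^ k" by linarith
  then have N: "1 \<le> real (n * 16 ^ k)" by (metis of_nat_1 of_nat_le_iff)
  have "1 * 1 \<le> real (n * 16 ^ k) ^ 3 * scale_M n M k"
    using N sb assms by (intro mult_mono one_le_power) auto
  then have 1: "1 \<le> (3 * (real (n * 16 ^ k) ^ 3 * scale_M n M k)) ^ (CARD('n) - 1)" by (intro one_le_power) simp
  have "1 * 1 * 1 \<le> (180 * lat_const TYPE('n)) * scale_L n L k * (3 * (real (n * 16 ^ k) ^ 3 * scale_M n M k)) ^ (CARD('n) - 1)"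
    using 1 sb assms lat_const_ge_1[where 'n = 'n] by (intro mult_mono) auto
  then show ?thesis
    unfolding moment_bound_def by (simp add: divide_le_eq mult_le_cancel_left1)
qed

text \<open>A probability is at most its own power of order at most one, so the fractional moments of the odds control the expectation of
  the failure probability.\<close>

theorem expected_failure_le:
  fixes R :: "((real, 'n::{finite,linorder}) vec, 'n) vec" and P :: "'n env measure"
  assumes good: "good_constants TYPE('n) \<kappa> C g r A C0"
    and \<kappa>: "0 < \<kappa>" "2 * \<kappa> \<le> 1" and Cg: "0 < C" "0 < g"
    and env: "random_environment \<kappa> P" and smg: "SMG \<kappa> r C g P" and R: "orthogonal_matrix R"
    and L: "C0 \<le> L" and M: "L \<le> M" "M \<le> L ^ 5" and n: "40 dvd n" "0 < n" "A * L \<le> real n" "real n \<le> L ^ 2"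
    and a: "0 < a" "a \<le> 1"
    and start: "(\<integral>\<^sup>+\<omega>. ennreal (ratio R L M \<omega> powr a) \<partial>P) \<le> ennreal (moment_bound TYPE('n) n L M 0)"
  shows "(\<integral>\<^sup>+\<omega>. ennreal (1 - pfront R (scale_L n L k) (scale_M n M k) \<omega>) \<partial>P) \<le> ennreal (exp (- rate n L k))"
proof -
  let ?L = "scale_L n L k" and ?M = "scale_M n M k"
  have C0: "4 * real CARD('n) \<le> C0" "4 \<le> C0" using good by (auto simp: good_constants_def)
  have L4: "4 \<le> L" using C0 L by simp
  have n40: "40 \<le> n" using n by (auto dest: dvd_imp_le)
  note sb = scale_bounds[OF n40 n(4) L4 M, of k]
  interpret tilted_boxes \<kappa> R ?L ?M
    by (rule tilted_boxesI[OF \<kappa>(1) R]) (use C0 L sb in auto)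
  have a': "0 < a / 4 ^ k" "a / 4 ^ k \<le> 1"
  proof -
    have "a \<le> 4 ^ k" using a(2) by (rule order_trans) simp
    then show "a / 4 ^ k \<le> 1" by (simp add: divide_le_eq)
  qed (use a in simp)
  have "(\<integral>\<^sup>+\<omega>. ennreal (1 - pf \<omega>) \<partial>P) \<le> (\<integral>\<^sup>+\<omega>. ennreal (ratio R ?L ?M \<omega> powr (a / 4 ^ k)) \<partial>P)"
  proof (intro nn_integral_mono ennreal_leI)
    fix \<omega> assume "\<omega> \<in> space P"
    then have ok: "env_ok \<kappa> \<omega>" using random_env_facts(3)[OF env] by simp
    have q: "0 < 1 - pf \<omega>" "1 - pf \<omega> \<le> 1" using pf_bounds[OF ok] by auto
    have "1 - pf \<omega> = (1 - pf \<omega>) powr 1" using q by simp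
    also have "\<dots> \<le> (1 - pf \<omega>) powr (a / 4 ^ k)" using q a' by (intro powr_mono') auto
    also have "\<dots> \<le> ratio R ?L ?M \<omega> powr (a / 4 ^ k)"
      using q a' fail_le_ratio[OF ok] by (intro powr_mono2) auto
    finally show "1 - pf \<omega> \<le> ratio R ?L ?M \<omega> powr (a / 4 ^ k)" .
  qed
  also have "\<dots> \<le> ennreal (moment_bound TYPE('n) n L M k)"
    by (rule scale_induction[OF assms])
  also have "\<dots> \<le> ennreal (exp (- rate n L k))"
    by (intro ennreal_leI moment_bound_le n40 n(4) L4 M)
  finally show ?thesis .
qed

lemma good_constants_exist:
  fixes C g r \<kappa> :: real
  assumes "0 < g"
  shows "\<exists>A C0. good_constants TYPE('n::finite) \<kappa> C g r A C0"
proof -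
  let ?c1 = "(16 + 8 * real CARD('n)) * (180 * lat_const TYPE('n)) * 12288 ^ (CARD('n) - 1)"
  let ?c2 = "C * (lat_const TYPE('n) * 8 ^ CARD('n) * decay_const TYPE('n) (g / 2))"
  obtain L1 where L1: "\<forall>L\<ge>L1. ?c1 * L ^ (5 + 17 * (CARD('n) - 1)) \<le> exp (1 * L)"
    using polynomial_le_exp[of 1 ?c1 "5 + 17 * (CARD('n) - 1)"] by auto
  obtain L2 where L2: "\<forall>L\<ge>L2. ?c2 * L ^ (11 * CARD('n)) \<le> exp (g / 2 * L)"
    using polynomial_le_exp[of "g / 2" ?c2 "11 * CARD('n)"] assms by auto
  let ?C0 = "Max {L1, L2, 4 * real CARD('n), 4, r}"
  have 2: "C * (lat_const TYPE('n) * (8 * L ^ 11) ^ CARD('n) * decay_const TYPE('n) (g / 2)) = ?c2 * L ^ (11 * CARD('n))" for L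
    unfolding power_mult_distrib power_mult[symmetric] by (simp only: mult_ac)
  have 3: "g * L / 2 = g / 2 * L" for L by simp
  have "good_constants TYPE('n) \<kappa> C g r (max 16 (40 * (escape_exponent TYPE('n) \<kappa> + 1 / 8))) ?C0"
    unfolding good_constants_def 2 3 using L1 L2 by auto
  then show ?thesis by blast
qed

section \<open>Stretched exponential decay of backtracking\<close>

lemma scale_L_superexponential:
  assumes "1 \<le> n" "1 \<le> L" shows "2 ^ (k * (k - 1)) \<le> scale_L n L k"
proof (induction k)
  case (Suc k)
  have e: "Suc k * (Suc k - 1) = 2 * k + k * (k - 1)"
    by (cases k) auto
  have "(2::real) ^ (Suc k * (Suc k - 1)) = 4 ^ k * 2 ^ (k * (k - 1))"
    unfolding e power_add power_mult by simp
  also have "\<dots> \<le> real (n * 16 ^ k) * scale_L n L k"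
  proof (rule mult_mono[OF _ Suc])
    have "1 * (4::real) ^ k \<le> real n * 16 ^ k" using assms by (intro mult_mono power_mono) auto
    then show "4 ^ k \<le> real (n * 16 ^ k)" by simp
  qed auto
  finally show ?case by simp
qed (use assms in simp)

text \<open>The quadratic exponent of \<open>scale_L_superexponential\<close> beats every geometric sequence.\<close>

lemma scale_L_growth:
  assumes "1 \<le> n" "1 \<le> L" "0 < \<delta>"
  shows "\<exists>k0. \<forall>k\<ge>k0. c * 256 ^ k \<le> scale_L n L k powr \<delta>"
proof (intro exI allI impI)
  fix k assume k: "nat \<lceil>9 / \<delta>\<rceil> + 1 + nat \<lceil>c\<rceil> \<le> k"
  have c: "c \<le> 2 ^ k"
  proof -
    have "c \<le> real k" using k by linarith
    also have "real k \<le> 2 ^ k" using of_nat_less_two_power[of k, where 'a = real] by simp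
    finally show ?thesis .
  qed
  have "9 / \<delta> \<le> real (k - 1)" using k by linarith
  then have k1: "9 \<le> \<delta> * real (k - 1)"
    by (simp only: pos_divide_le_eq[OF assms(3)] mult.commute[of \<delta>])
  have "c * 256 ^ k \<le> 2 ^ k * 256 ^ k" using c by (intro mult_right_mono) auto
  also have "\<dots> = (2::real) ^ (9 * k)" by (simp add: power_mult flip: power_mult_distrib)
  also have "\<dots> = 2 powr (real k * 9)" by (simp add: powr_realpow[symmetric] mult.commute)
  also have "\<dots> \<le> 2 powr (real k * (\<delta> * real (k - 1)))"
    by (intro powr_mono mult_left_mono k1) simp_all
  also have "\<dots> = (2 ^ (k * (k - 1))) powr \<delta>"
    by (simp add: powr_realpow[symmetric] powr_powr mult_ac)
  also have "\<dots> \<le> scale_L n L k powr \<delta>"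
    using scale_L_superexponential[OF assms(1,2)] assms(3) by (intro powr_mono2) auto
  finally show "c * 256 ^ k \<le> scale_L n L k powr \<delta>" .
qed

lemma scale_between:
  assumes "1 \<le> n" "1 \<le> L" "scale_L n L k0 \<le> x"
  shows "\<exists>k\<ge>k0. scale_L n L k \<le> x \<and> x < scale_L n L (Suc k)"
proof -
  obtain k1 where "\<forall>k\<ge>k1. (\<bar>x\<bar> + 1) * 256 ^ k \<le> scale_L n L k powr 1"
    using scale_L_growth[OF assms(1,2), of 1 "\<bar>x\<bar> + 1"] by auto
  then have "(\<bar>x\<bar> + 1) * 256 ^ max k1 k0 \<le> scale_L n L (max k1 k0) powr 1" by simp
  moreover have "0 < scale_L n L (max k1 k0)"
    using scale_L_superexponential[OF assms(1,2), of "max k1 k0"] by (rule less_le_trans[rotated]) simp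
  moreover have "(\<bar>x\<bar> + 1) * 1 \<le> (\<bar>x\<bar> + 1) * 256 ^ max k1 k0" by (intro mult_left_mono) auto
  ultimately have ex: "k0 \<le> max k1 k0 \<and> x < scale_L n L (max k1 k0)" by simp
  define m where "m = (LEAST m. k0 \<le> m \<and> x < scale_L n L m)"
  have m: "k0 \<le> m" "x < scale_L n L m" using LeastI[of "\<lambda>m. k0 \<le> m \<and> x < scale_L n L m", OF ex] by (auto simp: m_def)
  have "m \<noteq> k0" using m assms(3) by auto
  then obtain k where k: "m = Suc k" "k0 \<le> k" using m(1) by (cases m) auto
  have "\<not> (k0 \<le> k \<and> x < scale_L n L k)" using not_less_Least[of k "\<lambda>m. k0 \<le> m \<and> x < scale_L n L m"] k m_def by auto
  then show ?thesis using k m by auto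
qed

context tilted_boxes
begin

definition route :: "nat \<Rightarrow> real \<Rightarrow> 'n site set" where
  "route n T = {x. 0 \<le> coord R idx1 x \<and> coord R idx1 x \<le> T \<and> (\<forall>j. j \<noteq> idx1 \<longrightarrow> \<bar>coord R j x\<bar> \<le> real n * M)}"

lemma card_route_le:
  assumes "0 \<le> T"
  shows "finite (route n T)" "real (card (route n T)) \<le> lat_const TYPE('n) * ((T + 2) * (2 * (real n * M) + 2) ^ (CARD('n) - 1))"
proof -
  let ?a = "\<lambda>j :: 'n. if j = idx1 then 0 else - (real n * M)" and ?b = "\<lambda>j :: 'n. if j = idx1 then T else real n * M"
  have nM: "0 \<le> real n * M" using L_ge L_le_M by simp
  have ab: "?a j \<le> ?b j" for j using assms nM by auto
  note S = lattice_points_rotated_box[where a = ?a and b = ?b, OF orth ab]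
  have sub: "route n T \<subseteq> {z. \<forall>j. ?a j \<le> coord R j z \<and> coord R j z \<le> ?b j}"
  proof
    fix z assume z: "z \<in> route n T"
    have "?a j \<le> coord R j z \<and> coord R j z \<le> ?b j" for j
      using z by (cases "j = idx1") (auto simp: route_def abs_le_iff dest!: spec[of _ j])
    then show "z \<in> {z. \<forall>j. ?a j \<le> coord R j z \<and> coord R j z \<le> ?b j}" by blast
  qed
  show "finite (route n T)" by (rule finite_subset[OF sub S(1)])
  have "real (card (route n T)) \<le> real (card {z. \<forall>j. ?a j \<le> coord R j z \<and> coord R j z \<le> ?b j})"
    using card_mono[OF S(1) sub] by simp
  also have "\<dots> \<le> lat_const TYPE('n) * (\<Prod>j\<in>UNIV. ?b j - ?a j + 2)" by (rule S(2))
  also have "(\<Prod>j\<in>UNIV. ?b j - ?a j + 2) = (T + 2) * (2 * (real n * M) + 2) ^ (CARD('n) - 1)"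
    by (subst prod.remove[of _ idx1]) (auto simp: algebra_simps)
  finally show "real (card (route n T)) \<le> lat_const TYPE('n) * ((T + 2) * (2 * (real n * M) + 2) ^ (CARD('n) - 1))" .
qed

text \<open>As long as the crossings succeed, the walk climbs by more than \<open>L\<close> per crossing while
  staying in \<open>route\<close>; after \<open>n\<close> of them it is above level
  \<open>T\<close>.  A failure at any of the possible centres is counted with its full probability.\<close>

lemma backtrack_le:
  assumes ok: "env_ok \<kappa> \<omega>" and n: "T \<le> real n * L" and D: "L \<le> D" and T: "0 < T"
  shows "hit \<omega> {z. - D < coord R idx1 z \<and> coord R idx1 z < T} {z. coord R idx1 z \<le> - D} 0
    \<le> real n * (\<Sum>x\<in>route n T. 1 - pf (env_shift x \<omega>))"
proof -
  let ?V = "{z. - D < coord R idx1 z \<and> coord R idx1 z < T}" and ?F = "{z. coord R idx1 z \<le> - D}"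
  define w where "w = hit \<omega> ?V ?F"
  define Q where "Q = (\<Sum>x\<in>route n T. 1 - pf (env_shift x \<omega>))"
  have D0: "0 < D" using D L_ge by simp
  have p: "0 < pf (env_shift x \<omega>)" "pf (env_shift x \<omega>) < 1" for x
    using pf_bounds[OF env_ok_shift[OF ok]] by auto
  have Q0: "0 \<le> Q" unfolding Q_def by (intro sum_nonneg) (simp add: less_imp_le[OF p(2)])
  have top: "w z = 0" if "T \<le> coord R idx1 z" for z
    using that T D0 by (simp add: w_def hit_boundary)
  have main: "w x \<le> real m * Q"
    if "m \<le> n" "0 \<le> coord R idx1 x" "T - real m * L \<le> coord R idx1 x"
      "\<And>j. j \<noteq> idx1 \<Longrightarrow> \<bar>coord R j x\<bar> \<le> real (n - m) * M" for m x
    using that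
  proof (induction m arbitrary: x)
    case 0
    then show ?case using top[of x] by simp
  next
    case (Suc m)
    show ?case
    proof (cases "T \<le> coord R idx1 x")
      case True
      then show ?thesis using top[of x] Q0 by simp
    next
      case False
      have xr: "x \<in> route n T"
      proof -
        have "real (n - Suc m) * M \<le> real n * M" using L_ge L_le_M by (intro mult_right_mono) auto
        then show ?thesis using Suc.prems(2,4) False unfolding route_def by (auto intro: order_trans)
      qed
      let ?p = "pf (env_shift x \<omega>)"
      have "w x \<le> (real m * Q) * ?p + 1 * (1 - ?p)"
      proof (rule walk_comparison[OF ok])
        fix z assume z: "coord R idx1 x - (L - 1) < coord R idx1 z"
        show "w z \<le> mean_step \<omega> w z"
        proof (cases "z \<in> ?V")
          case True
          then show ?thesis unfolding w_def using hit_harmonic[OF ok kappa_pos] by simp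
        next
          case False
          then have "T \<le> coord R idx1 z" using z Suc.prems(2) D by auto
          then have "w z = 0" by (rule top)
          also have "\<dots> \<le> mean_step \<omega> w z"
            unfolding mean_step_def w_def
            by (intro sum_nonneg mult_nonneg_nonneg hit_nonneg less_imp_le[OF env_pos[OF ok kappa_pos]])
          finally show ?thesis .
        qed
      next
        fix z assume z: "coord R idx1 x + L + 1 \<le> coord R idx1 z"
          and zj: "\<And>j. j \<noteq> idx1 \<Longrightarrow> \<bar>coord R j z - coord R j x\<bar> < M"
        show "w z \<le> real m * Q"
        proof (rule Suc.IH)
          show "m \<le> n" using Suc.prems(1) by simp
          show "0 \<le> coord R idx1 z" using z Suc.prems(2) L_ge by simp
          show "T - real m * L \<le> coord R idx1 z" using z Suc.prems(3) by (simp add: algebra_simps)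
          fix j :: 'n assume j: "j \<noteq> idx1"
          have nm: "n - m = Suc (n - Suc m)" using Suc.prems(1) by simp
          have "\<bar>coord R j z\<bar> \<le> real (n - Suc m) * M + M" using Suc.prems(4)[OF j] zj[OF j] by linarith
          also have "\<dots> = real (n - m) * M" unfolding nm of_nat_Suc by (simp add: algebra_simps)
          finally show "\<bar>coord R j z\<bar> \<le> real (n - m) * M" .
        qed
      next
        fix z show "w z \<le> 1" by (simp add: w_def hit_le_1)
      qed
      also have "\<dots> \<le> (real m * Q) * 1 + Q"
      proof (rule add_mono)
        show "(real m * Q) * ?p \<le> (real m * Q) * 1" using p[of x] Q0 by (intro mult_left_mono) auto
        have "1 - ?p \<le> Q" unfolding Q_def
          by (rule member_le_sum[OF xr]) (use card_route_le(1)[of T n] T in \<open>auto simp: less_imp_le[OF p(2)]\<close>)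
        then show "1 * (1 - ?p) \<le> Q" by simp
      qed
      finally show ?thesis by (simp add: algebra_simps)
    qed
  qed
  have "w 0 \<le> real n * Q" by (rule main) (use n in auto)
  then show ?thesis by (simp add: w_def Q_def)
qed

lemma expected_backtrack_le:
  fixes P :: "'n env measure"
  assumes env: "random_environment \<kappa> P" and n: "T \<le> real n * L" and D: "L \<le> D" and T: "0 < T"
    and e: "(\<integral>\<^sup>+\<omega>. ennreal (1 - pf \<omega>) \<partial>P) \<le> ennreal e" "0 \<le> e"
  shows "(\<integral>\<^sup>+\<omega>. ennreal (hit \<omega> {z. - D < coord R idx1 z \<and> coord R idx1 z < T} {z. coord R idx1 z \<le> - D} 0) \<partial>P)
    \<le> ennreal (real n * (lat_const TYPE('n) * ((T + 2) * (2 * (real n * M) + 2) ^ (CARD('n) - 1))) * e)"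
proof -
  note rf = random_env_facts[OF env]
  have m: "(\<lambda>\<omega>. ennreal (1 - pf \<omega>)) \<in> borel_measurable (conf_space \<kappa> UNIV)"
    by (rule measurable_compose[OF borel_measurable_diff[OF measurable_const measurable_pfront] measurable_ennreal]) simp
  have m': "(\<lambda>\<omega>. ennreal (1 - pf (env_shift x \<omega>))) \<in> borel_measurable P" for x
    unfolding rf(5) by (rule measurable_compose[OF measurable_env_shift m])
  have "(\<integral>\<^sup>+\<omega>. ennreal (hit \<omega> {z. - D < coord R idx1 z \<and> coord R idx1 z < T} {z. coord R idx1 z \<le> - D} 0) \<partial>P)
    \<le> (\<integral>\<^sup>+\<omega>. ennreal (real n) * (\<Sum>x\<in>route n T. ennreal (1 - pf (env_shift x \<omega>))) \<partial>P)"
  proof (rule nn_integral_mono)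
    fix \<omega> assume "\<omega> \<in> space P"
    then have ok: "env_ok \<kappa> \<omega>" using rf(3) by simp
    have q: "0 \<le> 1 - pf (env_shift x \<omega>)" for x
      using pf_bounds[OF env_ok_shift[OF ok]] by (simp add: less_imp_le)
    have "ennreal (hit \<omega> {z. - D < coord R idx1 z \<and> coord R idx1 z < T} {z. coord R idx1 z \<le> - D} 0)
      \<le> ennreal (real n * (\<Sum>x\<in>route n T. 1 - pf (env_shift x \<omega>)))"
      by (rule ennreal_leI[OF backtrack_le[OF ok n D T]])
    also have "\<dots> = ennreal (real n) * (\<Sum>x\<in>route n T. ennreal (1 - pf (env_shift x \<omega>)))"
      by (subst ennreal_mult) (auto intro!: sum_nonneg q simp: sum_ennreal[OF q])
    finally show "ennreal (hit \<omega> {z. - D < coord R idx1 z \<and> coord R idx1 z < T} {z. coord R idx1 z \<le> - D} 0)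
      \<le> ennreal (real n) * (\<Sum>x\<in>route n T. ennreal (1 - pf (env_shift x \<omega>)))" .
  qed
  also have "\<dots> = ennreal (real n) * (\<Sum>x\<in>route n T. \<integral>\<^sup>+\<omega>. ennreal (1 - pf (env_shift x \<omega>)) \<partial>P)"
    using m' by (subst nn_integral_cmult, intro borel_measurable_sum m', subst nn_integral_sum) simp_all
  also have "\<dots> = ennreal (real n) * (\<Sum>x\<in>route n T. \<integral>\<^sup>+\<omega>. ennreal (1 - pf \<omega>) \<partial>P)"
    using stationary_integral[OF env m] by simp
  also have "\<dots> \<le> ennreal (real n) * (\<Sum>x\<in>route n T. ennreal e)"
    by (intro mult_left_mono sum_mono e) simp
  also have "\<dots> = ennreal (real n * real (card (route n T)) * e)"
    using e(2) by (simp add: ennreal_mult ennreal_of_nat_eq_real_of_nat mult.assoc)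
  also have "\<dots> \<le> ennreal (real n * (lat_const TYPE('n) * ((T + 2) * (2 * (real n * M) + 2) ^ (CARD('n) - 1))) * e)"
    using card_route_le(2)[of T n] T e(2) by (intro ennreal_leI mult_right_mono mult_left_mono) auto
  finally show ?thesis .
qed

end

lemma stretched_exp_dominates:
  fixes c \<gamma> :: real
  assumes "0 < \<gamma>" shows "eventually (\<lambda>T. c * T ^ m \<le> exp (T powr \<gamma>)) at_top"
  using assms by real_asymp

text \<open>The scale \<open>k\<close> is the one with
  \<open>scale_L n L k \<le> b * T < scale_L n L (Suc k)\<close>.  The loss of \<open>256 ^ k\<close>
  between the rate and a power of \<open>T\<close> is negligible by \<open>scale_L_growth\<close>.\<close>

lemma rate_ge_power:
  assumes n: "1 \<le> n" and L: "1 \<le> L" and b: "0 < b" "b \<le> 1" and \<gamma>: "0 < \<gamma>" "\<gamma> < 1"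
    and T: "0 < T" "b * T < scale_L n L (Suc k)"
    and k: "2 * (real n / b) * L * 256 ^ k \<le> scale_L n L k powr (1 - \<gamma>)"
  shows "2 * T powr \<gamma> \<le> rate n L k"
proof -
  let ?L = "scale_L n L k"
  define y where "y = real n / b * 16 ^ k"
  have L0: "0 < ?L" using scale_L_superexponential[OF n L, of k] by (rule less_le_trans[rotated]) simp
  have "b * 1 \<le> real n * 16 ^ k" using n b by (intro mult_mono) auto
  then have y: "1 \<le> y" using b by (simp add: y_def le_divide_eq)
  have "T \<le> y * ?L" using T(2) b by (simp add: y_def field_simps)
  then have "T powr \<gamma> \<le> (y * ?L) powr \<gamma>" using T \<gamma> by (intro powr_mono2) auto
  also have "\<dots> = y powr \<gamma> * ?L powr \<gamma>" using y L0 by (simp add: powr_mult)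
  also have "\<dots> \<le> y * ?L powr \<gamma>" using powr_mono[of \<gamma> 1 y] y \<gamma> by (intro mult_right_mono) auto
  finally have "2 * T powr \<gamma> * (16 ^ k * L) \<le> 2 * (y * ?L powr \<gamma>) * (16 ^ k * L)"
    using L by (intro mult_right_mono) auto
  also have "\<dots> = (2 * (real n / b) * L * (16 ^ k * 16 ^ k)) * ?L powr \<gamma>" by (simp add: y_def)
  also have "(16 ^ k * 16 ^ k :: real) = 256 ^ k" by (simp flip: power_mult_distrib)
  also have "(2 * (real n / b) * L * 256 ^ k) * ?L powr \<gamma> \<le> ?L powr (1 - \<gamma>) * ?L powr \<gamma>"
    using k by (intro mult_right_mono) auto
  also have "\<dots> = ?L" using L0 by (simp flip: powr_add)
  finally show ?thesis unfolding rate_def using L by (simp add: le_divide_eq)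
qed

lemma annealed_backtrack_le:
  fixes P :: "('n::{finite,linorder}) env measure"
  assumes \<kappa>: "0 < \<kappa>" and env: "random_environment \<kappa> P" and T: "0 < T" "0 < D"
    and h: "(\<integral>\<^sup>+\<omega>. ennreal (hit \<omega> {z. - D < coord R idx1 z \<and> coord R idx1 z < T} {z. coord R idx1 z \<le> - D} 0) \<partial>P) \<le> ennreal e" "0 \<le> e"
  shows "measure (annealed P 0) {X \<in> space path_space. down_time (- D) (R *v basis_vec idx1) X < up_time T (R *v basis_vec idx1) X} \<le> e"
proof -
  note rf = random_env_facts[OF env]
  let ?V = "{z. - D < coord R idx1 z \<and> coord R idx1 z < T}" and ?F = "{z. coord R idx1 z \<le> - D}"
  have sets: "sets (annealed P 0) = sets path_space"
  proof -
    interpret prob_space P by (rule rf)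
    show ?thesis unfolding annealed_def by (rule sets_bind) (auto simp: not_empty)
  qed
  have "emeasure (annealed P 0) {X \<in> space path_space. down_time (- D) (R *v basis_vec idx1) X < up_time T (R *v basis_vec idx1) X}
    \<le> emeasure (annealed P 0) (exits ?V ?F)"
    using down_before_up_subset[of "- D" T "R *v basis_vec idx1"] T
    by (intro emeasure_mono) (simp_all add: coord_def sets)
  also have "\<dots> = (\<integral>\<^sup>+\<omega>. emeasure (quenched 0 \<omega>) (exits ?V ?F) \<partial>P)"
    by (rule emeasure_annealed[OF \<kappa> rf(2,1) exits_measurable])
  also have "\<dots> \<le> ennreal e" using h(1) by (simp add: ennreal_hit)
  finally show ?thesis using h(2) by (simp add: measure_def enn2real_leI)
qed

text \<open>For given \<open>T\<close> the largest scale not exceeding \<open>min b 1 * T\<close> is used: boxes of this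
  scale do not reach down to level \<open>- b * T\<close>, and the polynomially many boxes needed to
  climb to \<open>T\<close> are outweighed by the rate at that scale.\<close>

theorem limsup_from_scales:
  fixes R :: "((real, 'n::{finite,linorder}) vec, 'n) vec" and P :: "'n env measure"
  assumes \<kappa>: "0 < \<kappa>" and env: "random_environment \<kappa> P" and R: "orthogonal_matrix R"
    and L: "4 * real CARD('n) \<le> L" "4 \<le> L" and M: "L \<le> M" "M \<le> L ^ 5" and n: "40 \<le> n" "real n \<le> L ^ 2"
    and fail: "\<And>k. (\<integral>\<^sup>+\<omega>. ennreal (1 - pfront R (scale_L n L k) (scale_M n M k) \<omega>) \<partial>P) \<le> ennreal (exp (- rate n L k))"
    and b: "0 < b" and \<gamma>: "0 < \<gamma>" "\<gamma> < 1"
  defines "u \<equiv> R *v basis_vec idx1"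
  shows "Limsup at_top (\<lambda>T::real. ereal (T powr (- \<gamma>)) * log_ereal (measure (annealed P 0)
              {X \<in> space path_space. down_time (- b * T) u X < up_time T u X})) < 0"
proof -
  let ?d = "CARD('n)"
  let ?pr = "\<lambda>T. measure (annealed P 0) {X \<in> space path_space. down_time (- b * T) u X < up_time T u X}"
  define b' where "b' = min b 1"
  have b': "0 < b'" "b' \<le> 1" "b' \<le> b" using b by (auto simp: b'_def)
  have n1: "1 \<le> n" using n by simp
  have L1: "1 \<le> L" using L by simp
  obtain k0 where k0: "\<And>k. k \<ge> k0 \<Longrightarrow> 2 * (real n / b') * L * 256 ^ k \<le> scale_L n L k powr (1 - \<gamma>)"
    using scale_L_growth[OF n1 L1, of "1 - \<gamma>" "2 * (real n / b') * L"] \<gamma> by auto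
  define c where "c = 2 * lat_const TYPE('n) * 3 * 6 ^ (?d - 1)"
  have bound: "?pr T \<le> exp (- (T powr \<gamma>))"
    if T: "scale_L n L k0 / b' \<le> T" "1 \<le> T" and poly: "c * T ^ (2 + 6 * (?d - 1)) \<le> exp (T powr \<gamma>)" for T
  proof -
    have "scale_L n L k0 \<le> b' * T" using T(1) b' by (simp add: divide_le_eq mult.commute)
    then obtain k where k: "k \<ge> k0" "scale_L n L k \<le> b' * T" "b' * T < scale_L n L (Suc k)"
      using scale_between[OF n1 L1] by blast
    let ?L = "scale_L n L k" and ?M = "scale_M n M k"
    note sb = scale_bounds[OF n L(2) M, of k]
    interpret tilted_boxes \<kappa> R ?L ?M
      by (rule tilted_boxesI[OF \<kappa> R]) (use L sb in auto)
    have LT: "?L \<le> T"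
    proof -
      have "b' * T \<le> 1 * T" using b' T by (intro mult_right_mono) auto
      then show ?thesis using k(2) by simp
    qed
    have LbT: "?L \<le> b * T"
    proof -
      have "b' * T \<le> b * T" using b' T by (intro mult_right_mono) auto
      then show ?thesis using k(2) by simp
    qed
    define m where "m = nat \<lceil>T / ?L\<rceil>"
    have mL: "T \<le> real m * ?L"
    proof -
      have "T / ?L \<le> real m" unfolding m_def by linarith
      then show ?thesis using L_ge by (simp add: divide_le_eq)
    qed
    have mT: "real m \<le> 2 * T"
    proof -
      have "T / ?L \<le> T / 1" using L_ge T by (intro divide_left_mono) auto
      then have "real m \<le> T + 1" unfolding m_def using T by linarith
      then show ?thesis using T by simp
    qed
    have M5: "?M \<le> T ^ 5"
    proof -
      have "?L ^ 5 \<le> T ^ 5" using LT L_ge by (intro power_mono) auto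
      then show ?thesis using sb(4) by simp
    qed
    let ?e = "real m * (lat_const TYPE('n) * ((T + 2) * (2 * (real m * ?M) + 2) ^ (?d - 1))) * exp (- rate n L k)"
    have M0: "0 \<le> ?M" using L_ge L_le_M by simp
    have lc: "0 \<le> lat_const TYPE('n)" by (simp add: lat_const_def)
    have poly': "real m * (lat_const TYPE('n) * ((T + 2) * (2 * (real m * ?M) + 2) ^ (?d - 1))) \<le> c * T ^ (2 + 6 * (?d - 1))"
    proof -
      have "2 * (real m * ?M) + 2 \<le> 2 * ((2 * T) * T ^ 5) + 2 * T ^ 6"
        using mT M5 T M0 by (intro add_mono mult_left_mono mult_mono) (auto intro: one_le_power)
      also have "\<dots> = 6 * T ^ 6"
      proof -
        have T6: "T ^ 6 = T * T ^ 5" by (simp flip: power_Suc)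
        show ?thesis unfolding T6 by simp
      qed
      finally have "2 * (real m * ?M) + 2 \<le> 6 * T ^ 6" .
      then have "real m * (lat_const TYPE('n) * ((T + 2) * (2 * (real m * ?M) + 2) ^ (?d - 1)))
         \<le> (2 * T) * (lat_const TYPE('n) * ((3 * T) * (6 * T ^ 6) ^ (?d - 1)))"
        using mT T M0 lc by (intro mult_mono power_mono) auto
      also have "\<dots> = c * T ^ (2 + 6 * (?d - 1))"
        unfolding c_def power_mult_distrib power_add power_mult power2_eq_square by (simp only: mult_ac)
      finally show ?thesis .
    qed
    have e0: "0 \<le> ?e" using T M0 lc by (intro mult_nonneg_nonneg zero_le_power add_nonneg_nonneg) simp_all
    have T0: "0 < T" using T(2) by simp
    have bT0: "0 < b * T" using T0 b by simp
    have h: "(\<integral>\<^sup>+\<omega>. ennreal (hit \<omega> {z. - (b * T) < coord R idx1 z \<and> coord R idx1 z < T} {z. coord R idx1 z \<le> - (b * T)} 0) \<partial>P) \<le> ennreal ?e"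
      by (rule expected_backtrack_le[OF env mL LbT T0 fail]) simp
    have "?pr T \<le> ?e"
      using annealed_backtrack_le[OF \<kappa> env T0 bT0 h e0] unfolding u_def mult_minus_left .
    also have "\<dots> \<le> (c * T ^ (2 + 6 * (?d - 1))) * exp (- rate n L k)"
      using poly' by (intro mult_right_mono) auto
    also have "\<dots> \<le> exp (T powr \<gamma>) * exp (- (2 * T powr \<gamma>))"
    proof (intro mult_mono poly)
      have "2 * T powr \<gamma> \<le> rate n L k"
        by (rule rate_ge_power[OF n1 L1 b'(1,2) \<gamma> _ k(3) k0[OF k(1)]]) (use T in simp)
      then show "exp (- rate n L k) \<le> exp (- (2 * T powr \<gamma>))" by simp
    qed auto
    also have "\<dots> = exp (- (T powr \<gamma>))" by (simp add: exp_add[symmetric])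
    finally show ?thesis .
  qed
  have "eventually (\<lambda>T. ereal (T powr (- \<gamma>)) * log_ereal (?pr T) \<le> ereal (-1)) at_top"
    using eventually_ge_at_top[of "scale_L n L k0 / b'"] eventually_ge_at_top[of 1] stretched_exp_dominates[OF \<gamma>(1), of c "2 + 6 * (?d - 1)"]
  proof eventually_elim
    case (elim T)
    from bound[OF elim] have pr: "?pr T \<le> exp (- (T powr \<gamma>))" .
    have Tp: "0 < T powr (- \<gamma>)" using elim(2) by simp
    show ?case
    proof (cases "?pr T = 0")
      case True
      then show ?thesis using Tp by (simp add: log_ereal_def)
    next
      case False
      then have p0: "0 < ?pr T" by (simp add: less_le)
      have "ln (?pr T) \<le> ln (exp (- (T powr \<gamma>)))" by (rule iffD2[OF ln_le_cancel_iff[OF p0 exp_gt_zero] pr])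
      then have "ln (?pr T) \<le> - (T powr \<gamma>)" by (simp only: ln_exp)
      then have "T powr (- \<gamma>) * ln (?pr T) \<le> T powr (- \<gamma>) * (- (T powr \<gamma>))" using Tp by (intro mult_left_mono) auto
      also have "\<dots> = - 1" using elim(2) by (simp flip: powr_add)
      finally show ?thesis using False by (simp add: log_ereal_def)
    qed
  qed
  then have "Limsup at_top (\<lambda>T. ereal (T powr (- \<gamma>)) * log_ereal (?pr T)) \<le> ereal (-1)" by (rule Limsup_bounded)
  also have "ereal (-1) < 0" by simp
  finally show ?thesis .
qed

section \<open>Small rotations of a box\<close>

lemma walk_box_eq:
  assumes R: "orthogonal_matrix R" shows "walk_box (R, l1, l2, M) = general_box R l1 l2 M"
proof -
  have RR: "R ** transpose R = mat 1" "transpose R ** R = mat 1"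
    using R by (auto simp: orthogonal_matrix_def)
  have mem: "x \<in> (\<lambda>y. R *v y) ` Y \<longleftrightarrow> transpose R *v x \<in> Y" for x Y
  proof
    assume "x \<in> (\<lambda>y. R *v y) ` Y"
    then obtain y where y: "y \<in> Y" "x = R *v y" by blast
    then have "transpose R *v x = y" by (simp only: matrix_vector_mul_assoc RR matrix_vector_mul_lid)
    then show "transpose R *v x \<in> Y" using y(1) by simp
  next
    assume "transpose R *v x \<in> Y"
    moreover have "x = R *v (transpose R *v x)" by (simp only: matrix_vector_mul_assoc RR matrix_vector_mul_lid)
    ultimately show "x \<in> (\<lambda>y. R *v y) ` Y" by blast
  qed
  show ?thesis
    unfolding walk_box_def general_box_def prod.case mem mem_Collect_eq coord_eq[symmetric]
    by (auto simp: abs_less_iff minus_less_iff)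
qed

lemma front_boundary_eq:
  "front_boundary (R, l1, l2, M) = outer_boundary 1 (walk_box (R, l1, l2, M)) \<inter> general_front R l2 M"
  unfolding front_boundary_def general_front_def prod.case coord_def ..

lemma step_in_outer_boundary:
  assumes "x \<in> V" "e \<in> nn_steps" "x + e \<notin> V" shows "x + e \<in> outer_boundary 1 V"
proof -
  have "dist1 {x + e} V \<le> ereal (norm1 (x + e - x))"
    unfolding dist1_def using assms(1) by (simp, intro INF_lower2[of x]) auto
  then show ?thesis using assms by (simp add: outer_boundary_def nn_steps_def one_ereal_def)
qed

text \<open>Only boundary points adjacent to the box are hit at the exit, and these belong to the outer boundary.\<close>

lemma p_box_eq:
  fixes \<omega> :: "('n::{finite,linorder}) env"
  assumes ok: "env_ok \<kappa> \<omega>" "\<kappa> > 0" and R: "orthogonal_matrix R" and pos: "0 < l1" "0 < l2" "0 < M"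
  shows "p_box (R, l1, l2, M) \<omega> = hit \<omega> (general_box R l1 l2 M) (general_front R l2 M) 0"
proof -
  let ?V = "general_box R l1 l2 M" and ?F = "general_front R l2 M"
  have fin: "finite ?V"
  proof -
    have "?V \<subseteq> tilt_box R (max (l1 + 1) l2) M" by (auto simp: general_box_def tilt_box_def)
    then show ?thesis using finite_tilt_box[OF R] by (rule finite_subset)
  qed
  have z0: "0 \<in> ?V" using pos by (simp add: general_box_def)
  have le: "hit \<omega> ?V F 0 \<le> hit \<omega> ?V F' 0"
    if "\<And>x e. x \<in> ?V \<Longrightarrow> e \<in> nn_steps \<Longrightarrow> x + e \<notin> ?V \<Longrightarrow> x + e \<in> F \<Longrightarrow> x + e \<in> F'" for F F'
    by (rule comparison_principle[OF ok fin _ _ _ z0])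
       (use hit_harmonic[OF ok] that in \<open>auto simp: hit_boundary\<close>)
  show ?thesis
    unfolding p_box_eq_hit front_boundary_eq walk_box_eq[OF R]
    by (intro antisym le) (auto intro: step_in_outer_boundary)
qed

text \<open>Positivity of both \<open>p\<close> and \<open>1 - p\<close> matters: it excludes the conventional value
  zero of the odds at \<open>p = 0\<close> and of their power of order zero at \<open>p = 1\<close>.\<close>

lemma p_box_bounds:
  fixes \<omega> :: "('n::{finite,linorder}) env"
  assumes ok: "env_ok \<kappa> \<omega>" "\<kappa> > 0" and R: "orthogonal_matrix R"
    and l: "0 < l1" "0 < l2" and M: "0 < M" "2 * sqrt (real CARD('n)) * (l1 + 1) \<le> M\<^sup>2" "2 * sqrt (real CARD('n)) * (l2 + 1) \<le> M\<^sup>2"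
  shows "(2 * \<kappa>) ^ nat \<lceil>2 * sqrt (real CARD('n)) * l2\<rceil> \<le> p_box (R, l1, l2, M) \<omega>" "p_box (R, l1, l2, M) \<omega> < 1"
  unfolding p_box_eq[OF ok R l M(1)] by (rule general_front_prob_bounds[OF ok R l M])+

lemma rho_box_eq: "rho_box B \<omega> = (1 - p_box B \<omega>) / p_box B \<omega>"
  by (simp add: rho_box_def p_box_def)

text \<open>A path leaving the original box through its front leaves the slightly rotated and enlarged one through its
  front: the margins of one unit absorb the change of the coordinates.\<close>

lemma p_box_le_pfront:
  fixes \<omega> :: "('n::{finite,linorder}) env"
  assumes ok: "env_ok \<kappa> \<omega>" "\<kappa> > 0" and R: "orthogonal_matrix R" "orthogonal_matrix R'"
    and L: "2 < L" and M: "0 < M"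
    and close: "\<And>z j. \<bar>coord R idx1 z\<bar> \<le> L + 3 \<Longrightarrow> (\<And>i. i \<noteq> idx1 \<Longrightarrow> \<bar>coord R i z\<bar> \<le> M) \<Longrightarrow> \<bar>coord R' j z - coord R j z\<bar> \<le> 1"
  shows "p_box (R, L - 2, L + 2, M) \<omega> \<le> pfront R' L (M + 1) \<omega>"
proof -
  let ?V = "general_box R (L - 2) (L + 2) M" and ?F = "general_front R (L + 2) M"
  let ?V' = "tilt_box R' L (M + 1)" and ?F' = "tilt_front R' L (M + 1)"
  have p: "p_box (R, L - 2, L + 2, M) \<omega> = hit \<omega> ?V ?F 0"
    by (rule p_box_eq[OF ok R(1)]) (use L M in auto)
  have fin: "finite ?V"
  proof -
    have "?V \<subseteq> tilt_box R (L + 2) M" by (auto simp: general_box_def tilt_box_def)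
    then show ?thesis using finite_tilt_box[OF R(1)] by (rule finite_subset)
  qed
  have lat: "\<bar>coord R' j z\<bar> < M + 1"
    if "\<bar>coord R idx1 z\<bar> \<le> L + 3" "\<And>i. i \<noteq> idx1 \<Longrightarrow> \<bar>coord R i z\<bar> < M" "j \<noteq> idx1" for z j
  proof -
    have "\<bar>coord R' j z - coord R j z\<bar> \<le> 1" by (rule close[OF that(1) less_imp_le[OF that(2)]])
    then show ?thesis using that(2)[OF that(3)] by linarith
  qed
  show ?thesis
    unfolding p pfront_def
  proof (rule comparison_principle[OF ok fin])
    fix x assume x: "x \<in> ?V"
    show "hit \<omega> ?V ?F x \<le> mean_step \<omega> (hit \<omega> ?V ?F) x"
      using hit_harmonic[OF ok x, of ?F] by simp
    have c1: "\<bar>coord R idx1 x\<bar> \<le> L + 3" using x L by (auto simp: general_box_def)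
    have cj: "\<And>i. i \<noteq> idx1 \<Longrightarrow> \<bar>coord R i x\<bar> < M" using x by (simp add: general_box_def)
    show "mean_step \<omega> (hit \<omega> ?V' ?F') x \<le> hit \<omega> ?V' ?F' x"
    proof (cases "x \<in> ?V'")
      case True
      then show ?thesis using hit_harmonic[OF ok True, of ?F'] by simp
    next
      case False
      have l': "\<bar>coord R' j x\<bar> < M + 1" if "j \<noteq> idx1" for j by (rule lat[OF c1 cj that])
      have "- (L - 1) < coord R' idx1 x"
        using close[OF c1 less_imp_le[OF cj], of idx1] x by (simp add: general_box_def abs_le_iff)
      then have F': "x \<in> ?F'" using False l' by (auto simp: tilt_box_def tilt_front_def not_less)
      have "mean_step \<omega> (hit \<omega> ?V' ?F') x \<le> mean_step \<omega> (\<lambda>_. 1) x"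
        by (intro mean_step_mono[OF ok] hit_le_1)
      also have "\<dots> = 1" by (rule mean_step_const[OF ok(1)])
      also have "1 = hit \<omega> ?V' ?F' x" using False F' by (simp add: hit_boundary)
      finally show ?thesis .
    qed
  next
    fix x e assume x: "x \<in> ?V" and e: "e \<in> nn_steps" and out: "x + e \<notin> ?V"
    show "hit \<omega> ?V ?F (x + e) \<le> hit \<omega> ?V' ?F' (x + e)"
    proof (cases "x + e \<in> ?F")
      case False
      then show ?thesis using out by (simp add: hit_boundary hit_nonneg)
    next
      case True
      define z where "z = x + e"
      have st: "\<bar>coord R idx1 e\<bar> \<le> 1" by (rule abs_coord_step[OF R(1) e])
      have c1: "\<bar>coord R idx1 z\<bar> \<le> L + 3" using x st L by (auto simp: general_box_def z_def)
      have cj: "\<And>i. i \<noteq> idx1 \<Longrightarrow> \<bar>coord R i z\<bar> < M" using True by (simp add: general_front_def z_def)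
      have "L + 2 \<le> coord R idx1 z" using True by (simp add: general_front_def z_def)
      then have "L + 1 \<le> coord R' idx1 z"
        using close[OF c1 less_imp_le[OF cj], of idx1] by (simp add: abs_le_iff)
      then have "z \<in> ?F'" "z \<notin> ?V'" using lat[OF c1 cj] by (auto simp: tilt_box_def tilt_front_def)
      then have "hit \<omega> ?V' ?F' z = 1" by (simp add: hit_boundary)
      then show ?thesis using hit_le_1[of \<omega> ?V ?F "x + e"] by (simp add: z_def)
    qed
  next
    show "0 \<in> ?V" using L M by (simp add: general_box_def)
  qed
qed

definition reflect :: "real ^ 'n::finite \<Rightarrow> real ^ 'n \<Rightarrow> real ^ 'n" where
  "reflect m x = x - (2 * (m \<bullet> x)) *\<^sub>R m"

lemma linear_reflect: "linear (reflect m)"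
  by (rule linearI) (simp_all add: reflect_def inner_simps algebra_simps)

lemma norm_reflect: "norm m = 1 \<Longrightarrow> norm (reflect m x) = norm x"
proof -
  assume "norm m = 1"
  then have m: "m \<bullet> m = 1" by (simp add: norm_eq_1)
  have "reflect m x \<bullet> reflect m x = x \<bullet> x"
    unfolding reflect_def inner_diff_left inner_diff_right inner_scaleR_left inner_scaleR_right m
    by (simp add: inner_commute)
  then show ?thesis by (simp add: norm_eq_sqrt_inner)
qed

lemma reflect_reflect: "norm m = 1 \<Longrightarrow> reflect m (reflect m x) = x"
  by (simp add: reflect_def inner_simps norm_eq_1 algebra_simps)

text \<open>The composition of the reflections along \<open>l\<close> and along the bisector of
  \<open>l\<close> and \<open>l'\<close>; it maps \<open>l\<close> to \<open>l'\<close>, and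
  it is close to the identity since the two reflections nearly cancel.\<close>

lemma rotation_near_identity:
  fixes l l' :: "real ^ 'n::finite"
  assumes l: "norm l = 1" "norm l' = 1" and d: "norm (l' - l) \<le> \<delta>" "\<delta> < 1"
  shows "\<exists>S. orthogonal_matrix S \<and> S *v l = l' \<and> (\<forall>x. norm (S *v x - x) \<le> 4 * \<delta> * norm x)"
proof -
  define m where "m = l + l'"
  have m2: "m = 2 *\<^sub>R l + (l' - l)" by (simp add: m_def scaleR_2)
  have nm: "\<bar>norm m - 2\<bar> \<le> norm (l' - l)"
    using norm_triangle_ineq3[of m "2 *\<^sub>R l"] l(1) by (simp add: m2)
  then have m0: "0 < norm m" using d by linarith
  define h where "h = (1 / norm m) *\<^sub>R m"
  have h1: "norm h = 1" using m0 by (simp add: h_def)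
  have hl: "norm (h - l) \<le> \<delta>"
  proof -
    have "norm (h - (1/2) *\<^sub>R m) = \<bar>1 / norm m - 1/2\<bar> * norm m"
      unfolding h_def scaleR_left_diff_distrib[symmetric] by simp
    also have "\<dots> = \<bar>(1 / norm m - 1/2) * norm m\<bar>" by (simp add: abs_mult)
    also have "(1 / norm m - 1/2) * norm m = (2 - norm m) / 2" using m0 by (simp add: field_simps)
    also have "\<bar>(2 - norm m) / 2\<bar> \<le> \<delta> / 2" using nm d by simp
    finally have 1: "norm (h - (1/2) *\<^sub>R m) \<le> \<delta> / 2" .
    have "(1/2) *\<^sub>R m - l = (1/2) *\<^sub>R (l' - l)" by (simp add: m2 scaleR_add_right)
    then have 2: "norm ((1/2) *\<^sub>R m - l) \<le> \<delta> / 2" using d by simp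
    have "norm (h - l) \<le> norm (h - (1/2) *\<^sub>R m) + norm ((1/2) *\<^sub>R m - l)"
      using norm_triangle_ineq[of "h - (1/2) *\<^sub>R m" "(1/2) *\<^sub>R m - l"] by simp
    then show ?thesis using 1 2 by simp
  qed
  let ?f = "reflect h \<circ> reflect l"
  have lin: "linear ?f" by (intro linear_compose linear_reflect)
  have orth: "orthogonal_transformation ?f"
    unfolding orthogonal_transformation using lin l(1) h1 by (simp add: norm_reflect)
  define S where "S = matrix ?f"
  have S: "S *v x = reflect h (reflect l x)" for x
    using matrix_works[OF lin[folded linear_matrix_vector_mul_eq]] lin unfolding S_def by (simp add: matrix_works)
  have ll: "l \<bullet> l = 1" "l' \<bullet> l' = 1" using l by (simp_all add: norm_eq_1)
  have "S *v l = l'"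
  proof -
    have "reflect l l = - l" by (simp add: reflect_def ll scaleR_2)
    moreover have "reflect h (- l) = l'"
    proof -
      have mm: "(norm m)\<^sup>2 = 2 * (m \<bullet> l)"
        unfolding power2_norm_eq_inner m_def by (simp add: inner_simps ll inner_commute)
      have "reflect h (- l) = - l + (2 * (m \<bullet> l) / (norm m)\<^sup>2) *\<^sub>R m"
        by (simp add: reflect_def h_def power2_eq_square)
      also have "2 * (m \<bullet> l) / (norm m)\<^sup>2 = 1" using m0 by (simp flip: mm)
      finally show ?thesis by (simp add: m_def)
    qed
    ultimately show ?thesis by (simp add: S)
  qed
  moreover have "orthogonal_matrix S" using orth by (simp add: S_def orthogonal_transformation_matrix)
  moreover have "norm (S *v x - x) \<le> 4 * \<delta> * norm x" for x
  proof -
    have "S *v x - x = reflect h (reflect l x) - reflect h (reflect h x)" by (simp add: S reflect_reflect[OF h1])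
    also have "\<dots> = reflect h (reflect l x - reflect h x)" by (rule linear_diff[OF linear_reflect, symmetric])
    finally have "norm (S *v x - x) = norm (reflect l x - reflect h x)" by (simp add: norm_reflect[OF h1])
    also have "reflect l x - reflect h x = 2 *\<^sub>R ((h \<bullet> x) *\<^sub>R (h - l) + ((h - l) \<bullet> x) *\<^sub>R l)"
      by (simp add: reflect_def algebra_simps inner_diff_left)
    also have "norm \<dots> \<le> 2 * (\<bar>h \<bullet> x\<bar> * norm (h - l) + \<bar>(h - l) \<bullet> x\<bar> * norm l)"
      using norm_triangle_ineq[of "(h \<bullet> x) *\<^sub>R (h - l)" "((h - l) \<bullet> x) *\<^sub>R l"] by simp
    also have "\<dots> \<le> 2 * ((norm h * norm x) * \<delta> + (\<delta> * norm x) * 1)"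
    proof (intro mult_left_mono add_mono mult_mono)
      show "\<bar>h \<bullet> x\<bar> \<le> norm h * norm x" by (rule Cauchy_Schwarz_ineq2)
      have "\<bar>(h - l) \<bullet> x\<bar> \<le> norm (h - l) * norm x" by (rule Cauchy_Schwarz_ineq2)
      also have "\<dots> \<le> \<delta> * norm x" using hl by (intro mult_right_mono) auto
      finally show "\<bar>(h - l) \<bullet> x\<bar> \<le> \<delta> * norm x" .
      show "0 \<le> \<delta> * norm x" using order_trans[OF norm_ge_zero hl] by simp
    qed (use hl l h1 in auto)
    also have "\<dots> = 4 * \<delta> * norm x" using h1 by simp
    finally show ?thesis .
  qed
  ultimately show ?thesis by blast
qed

section \<open>The effective criterion\<close>

text \<open>The initial number of slabs is of order \<open>A * L\<close>, so the factor
  \<open>(N ^ 3 * M) ^ (d - 1) * L\<close> of the one-step bound is covered by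
  \<open>M ^ (d - 1) * L ^ (4 * (d - 1) + 1)\<close>.\<close>

lemma start_arith:
  fixes L M A K n :: real and d :: nat
  assumes L: "1 \<le> L" and M: "1 \<le> M" and K: "1 \<le> K" and n: "0 \<le> n" "n \<le> 80 * A * L" and A: "1 \<le> A"
    and I: "(1 + 180 * K * exp 1 * (6 * (80 * A) ^ 3) ^ (d - 1)) * M ^ (d - 1) * L ^ (4 * (d - 1) + 1) * I < 1"
    and I0: "0 \<le> I"
    and n0: "0 < n"
  shows "I \<le> exp (- 1) / (180 * K * L * (3 * (n ^ 3 * (M + 1))) ^ (d - 1))"
proof -
  let ?D = "180 * K * L * (3 * (n ^ 3 * (M + 1))) ^ (d - 1)"
  let ?C = "1 + 180 * K * exp 1 * (6 * (80 * A) ^ 3) ^ (d - 1)"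
  let ?B = "M ^ (d - 1) * L ^ (4 * (d - 1) + 1)"
  have D0: "0 < ?D" using L M K n0 by (intro mult_pos_pos zero_less_power add_pos_pos) auto
  have "3 * (n ^ 3 * (M + 1)) \<le> 3 * ((80 * A * L) ^ 3 * (2 * M))"
    using n M by (intro mult_left_mono mult_mono power_mono) auto
  also have "\<dots> = 6 * (80 * A) ^ 3 * (L ^ 3 * M)" by (simp add: power_mult_distrib)
  finally have "(3 * (n ^ 3 * (M + 1))) ^ (d - 1) \<le> (6 * (80 * A) ^ 3 * (L ^ 3 * M)) ^ (d - 1)"
    using n M by (intro power_mono) auto
  also have "\<dots> = (6 * (80 * A) ^ 3) ^ (d - 1) * (L ^ (3 * (d - 1)) * M ^ (d - 1))"
    by (simp only: power_mult_distrib power_mult)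
  finally have p: "(3 * (n ^ 3 * (M + 1))) ^ (d - 1) \<le> (6 * (80 * A) ^ 3) ^ (d - 1) * (L ^ (3 * (d - 1)) * M ^ (d - 1))" .
  have "?D * exp 1 \<le> (180 * K * L * ((6 * (80 * A) ^ 3) ^ (d - 1) * (L ^ (3 * (d - 1)) * M ^ (d - 1)))) * exp 1"
    using p L K by (intro mult_right_mono mult_left_mono) auto
  also have "\<dots> = (180 * K * exp 1 * (6 * (80 * A) ^ 3) ^ (d - 1)) * (M ^ (d - 1) * L ^ (3 * (d - 1) + 1))"
    by (simp only: power_add power_one_right mult_ac)
  also have "\<dots> \<le> ?C * ?B"
  proof (intro mult_mono)
    show "L ^ (3 * (d - 1) + 1) \<le> L ^ (4 * (d - 1) + 1)" using L by (intro power_increasing) auto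
  qed (use L M K A in auto)
  finally have 1: "?D * exp 1 \<le> ?C * ?B" .
  have "I * (?D * exp 1) \<le> I * (?C * ?B)" using 1 I0 by (rule mult_left_mono)
  also have "\<dots> < 1" using I by (simp only: mult_ac)
  finally have "I * ?D * exp 1 \<le> 1" by (simp only: mult.assoc less_imp_le)
  then have "I * ?D \<le> exp (- 1)" by (simp add: exp_minus field_simps)
  then show ?thesis using D0 by (simp add: le_divide_eq)
qed

theorem theorem3p1:
  fixes \<kappa> C g r :: real
  assumes "CARD('n::{finite,linorder}) \<ge> 2"
    and "0 < \<kappa>" and "\<kappa> < 1 / (4 * real CARD('n))"
    and "C > 0" and "g > 0" and "r \<ge> 1"
  shows "\<exists>C'>0. \<exists>C''>0. \<forall>(l :: (real, 'n) vec) (P :: 'n env measure).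
    l \<in> sphere 0 1 \<longrightarrow> random_environment \<kappa> P \<longrightarrow> SMG \<kappa> r C g P \<longrightarrow>
    (INF (R, L, M, a) \<in> {(R, L, M, a).
          is_box_spec l (R, L - 2, L + 2, M) \<and> L \<ge> C'' \<and> L \<le> M \<and> M < L ^ 4 \<and> a \<in> {0..1}}.
        ereal (C' * M ^ (CARD('n) - 1) * L ^ (4 * (CARD('n) - 1) + 1) *
          (\<integral>\<omega>. rho_box (R, L - 2, L + 2, M) \<omega> powr a \<partial>P))) < 1 \<longrightarrow>
    T_prime P l"
proof -
  let ?d = "CARD('n)" and ?K = "lat_const TYPE('n)"
  have d2: "2 \<le> real ?d" using assms(1) by (metis of_nat_le_iff of_nat_numeral)
  have \<kappa>: "0 < \<kappa>" "2 * \<kappa> \<le> 1"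
  proof -
    have "1 / (4 * real ?d) \<le> 1 / 8" using d2 by (intro divide_left_mono) auto
    then show "2 * \<kappa> \<le> 1" using assms(3) by linarith
  qed (rule assms)
  obtain A C0 where good: "good_constants TYPE('n) \<kappa> C g r A C0"
    using good_constants_exist[OF assms(5), where 'n = 'n] by blast
  then have A16: "16 \<le> A" and C0: "4 * real ?d \<le> C0" "4 \<le> C0" by (auto simp: good_constants_def)
  define A' where "A' = nat \<lceil>A\<rceil>"
  have A': "A \<le> real A'" "1 \<le> real A'" using A16 unfolding A'_def by linarith+
  define C1 where "C1 = 1 + 180 * ?K * exp 1 * (6 * (80 * real A') ^ 3) ^ (?d - 1)"
  define C2 where "C2 = max C0 (80 * real A')"
  have K1: "1 \<le> ?K" by (rule lat_const_ge_1)
  have C1: "1 \<le> C1" unfolding C1_def using K1 by simp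
  have main: "T_prime P l"
    if l: "norm l = 1" and env: "random_environment \<kappa> P" and smg: "SMG \<kappa> r C g P"
      and inf: "(INF (R, L, M, a) \<in> {(R, L, M, a).
          is_box_spec l (R, L - 2, L + 2, M) \<and> L \<ge> C2 \<and> L \<le> M \<and> M < L ^ 4 \<and> a \<in> {0..1}}.
        ereal (C1 * M ^ (?d - 1) * L ^ (4 * (?d - 1) + 1) *
          (\<integral>\<omega>. rho_box (R, L - 2, L + 2, M) \<omega> powr a \<partial>P))) < 1"
    for l :: "(real, 'n) vec" and P :: "'n env measure"
  proof -
    note rf = random_env_facts[OF env]
    interpret prob_space P by (rule rf)
    obtain R L M a where spec: "is_box_spec l (R, L - 2, L + 2, M)" and L: "C2 \<le> L" and M: "L \<le> M" "M < L ^ 4"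
      and a: "0 \<le> a" "a \<le> 1"
      and less: "C1 * M ^ (?d - 1) * L ^ (4 * (?d - 1) + 1) * (\<integral>\<omega>. rho_box (R, L - 2, L + 2, M) \<omega> powr a \<partial>P) < 1"
      using inf unfolding INF_less_iff by (auto simp: one_ereal_def)
    let ?B = "(R, L - 2, L + 2, M)"
    define I where "I = (\<integral>\<omega>. rho_box ?B \<omega> powr a \<partial>P)"
    have R: "orthogonal_matrix R" and Rl: "R *v basis_vec idx1 = l"
      using spec by (auto simp: is_box_spec_def rotation_matrix_def)
    have LC0: "C0 \<le> L" and L80: "80 * real A' \<le> L" using L by (auto simp: C2_def)
    have L4: "4 \<le> L" "4 * real ?d \<le> L" using LC0 C0 by auto
    have M0: "4 \<le> M" using M L4 by simp
    have sq: "2 * sqrt (real ?d) * (L + 3) \<le> M\<^sup>2"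
    proof -
      have "real ?d \<le> real ?d ^ 2" using d2 by (intro self_le_power) auto
      then have s: "sqrt (real ?d) \<le> real ?d" by (intro real_le_lsqrt) auto
      have "2 * sqrt (real ?d) * (L + 3) \<le> (2 * real ?d) * (2 * L)" using s L4 by (intro mult_mono) auto
      also have "\<dots> \<le> L * L" using L4 by simp
      also have "\<dots> \<le> M * M" using M L4 by (intro mult_mono) auto
      finally show ?thesis by (simp add: power2_eq_square)
    qed
    have sq': "2 * sqrt (real ?d) * (L - 2 + 1) \<le> M\<^sup>2" "2 * sqrt (real ?d) * (L + 2 + 1) \<le> M\<^sup>2"
    proof -
      have "2 * sqrt (real ?d) * (L - 2 + 1) \<le> 2 * sqrt (real ?d) * (L + 3)" by (intro mult_left_mono) auto
      then show "2 * sqrt (real ?d) * (L - 2 + 1) \<le> M\<^sup>2" using sq by linarith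
      show "2 * sqrt (real ?d) * (L + 2 + 1) \<le> M\<^sup>2" using sq by (simp add: add.assoc)
    qed
    define pm where "pm = (2 * \<kappa>) ^ nat \<lceil>2 * sqrt (real ?d) * (L + 2)\<rceil>"
    have pm: "0 < pm" using \<kappa> by (simp add: pm_def)
    have pb: "pm \<le> p_box ?B \<omega>" "p_box ?B \<omega> < 1" if "env_ok \<kappa> \<omega>" for \<omega>
      unfolding pm_def by (rule p_box_bounds[OF that \<kappa>(1) R _ _ _ sq']; use L4 M0 in simp)+
    have rho: "0 < rho_box ?B \<omega>" "rho_box ?B \<omega> \<le> 1 / pm" if "env_ok \<kappa> \<omega>" for \<omega>
    proof -
      show "0 < rho_box ?B \<omega>" using pb[OF that] pm by (simp add: rho_box_eq)
      show "rho_box ?B \<omega> \<le> 1 / pm" unfolding rho_box_eq using pb[OF that] pm by (intro frac_le) auto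
    qed
    have m: "(\<lambda>\<omega>. rho_box ?B \<omega> powr a) \<in> borel_measurable P"
    proof -
      have "(\<lambda>\<omega>. p_box ?B \<omega>) \<in> borel_measurable P"
        unfolding p_box_eq_hit rf(5) by (rule measurable_hit[OF \<kappa>(1)])
      then have "(\<lambda>\<omega>. rho_box ?B \<omega>) \<in> borel_measurable P"
        unfolding rho_box_eq by (intro borel_measurable_divide borel_measurable_diff measurable_const) simp_all
      then show ?thesis by (intro powr_real_measurable measurable_const) simp_all
    qed
    have integ: "integrable P (\<lambda>\<omega>. rho_box ?B \<omega> powr a)"
    proof (rule integrable_const_bound[OF _ m, of "(1 / pm) powr a"])
      show "AE \<omega> in P. norm (rho_box ?B \<omega> powr a) \<le> (1 / pm) powr a"
      proof (rule AE_I2)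
        fix \<omega> assume "\<omega> \<in> space P"
        then have ok: "env_ok \<kappa> \<omega>" using rf(3) by simp
        have "rho_box ?B \<omega> powr a \<le> (1 / pm) powr a"
          using rho[OF ok] a by (intro powr_mono2) auto
        then show "norm (rho_box ?B \<omega> powr a) \<le> (1 / pm) powr a" by simp
      qed
    qed
    have nnI: "(\<integral>\<^sup>+\<omega>. ennreal (rho_box ?B \<omega> powr a) \<partial>P) = ennreal I"
      unfolding I_def by (rule nn_integral_eq_integral[OF integ]) simp
    have I0: "0 \<le> I" unfolding I_def by (rule integral_nonneg_AE) simp
    have less': "C1 * M ^ (?d - 1) * L ^ (4 * (?d - 1) + 1) * I < 1" using less by (simp only: I_def)
    \<comment> \<open>For \<open>a = 0\<close> the moment equals one, since the odds are positive, and the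
      bound in the hypothesis fails.\<close>
    have a0: "0 < a"
    proof (rule ccontr)
      assume "\<not> 0 < a"
      then have "a = 0" using a by simp
      have "I = (\<integral>\<omega>. 1 \<partial>P)"
        unfolding I_def
      proof (rule Bochner_Integration.integral_cong[OF refl])
        fix \<omega> assume "\<omega> \<in> space P"
        then have "0 < rho_box ?B \<omega>" using rho(1) rf(3) by simp
        then show "rho_box ?B \<omega> powr a = 1" by (simp add: \<open>a = 0\<close>)
      qed
      then have "I = 1" by (simp add: prob_space)
      have "1 * 1 * 1 \<le> C1 * M ^ (?d - 1) * L ^ (4 * (?d - 1) + 1)"
        using C1 M0 L4 by (intro mult_mono one_le_power) auto
      then show False using less' \<open>I = 1\<close> by simp
    qed
    define n where "n = 40 * A' * nat \<lceil>L\<rceil>"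
    have cL: "L \<le> real (nat \<lceil>L\<rceil>)" "real (nat \<lceil>L\<rceil>) \<le> 2 * L" using L4 by linarith+
    have rn: "real n = 40 * real A' * real (nat \<lceil>L\<rceil>)" by (simp add: n_def)
    have nL: "real n \<le> 80 * real A' * L"
      unfolding rn using mult_left_mono[OF cL(2), of "40 * real A'"] A' by simp
    have n2: "real n \<le> L ^ 2"
    proof -
      have "80 * real A' * L \<le> L * L" using L80 L4 by (intro mult_right_mono) auto
      then show ?thesis using nL by (simp add: power2_eq_square)
    qed
    have n1: "A * L \<le> real n"
    proof -
      have "A * L \<le> (40 * real A') * real (nat \<lceil>L\<rceil>)" using A' A16 cL L4 by (intro mult_mono) auto
      then show ?thesis by (simp add: rn)
    qed
    have n0: "0 < n" "40 dvd n"
    proof -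
      have "0 < A * L" using A16 L4 by simp
      then have "0 < real n" using n1 by linarith
      then show "0 < n" by simp
      show "40 dvd n" by (simp add: n_def)
    qed
    have M5: "L \<le> M + 1" "M + 1 \<le> L ^ 5"
    proof -
      have "1 \<le> L ^ 4" using L4 by (intro one_le_power) auto
      then have "M + 1 \<le> L ^ 4 * 2" using M by simp
      also have "\<dots> \<le> L ^ 4 * L" using L4 by (intro mult_left_mono) auto
      also have "\<dots> = L ^ 5" by (simp add: power_Suc2[symmetric] del: power_Suc)
      finally show "M + 1 \<le> L ^ 5" .
    qed (use M in simp)
    have Ile: "I \<le> moment_bound TYPE('n) n L (M + 1) 0"
    proof -
      have "I \<le> exp (- 1) / (180 * ?K * L * (3 * (real n ^ 3 * (M + 1))) ^ (?d - 1))"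
        by (rule start_arith[OF _ _ K1 _ nL A'(2) less'[unfolded C1_def] I0]) (use L4 M0 n0 in auto)
      then show ?thesis using L4 by (simp add: moment_bound_def rate_def)
    qed
    \<comment> \<open>Points of the box and their neighbours have norm at most \<open>d * (L + 3 + M)\<close>, so
      that a rotation of this size changes their coordinates by at most one.\<close>
    define \<delta> where "\<delta> = 1 / (4 * (real ?d * (L + 3 + M)))"
    have dLM: "1 \<le> real ?d * (L + 3 + M)"
      using mult_mono[of 1 "real ?d" 1 "L + 3 + M"] d2 L4 M0 by simp
    have \<delta>: "0 < \<delta>" "\<delta> < 1" "4 * \<delta> * (real ?d * (L + 3 + M)) = 1"
      using dLM by (auto simp: \<delta>_def divide_less_eq)
    have dir: "Limsup at_top (\<lambda>T::real. ereal (T powr (- \<gamma>)) * log_ereal (measure (annealed P 0)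
              {X \<in> space path_space. down_time (- b * T) l' X < up_time T l' X})) < 0"
      if l': "norm l' = 1" "norm (l' - l) < \<delta>" and b: "0 < b" and \<gamma>: "0 < \<gamma>" "\<gamma> < 1" for l' b \<gamma>
    proof -
      obtain S where S: "orthogonal_matrix S" "S *v l = l'" "\<And>x. norm (S *v x - x) \<le> 4 * \<delta> * norm x"
        using rotation_near_identity[OF l l'(1) less_imp_le[OF l'(2)] \<delta>(2)] by blast
      define R' where "R' = S ** R"
      have R': "orthogonal_matrix R'" unfolding R'_def by (rule orthogonal_matrix_mul[OF S(1) R])
      have R'v: "R' *v x = S *v (R *v x)" for x by (simp add: R'_def matrix_vector_mul_assoc)
      have Rl': "R' *v basis_vec idx1 = l'" by (simp add: R'v Rl S(2))
      have close: "\<bar>coord R' j z - coord R j z\<bar> \<le> 1"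
        if z: "\<bar>coord R idx1 z\<bar> \<le> L + 3" "\<And>i. i \<noteq> idx1 \<Longrightarrow> \<bar>coord R i z\<bar> \<le> M" for z j
      proof -
        let ?v = "R *v basis_vec j"
        have "norm (to_real z) \<le> (\<Sum>i\<in>UNIV. \<bar>coord R i z\<bar>)" by (rule norm_le_sum_coord[OF R])
        also have "\<dots> \<le> (\<Sum>i\<in>(UNIV :: 'n set). L + 3 + M)"
        proof (rule sum_mono)
          fix i show "\<bar>coord R i z\<bar> \<le> L + 3 + M"
            using z(1) z(2)[of i] L4 M0 by (cases "i = idx1") auto
        qed
        finally have nz: "norm (to_real z) \<le> real ?d * (L + 3 + M)" by simp
        have "\<bar>coord R' j z - coord R j z\<bar> = \<bar>to_real z \<bullet> (S *v ?v - ?v)\<bar>"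
          by (simp add: coord_def R'v inner_diff_right)
        also have "\<dots> \<le> norm (to_real z) * norm (S *v ?v - ?v)" by (rule Cauchy_Schwarz_ineq2)
        also have "\<dots> \<le> (real ?d * (L + 3 + M)) * (4 * \<delta>)"
          using nz S(3)[of ?v] norm_column[OF R, of j] dLM by (intro mult_mono) auto
        also have "\<dots> = 1" using \<delta>(3) by (simp only: mult.commute)
        finally show ?thesis .
      qed
      have start: "(\<integral>\<^sup>+\<omega>. ennreal (ratio R' L (M + 1) \<omega> powr a) \<partial>P) \<le> ennreal (moment_bound TYPE('n) n L (M + 1) 0)"
      proof -
        have "(\<integral>\<^sup>+\<omega>. ennreal (ratio R' L (M + 1) \<omega> powr a) \<partial>P) \<le> (\<integral>\<^sup>+\<omega>. ennreal (rho_box ?B \<omega> powr a) \<partial>P)"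
        proof (intro nn_integral_mono ennreal_leI powr_mono2)
          fix \<omega> assume "\<omega> \<in> space P"
          then have ok: "env_ok \<kappa> \<omega>" using rf(3) by simp
          have pp: "p_box ?B \<omega> \<le> pfront R' L (M + 1) \<omega>"
            by (rule p_box_le_pfront[OF ok \<kappa>(1) R R' _ _ close]) (use L4 M0 in auto)
          have p1: "pfront R' L (M + 1) \<omega> \<le> 1" by (simp add: pfront_def hit_le_1)
          have p0: "0 < p_box ?B \<omega>" using pb(1)[OF ok] pm by linarith
          show "ratio R' L (M + 1) \<omega> \<le> rho_box ?B \<omega>"
            unfolding ratio_def rho_box_eq using pp p1 p0 by (intro frac_le) auto
          show "0 \<le> ratio R' L (M + 1) \<omega>"
            unfolding ratio_def using pp p1 p0 by (intro divide_nonneg_pos) auto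
        qed (rule a)
        then show ?thesis using nnI ennreal_leI[OF Ile] by simp
      qed
      have n40: "40 \<le> n" using n0 by (auto dest: dvd_imp_le)
      have fail: "(\<integral>\<^sup>+\<omega>. ennreal (1 - pfront R' (scale_L n L k) (scale_M n (M + 1) k) \<omega>) \<partial>P) \<le> ennreal (exp (- rate n L k))" for k
        by (rule expected_failure_le[OF good \<kappa> assms(4,5) env smg R' LC0 M5 n0(2,1) n1 n2 a0 a(2) start])
      show ?thesis
        using limsup_from_scales[OF \<kappa>(1) env R' L4(2,1) M5 n40 n2 fail b \<gamma>] unfolding Rl' .
    qed
    show "T_prime P l"
      unfolding T_prime_def T_gamma_def
    proof (intro ballI exI conjI allI impI)
      show "openin (top_of_set (sphere 0 1)) (sphere 0 1 \<inter> ball l \<delta>)"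
        by (rule openin_open_Int) simp
      show "l \<in> sphere 0 1 \<inter> ball l \<delta>" using l \<delta>(1) by simp
      fix \<gamma> :: real and l' :: "(real, 'n) vec" and b :: real
      assume "\<gamma> \<in> {0<..<1}" "l' \<in> sphere 0 1 \<inter> ball l \<delta>" "0 < b"
      then show "Limsup at_top (\<lambda>T::real. ereal (T powr (- \<gamma>)) * log_ereal (measure (annealed P 0)
              {X \<in> space path_space. down_time (- b * T) l' X < up_time T l' X})) < 0"
        by (intro dir) (auto simp: dist_norm norm_minus_commute)
    qed
  qed
  have C1': "0 < C1" and C2': "0 < C2" using C1 C0 by (simp_all add: C2_def)
  show ?thesis
  proof (rule exI[of _ C1], rule conjI[OF C1'], rule exI[of _ C2], rule conjI[OF C2'], intro allI impI, rule main)
    show "norm l = 1" if "l \<in> sphere 0 1" for l :: "(real, 'n) vec" using that by simp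
  qed assumption+
qed

end
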